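(* Let $X$ be an infinite dimensional Banach space. Let $1\leqslant p\leqslant\infty$, $1\leqslant K$, and let $\lambda$ be a limit ordinal. (i) If $F\subset X^*$ is finite and $Y=\bigcap_{x^*\in F}\ker(x^* )$, then $I_p(X,K)>\lambda$ if and only if $I_p(Y,K)>\lambda$. (ii) If $E$ is an FDD for $X$ and if $Y=[E_n:n\geqslant m]$ and $F=(E_n)_{n\geqslant m}$ (where $m\in\mathbb{N}$), then $I_p(X,E,K)>\lambda$ if and only if $I_p(Y,F,K)>\lambda$. (iii) If $E$ is an FDD for $X$ and $Y=[E_n:n\geqslant m]$ and $F=(E_n)_{n\geqslant m}$ (where $m\in\mathbb{N}$), then $I^a_p(X,E,K)=I^a_p(Y,F,K)$. (iv) Either $I_p(X)=\infty$ or there exists an ordinal $\xi$ so that $I_p(X)=\omega^\xi$. (v) If $E$ is an FDD for $X$, either $I_p(X)=\infty$ or there exist ordinals $\alpha\leqslant\beta\leqslant\gamma\leqslant1+\alpha$ so that $I^a_p(X,E)=\omega^\alpha$, $I_p(X,E)=\omega^\beta$, and $I_p(X)=\omega^\gamma$. (vi) For any $K\geqslant1$, $I_p(X,K)<I_p(X)$ and, if $E$ is an FDD for $X$, $I_p(X,E,K)<I_p(X,E)$ and $I^a_p(X,E,K)<I^a_p(X,E)$.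
   Context: Trees: a tree is a set of finite sequences (including the empty sequence $\varnothing$) closed under initial segments. $T'$ is $T$ with its maximal members (with respect to extension) removed, $d^0(T)=T$, $d^{\xi+1}(T)=(d^\xi(T))'$, $d^\xi(T)=\bigcap_{\zeta<\xi}d^\zeta(T)$ for limit $\xi$, and $o(T)=\min\{\xi:d^\xi(T)=\varnothing\}$, with $o(T)=\infty$ if no such ordinal exists; $\xi<\infty$ for every ordinal $\xi$. An FDD for $X$ is a sequence $E=(E_n)$ of finite dimensional subspaces so that each $x\in X$ is uniquely $x=\sum x_n$ with $x_n\in E_n$; $P^E_n$ is the projection $x\mapsto x_n$, $\mathrm{supp}_E(x)=\{n:P^E_nx\neq0\}$. $[\cdot]$ denotes closed linear span. $\Sigma(E,X)$ is the set of finite block sequences: finite sequences of non-zero, finitely supported vectors with $\max\mathrm{supp}_E(x_i)<\min\mathrm{supp}_E(x_{i+1})$. $T_p(X,K)$ is the tree of all finite sequences $(x_i)_{i=1}^n$ in the unit ball $B_X$ with $K^{-1}\leqslant\|\sum_{i=1}^na_ix_i\|\leqslant1$ for all $(a_i)_{i=1}^n$ in the unit sphere of $\ell_p^n$. $T_p(X,E,K)=T_p(X,K)\cap\Sigma(E,X)$. For a tree $T$ of sequences in $X$, $d_E(T)$ is the set of $(x_i)_{i=1}^n\in T$ for which there exist vectors $(y_i)_{i\in\mathbb{N}}$ with $i\leqslant\min\mathrm{supp}_E(y_i)$ and $(x_1,\ldots,x_n,y_i)\in T$ for all $i$; $d_E^\xi$ is obtained by transfinite iteration (intersections at limits) and $o_E(T)=\min\{\xi:d_E^\xi(T)=\varnothing\}$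 (or $\infty$). Put $I_p(X,K)=o(T_p(X,K))$, $I_p(X,E,K)=o(T_p(X,E,K))$, $I^a_p(X,E,K)=o_E(T_p(X,E,K))$, and $I_p(X)=\sup_{K\geqslant1}I_p(X,K)$, $I_p(X,E)=\sup_{K\geqslant1}I_p(X,E,K)$, $I^a_p(X,E)=\sup_{K\geqslant1}I^a_p(X,E,K)$.
   Formalization: In (vi) each strict inequality is asserted only when its right-hand side (I_p(X), I_p(X,E), I^a_p(X,E) respectively) is not ∞, since e.g. for X = ℓ_p one has I_p(X,1) = ∞ = I_p(X); Banach spaces are taken over the reals. *)

theory Defs
  imports "HOL-Analysis.Analysis" "HOL-Library.Extended" "HOL-Library.Sublist"
begin

section \<open>Ordinals\<close>

text \<open>
  The ordinals of universe \<open>'u\<close>: order types of well-orders on subsets of \<open>nat + 'u\<close>, that is, the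
  ordinals below the cardinal successor of \<open>max |'u| \<aleph>\<^sub>0\<close>. This initial segment of the ordinals is
  closed under successors, under suprema of at most \<open>max |'u| \<aleph>\<^sub>0\<close> elements, and hence under
  \<open>+\<close>, \<open>*\<close> and \<open>\<omega>\<^bsup>\<xi>\<^esup>\<close>. Every well-order on any type is represented in some universe.
\<close>

quotient_type 'u ordinal = "(nat + 'u) rel" / partial: "\<lambda>r s. (r, s) \<in> ordIso"
proof (rule part_equivpI)
  show "\<exists>r :: (nat + 'u) rel. (r, r) \<in> ordIso"
    using ordIso_reflexive card_of_Well_order by blast
  show "symp (\<lambda>r s :: (nat + 'u) rel. (r, s) \<in> ordIso)"
    by (auto intro: sympI ordIso_symmetric)
  show "transp (\<lambda>r s :: (nat + 'u) rel. (r, s) \<in> ordIso)"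
    by (auto intro: transpI ordIso_transitive)
qed

instantiation ordinal :: (type) wellorder
begin

lift_definition less_eq_ordinal :: "'a ordinal \<Rightarrow> 'a ordinal \<Rightarrow> bool" is "\<lambda>r s. (r, s) \<in> ordLeq"
  by (meson ordIso_ordLeq_trans ordIso_symmetric ordLeq_ordIso_trans)

lift_definition less_ordinal :: "'a ordinal \<Rightarrow> 'a ordinal \<Rightarrow> bool" is "\<lambda>r s. (r, s) \<in> ordLess"
  by (meson ordIso_ordLess_trans ordIso_symmetric ordLess_ordIso_trans)

instance
proof
  fix x y z :: "'a ordinal"
  show "x < y \<longleftrightarrow> x \<le> y \<and> \<not> y \<le> x"
    by transfer (auto simp: ordIso_def ordLess_imp_ordLeq not_ordLess_ordLeq not_ordLeq_iff_ordLess)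
  show "x \<le> x"
    by transfer (simp add: ordIso_imp_ordLeq)
  show "x \<le> y \<Longrightarrow> y \<le> z \<Longrightarrow> x \<le> z"
    by transfer (rule ordLeq_transitive)
  show "x \<le> y \<Longrightarrow> y \<le> x \<Longrightarrow> x = y"
    by transfer (simp add: ordIso_iff_ordLeq)
  show "x \<le> y \<or> y \<le> x"
    by transfer (simp add: ordIso_def ordLeq_total)
  show "P x" if step: "\<And>x. (\<And>y. y < x \<Longrightarrow> P y) \<Longrightarrow> P x" for P :: "'a ordinal \<Rightarrow> bool"
  proof -
    have less_iff: "(rep_ordinal y, rep_ordinal z) \<in> ordLess \<longleftrightarrow> y < z" for y z :: "'a ordinal"
      by (simp add: less_ordinal.rep_eq)
    have "wf {(y, z :: 'a ordinal). y < z}"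
      by (rule wf_subset[OF wf_inv_image[OF wf_ordLess, of rep_ordinal]]) (auto simp: less_iff)
    then show "P x"
      by (induction x rule: wf_induct_rule) (auto intro: step)
  qed
qed

end

lemma ordinal_no_max: "\<exists>y. x < y" for x :: "'u ordinal"
proof -
  define r where "r = rep_ordinal x"
  have x: "x = abs_ordinal r"
    unfolding r_def by (rule Quotient3_abs_rep[OF Quotient3_ordinal, symmetric])
  have rr: "(r, r) \<in> ordIso"
    unfolding r_def by (rule Quotient3_rep_reflp[OF Quotient3_ordinal])
  then have r: "Well_order r" by (simp add: ordIso_def)
  define f :: "nat + 'u \<Rightarrow> nat + 'u" where "f = map_sum Suc id"
  define z :: "nat + 'u" where "z = Inl 0"
  define r' where "r' = dir_image r f"
  define s where "s = r' \<union> (insert z (Field r')) \<times> {z}"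
  have inj: "inj f" by (auto simp: f_def intro!: sum.inj_map)
  have rr': "(r, r') \<in> ordIso"
    unfolding r'_def using inj by (intro dir_image_ordIso r) (auto intro: inj_on_subset)
  then have r': "Well_order r'" by (auto simp: ordIso_def)
  have fz: "f x \<noteq> z" "z \<noteq> f x" for x
    by (cases x; simp add: f_def z_def)+
  have zr': "z \<notin> Field r'"
    using fz by (auto simp: r'_def dir_image_def Field_def)
  then have zr'': "(z, a) \<notin> r'" "(a, z) \<notin> r'" for a
    by (auto simp: Field_def)
  have Fs: "Field s = insert z (Field r')"
    by (auto simp: s_def Field_def)
  have wf: "wf (s - Id)"
  proof (rule wf_subset)
    have "wf (r' - Id)" using r' by (simp add: well_order_on_def)
    moreover have "wf (Field r' \<times> {z})"
      using zr' by (intro wf_subset[OF wf_measure[of "\<lambda>a. if a = z then 1 else 0"]]) auto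
    moreover have "(r' - Id) O (Field r' \<times> {z}) \<subseteq> Field r' \<times> {z}"
      by (auto simp: Field_def)
    moreover have "Domain (r' - Id) \<inter> Range (Field r' \<times> {z}) = {}"
      using zr'' by auto
    ultimately show "wf ((r' - Id) \<union> Field r' \<times> {z})"
      by (intro wf_Un) auto
  qed (auto simp: s_def)
  have lin: "Linear_order r'" using r' by (simp add: well_order_on_def)
  then have refl: "\<And>a. a \<in> Field r' \<Longrightarrow> (a, a) \<in> r'"
    and tr: "trans r'" and anti: "antisym r'"
    and tot: "\<And>a b. a \<in> Field r' \<Longrightarrow> b \<in> Field r' \<Longrightarrow> a \<noteq> b \<Longrightarrow> (a, b) \<in> r' \<or> (b, a) \<in> r'"
    by (auto simp: linear_order_on_def partial_order_on_def preorder_on_def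
        refl_on_def total_on_def)
  have "refl_on (Field s) s"
    unfolding refl_on_def Fs by (auto simp: s_def refl)
  moreover have "trans s"
  proof (rule transI)
    fix a b c assume ab: "(a, b) \<in> s" and bc: "(b, c) \<in> s"
    show "(a, c) \<in> s"
    proof (cases "c = z")
      case True
      with ab show ?thesis by (auto simp: s_def Field_def)
    next
      case False
      with bc have bc': "(b, c) \<in> r'" by (auto simp: s_def)
      with zr''(1) have "b \<noteq> z" by blast
      with ab have "(a, b) \<in> r'" by (auto simp: s_def)
      with bc' tr have "(a, c) \<in> r'" by (blast dest: transD)
      then show ?thesis by (simp add: s_def)
    qed
  qed
  moreover have "antisym s"
  proof (rule antisymI)
    fix a b assume "(a, b) \<in> s" "(b, a) \<in> s"
    then show "a = b"
      using zr'' zr' by (auto simp: s_def dest: antisymD[OF anti])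
  qed
  moreover have "total_on (Field s) s"
    unfolding total_on_def Fs using tot by (auto simp: s_def)
  moreover have "s \<subseteq> Field s \<times> Field s"
    by (auto simp: Field_def)
  ultimately have "Well_order s"
    using wf by (simp add: well_order_on_def linear_order_on_def partial_order_on_def
        preorder_on_def)
  moreover have "r' = Restr s (underS s z)"
    using zr'' zr' by (auto simp: s_def underS_def Field_def)
  ultimately have "(r', s) \<in> ordLess"
    using underS_Restr_ordLess[of s z] Fs by auto
  with rr' have "(r, s) \<in> ordLess" by (rule ordIso_ordLess_trans)
  moreover have "(s, s) \<in> ordIso"
    using \<open>Well_order s\<close> by (rule ordIso_reflexive)
  ultimately have "x < abs_ordinal s"
    unfolding x using rr by (simp add: less_ordinal.abs_eq)
  then show ?thesis ..
qed

instantiation ordinal :: (type) "{zero, one}"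
begin
definition "0 = (LEAST x :: 'a ordinal. True)"
definition "1 = (LEAST x :: 'a ordinal. 0 < x)"
instance ..
end

definition osucc :: "'u ordinal \<Rightarrow> 'u ordinal" where
  "osucc x = (LEAST y. x < y)"

definition is_limit :: "'u ordinal \<Rightarrow> bool" where
  "is_limit x \<longleftrightarrow> x \<noteq> 0 \<and> (\<forall>y. x \<noteq> osucc y)"

definition omega :: "'u ordinal" where
  "omega = (LEAST x. is_limit x)"

definition lub :: "'o::order set \<Rightarrow> 'o" where
  "lub A = (LEAST b. \<forall>a\<in>A. a \<le> b)"

lemma zero_le_ordinal: "0 \<le> x" for x :: "'u ordinal"
  unfolding zero_ordinal_def by (rule Least_le) simp

lemma less_osucc: "x < osucc x"
  unfolding osucc_def using ordinal_no_max by (rule LeastI_ex)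

lemma osucc_le_iff: "osucc x \<le> y \<longleftrightarrow> x < y"
  using less_osucc[of x] by (auto simp: osucc_def intro: Least_le)

lemma osucc_inject: "osucc x = osucc y \<longleftrightarrow> x = y"
proof
  assume eq: "osucc x = osucc y"
  have "\<not> x < y" "\<not> y < x"
    using less_osucc[of x] less_osucc[of y] eq by (simp_all flip: osucc_le_iff add: not_le)
  then show "x = y" by simp
qed simp

lemma osucc_neq_zero: "osucc x \<noteq> 0"
  using less_osucc[of x] zero_le_ordinal[of x] by auto

text \<open>Transfinite recursion: start value \<open>z\<close>, successor step \<open>s\<close>, limit step \<open>l\<close>.\<close>

function orec :: "'b \<Rightarrow> ('b \<Rightarrow> 'b) \<Rightarrow> ('b set \<Rightarrow> 'b) \<Rightarrow> 'u ordinal \<Rightarrow> 'b" where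
  "orec z s l \<xi> =
     (if \<xi> = 0 then z
      else if \<exists>\<zeta>. \<xi> = osucc \<zeta> then s (orec z s l (THE \<zeta>. \<xi> = osucc \<zeta>))
      else l ((\<lambda>\<zeta>. orec z s l \<zeta>) ` {\<zeta>. \<zeta> < \<xi>}))"
  by auto
termination
  by (relation "inv_image {(x, y). x < y} (\<lambda>(z, s, l, \<xi>). \<xi>)")
    (auto simp: osucc_inject less_osucc intro: wf)

declare orec.simps [simp del]

lemma orec_zero: "orec z s l 0 = z"
  by (subst orec.simps) simp

lemma orec_osucc: "orec z s l (osucc \<xi>) = s (orec z s l \<xi>)"
  by (subst orec.simps) (simp add: osucc_neq_zero osucc_inject)

lemma orec_limit: "is_limit \<xi> \<Longrightarrow> orec z s l \<xi> = l (orec z s l ` {\<zeta>. \<zeta> < \<xi>})"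
  by (subst orec.simps) (auto simp: is_limit_def)

instantiation ordinal :: (type) "{plus, times}"
begin
definition
  "(\<alpha> :: 'a ordinal) + (\<beta> :: 'a ordinal) = orec \<alpha> osucc lub \<beta>"
definition
  "(\<alpha> :: 'a ordinal) * (\<beta> :: 'a ordinal) = orec 0 (\<lambda>x. x + \<alpha>) lub \<beta>"
instance ..
end

definition omega_pow :: "'u ordinal \<Rightarrow> 'u ordinal" where
  "omega_pow \<xi> = orec 1 (\<lambda>x. x * omega) lub \<xi>"

section \<open>Trees and their orders\<close>

definition tree_deriv :: "'a list set \<Rightarrow> 'a list set" where
  "tree_deriv T = {t \<in> T. \<exists>s\<in>T. strict_prefix t s}"

text \<open>
  The order of \<open>T\<close> with respect to a derivation \<open>D\<close>; \<open>Pinf\<close> plays the role of \<open>\<infinity>\<close>, and \<open>Minf\<close> is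
  never a value. Since each step before the order is reached removes a member of \<open>T\<close>, an
  order other than \<open>\<infinity>\<close> has cardinality at most \<open>|T| \<le> max |'a| \<aleph>\<^sub>0\<close>, so it is an ordinal of universe
  \<open>'a + 'u\<close>. The
  parameter \<open>'u\<close> does not affect the order; it only allows comparison with arbitrarily large
  ordinals.
\<close>

definition iter_order ::
    "('a list set \<Rightarrow> 'a list set) \<Rightarrow> 'a list set \<Rightarrow> ('a + 'u) ordinal extended" where
  "iter_order D T =
     (if \<exists>\<xi> :: ('a + 'u) ordinal. orec T D Inter \<xi> = {}
      then Fin (LEAST \<xi>. orec T D Inter \<xi> = {}) else Pinf)"

definition tree_order :: "'a list set \<Rightarrow> ('a + 'u) ordinal extended" where
  "tree_order T = iter_order tree_deriv T"

section \<open>Finite dimensional decompositions\<close>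

text \<open>Throughout, a closed subspace \<open>X\<close> of the ambient Banach space \<open>'a\<close> is given by its carrier.\<close>

definition is_fdd :: "'a::banach set \<Rightarrow> (nat \<Rightarrow> 'a set) \<Rightarrow> bool" where
  "is_fdd X E \<longleftrightarrow>
     (\<forall>n. E n \<subseteq> X \<and> (\<exists>B. finite B \<and> E n = span B)) \<and>
     (\<forall>x\<in>X. \<exists>!f. (\<forall>n. f n \<in> E n) \<and> f sums x)"

definition fdd_proj :: "(nat \<Rightarrow> 'a::banach set) \<Rightarrow> nat \<Rightarrow> 'a \<Rightarrow> 'a" where
  "fdd_proj E n x = (THE f. (\<forall>n. f n \<in> E n) \<and> f sums x) n"

definition fdd_supp :: "(nat \<Rightarrow> 'a::banach set) \<Rightarrow> 'a \<Rightarrow> nat set" where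
  "fdd_supp E x = {n. fdd_proj E n x \<noteq> 0}"

definition block_seqs :: "'a::banach set \<Rightarrow> (nat \<Rightarrow> 'a set) \<Rightarrow> 'a list set" where
  "block_seqs X E =
     {xs. (\<forall>x\<in>set xs. x \<in> X \<and> x \<noteq> 0 \<and> finite (fdd_supp E x)) \<and>
          (\<forall>i. Suc i < length xs \<longrightarrow>
             Max (fdd_supp E (xs ! i)) < Min (fdd_supp E (xs ! Suc i)))}"

text \<open>\<open>Inf\<close> is the minimum of a non-empty, possibly infinite, set of natural numbers.\<close>

definition fdd_deriv :: "(nat \<Rightarrow> 'a::banach set) \<Rightarrow> 'a list set \<Rightarrow> 'a list set" where
  "fdd_deriv E T =
     {xs \<in> T. \<exists>y :: nat \<Rightarrow> 'a. \<forall>i. i \<le> Inf (fdd_supp E (y i)) \<and> xs @ [y i] \<in> T}"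

definition fdd_order ::
    "(nat \<Rightarrow> 'a::banach set) \<Rightarrow> 'a list set \<Rightarrow> ('a + 'u) ordinal extended" where
  "fdd_order E T = iter_order (fdd_deriv E) T"

section \<open>The indices\<close>

text \<open>The norm of \<open>\<ell>\<^sub>p\<^sup>n\<close> for \<open>1 \<le> p \<le> \<infinity>\<close>; the inserted \<open>0\<close> only matters for \<open>n = 0\<close>.\<close>

definition lp_norm :: "ereal \<Rightarrow> nat \<Rightarrow> (nat \<Rightarrow> real) \<Rightarrow> real" where
  "lp_norm p n a =
     (if p = PInfty then Max (insert 0 ((\<lambda>i. \<bar>a i\<bar>) ` {..<n}))
      else (\<Sum>i<n. \<bar>a i\<bar> powr real_of_ereal p) powr (1 / real_of_ereal p))"

definition Tp :: "ereal \<Rightarrow> 'a::banach set \<Rightarrow> real \<Rightarrow> 'a list set" where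
  "Tp p X K =
     {xs. set xs \<subseteq> X \<inter> cball 0 1 \<and>
          (\<forall>a. lp_norm p (length xs) a = 1 \<longrightarrow>
             inverse K \<le> norm (\<Sum>i<length xs. a i *\<^sub>R xs ! i) \<and>
             norm (\<Sum>i<length xs. a i *\<^sub>R xs ! i) \<le> 1)}"

definition TpE :: "ereal \<Rightarrow> 'a::banach set \<Rightarrow> (nat \<Rightarrow> 'a set) \<Rightarrow> real \<Rightarrow> 'a list set" where
  "TpE p X E K = Tp p X K \<inter> block_seqs X E"

definition IpK :: "ereal \<Rightarrow> 'a::banach set \<Rightarrow> real \<Rightarrow> ('a + 'u) ordinal extended" where
  "IpK p X K = tree_order (Tp p X K)"

definition IpEK ::
    "ereal \<Rightarrow> 'a::banach set \<Rightarrow> (nat \<Rightarrow> 'a set) \<Rightarrow> real \<Rightarrow> ('a + 'u) ordinal extended" where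
  "IpEK p X E K = tree_order (TpE p X E K)"

definition IapEK ::
    "ereal \<Rightarrow> 'a::banach set \<Rightarrow> (nat \<Rightarrow> 'a set) \<Rightarrow> real \<Rightarrow> ('a + 'u) ordinal extended" where
  "IapEK p X E K = fdd_order E (TpE p X E K)"

text \<open>
  The trees increase with \<open>K\<close>, so the suprema below are suprema of sequences, and \<open>lub\<close> takes the
  value \<open>Pinf\<close> only if some member of the family does.
\<close>

definition Ip :: "ereal \<Rightarrow> 'a::banach set \<Rightarrow> ('a + 'u) ordinal extended" where
  "Ip p X = lub {IpK p X K | K. K \<ge> 1}"

definition IpE ::
    "ereal \<Rightarrow> 'a::banach set \<Rightarrow> (nat \<Rightarrow> 'a set) \<Rightarrow> ('a + 'u) ordinal extended" where
  "IpE p X E = lub {IpEK p X E K | K. K \<ge> 1}"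

definition IapE ::
    "ereal \<Rightarrow> 'a::banach set \<Rightarrow> (nat \<Rightarrow> 'a set) \<Rightarrow> ('a + 'u) ordinal extended" where
  "IapE p X E = lub {IapEK p X E K | K. K \<ge> 1}"

end

theory Submission
  imports Defs
begin

text \<open>
  Both derivations remove from a tree the nodes without sufficiently many one-step extensions, so
  both iterations have one description: \<open>t\<close> survives to stage \<open>\<xi>\<close> iff for every \<open>\<zeta> < \<xi>\<close> and every
  \<open>i\<close> some admissible extension of \<open>t\<close> by one vector survives to stage \<open>\<zeta>\<close> (\<open>mem_derived_iff\<close>).
  The trees of the theorem are closed under passing to subsequences, hence so are all their derived
  sets, and an index exceeds \<open>\<xi>\<close> iff the empty sequence survives to stage \<open>\<xi>\<close>. All comparisons of
  indices are then transfinite inductions along a relation between the nodes of two trees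
  (\<open>derived_simulation\<close>, \<open>derived_block_simulation\<close>, \<open>derived_concat\<close>).

  Passing to a subspace. Among sufficiently many vectors some normalized combination solves
  finitely many linear equations. Grouping the vectors of a sequence into blocks of a fixed length
  \<open>k\<close> and picking such a combination in each block turns a tree in \<open>X\<close> into one in the
  common kernel \<open>Y\<close>. This divides ranks by \<open>k\<close> on the left, which is invisible at a limit
  ordinal (\<open>derived_Tp_kernel\<close>). For block sequences it suffices to drop the first \<open>m\<close> vectors,
  as the supports move to the right (\<open>derived_TpE_tail\<close>), and for the derivation adapted to the
  decomposition one may restrict to far extensions from the start, so that nothing is lost
  (\<open>derived_far_tail\<close>).

  Indecomposability. If \<open>t\<close> is followed by a sequence \<open>s\<close> with
  \<open>\<parallel>x\<parallel> \<le> C \<parallel>x + y\<parallel>\<close> on the two spans, then \<open>t @ s\<close>, halved, is again in the tree, for a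
  constant proportional to \<open>K\<close> (\<open>glue_Tp\<close>). So a tree of rank above \<open>l\<close> can be hung below every node of
  the tree, and the index passes from above \<open>l\<close> to above \<open>l + l\<close> at the price of a larger \<open>K\<close>.
  In general \<open>s\<close> is taken in the kernel of finitely many norming functionals,
  supplied by the Hahn--Banach theorem and compactness (\<open>norming_functional\<close>,
  \<open>separating_functionals\<close>); with a decomposition it is taken in a tail, and \<open>C\<close> is the bound for the
  partial sum projections, obtained from the Baire category theorem (\<open>fdd_constant\<close>). Hence each
  supremum over \<open>K\<close> is closed under doubling of limit ordinals and is at least \<open>\<omega>\<close>, which forces it
  to be a power of \<open>\<omega>\<close> (\<open>omega_powI\<close>). Being a limit ordinal, it is not attained: a tree
  surviving to all stages below a limit survives to that limit.

  Comparing the three indices. The inequalities \<open>\<alpha> \<le> \<beta> \<le> \<gamma>\<close> are inclusions of trees. For the last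
  one, a node of rank \<open>\<omega> * \<zeta> + \<omega>\<close> has extensions of every finite length of rank \<open>\<omega> * \<zeta>\<close>, and the
  added vectors have a normalized combination in any prescribed tail, which is then
  perturbed to have finite support. So an index above \<open>\<omega> * \<xi>\<close> yields a block index above \<open>\<xi>\<close>
  (\<open>derived_Tp_imp_TpE\<close>), and \<open>\<omega> * \<omega>\<^sup>\<alpha> \<le> \<omega>\<^sup>1\<^sup>+\<^sup>\<alpha>\<close>.
\<close>

section \<open>Boundedness of small families of ordinals\<close>

lemma Well_order_rep_ordinal: "Well_order (rep_ordinal x)"
  using Quotient3_rep_reflp[OF Quotient3_ordinal, of x] by (simp add: ordIso_def)

lemma abs_ordinal_less:
  assumes "(r, s) \<in> ordLess"
  shows "abs_ordinal r < abs_ordinal s"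
proof -
  have "(r, r) \<in> ordIso" "(s, s) \<in> ordIso"
    using assms by (auto simp: ordLess_def intro: ordIso_reflexive)
  then show ?thesis using assms by (simp add: less_ordinal.abs_eq)
qed

text \<open>
  An ordinal below \<open>x\<close> is the type of a proper initial segment of a well-order representing \<open>x\<close>,
  and is determined by the element of \<open>nat + 'u\<close> that ends this segment.
\<close>

lemma card_initial_segment:
  fixes x :: "'u ordinal"
  shows "(card_of {y. y < x}, card_of (UNIV :: (nat + 'u) set)) \<in> ordLeq"
proof -
  let ?r = "rep_ordinal x"
  have "\<exists>a. (rep_ordinal y, Restr ?r (underS ?r a)) \<in> ordIso" if "y < x" for y
  proof -
    have "(rep_ordinal y, ?r) \<in> ordLess"
      using that by (simp add: less_ordinal.rep_eq)
    then show ?thesis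
      using ordLess_iff_ordIso_Restr[OF Well_order_rep_ordinal Well_order_rep_ordinal] by blast
  qed
  then obtain h where h: "(rep_ordinal y, Restr ?r (underS ?r (h y))) \<in> ordIso" if "y < x" for y
    by metis
  have "inj_on h {y. y < x}"
  proof (rule inj_onI)
    fix y z assume "y \<in> {y. y < x}" "z \<in> {y. y < x}" "h y = h z"
    then have "(rep_ordinal y, Restr ?r (underS ?r (h y))) \<in> ordIso"
      "(rep_ordinal z, Restr ?r (underS ?r (h y))) \<in> ordIso"
      using h[of y] h[of z] by simp_all
    then have "(rep_ordinal y, rep_ordinal z) \<in> ordIso"
      using ordIso_symmetric ordIso_transitive by blast
    then show "y = z"
      using Quotient3_rel_rep[OF Quotient3_ordinal, of y z] by simp
  qed
  then show ?thesis
    using card_of_ordLeq[of "{y. y < x}" "UNIV :: (nat + 'u) set"] by blast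
qed

text \<open>
  The Burali-Forti argument: an injection would copy the order of all ordinals of the universe to
  a well-order on a subset of \<open>nat + 'u\<close>, whose type would then lie above every ordinal.
\<close>

lemma no_injection_from_ordinals:
  fixes f :: "'u ordinal \<Rightarrow> nat + 'u"
  assumes "inj f"
  shows False
proof -
  define L where "L = {(x, y :: 'u ordinal). x \<le> y}"
  have FL: "Field L = UNIV" by (auto simp: L_def Field_def)
  have "wf (L - Id)"
    by (rule wf_subset[OF wf]) (auto simp: L_def)
  then have WL: "Well_order L"
    unfolding well_order_on_def linear_order_on_def partial_order_on_def preorder_on_def
      refl_on_def trans_def antisym_def total_on_def FL
    by (auto simp: L_def)
  define R where "R = dir_image L f"
  have WR: "Well_order R"
    unfolding R_def using Well_order_dir_image[OF WL] assms FL by auto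
  have R: "(f x, f y) \<in> R \<longleftrightarrow> x \<le> y" for x y
    using assms by (auto simp: R_def dir_image_def L_def dest: injD)
  have FR: "Field R = range f"
    unfolding R_def by (simp add: dir_image_Field FL)
  \<comment> \<open>The segments \<open>S x\<close> represent the ordinals order-preservingly,
    so the type of \<open>S x\<close> is at least \<open>x\<close>.\<close>
  define S where "S x = Restr R (underS R (f x))" for x
  have less_S: "(S x, R) \<in> ordLess" for x
    unfolding S_def using underS_Restr_ordLess[OF WR] FR by blast
  have S_mono: "(S x, S y) \<in> ordLess" if "x < y" for x y
  proof -
    have U: "underS R (f u) = f ` {z. z < u}" for u
    proof safe
      fix v assume "v \<in> underS R (f u)"
      then have v: "(v, f u) \<in> R" "v \<noteq> f u" by (auto simp: underS_def)
      then obtain w where w: "v = f w" using FR by (metis FieldI1 rangeE)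
      then have "w < u" using v R[of w u] by (auto simp: order_le_less)
      then show "v \<in> f ` {z. z < u}" using w by blast
    next
      fix w assume "w < u"
      then show "f w \<in> underS R (f u)"
        using R[of w u] injD[OF assms, of w u] by (auto simp: underS_def)
    qed
    have WS: "Well_order (S y)" unfolding S_def by (rule Well_order_Restr[OF WR])
    have S_iff: "(f v, f w) \<in> S u \<longleftrightarrow> v \<le> w \<and> w < u" for u v w
      unfolding S_def U using R[of v w] inj_image_mem_iff[OF assms] by auto
    have S_img: "S u \<subseteq> range f \<times> range f" for u
      unfolding S_def U by auto
    have fx: "f x \<in> Field (S y)"
      using S_iff[of x x y] that by (auto simp: Field_def)
    have "underS (S y) (f x) = f ` {z. z < x}"
    proof safe
      fix v assume "v \<in> underS (S y) (f x)"
      then have v: "(v, f x) \<in> S y" "v \<noteq> f x" by (auto simp: underS_def)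
      then obtain w where w: "v = f w" using S_img by blast
      then have "w < x" using v S_iff[of w x y] by (auto simp: order_le_less)
      then show "v \<in> f ` {z. z < x}" using w by blast
    next
      fix w assume "w < x"
      then show "f w \<in> underS (S y) (f x)"
        using S_iff[of w x y] that injD[OF assms, of w x] by (auto simp: underS_def)
    qed
    then have "Restr (S y) (underS (S y) (f x)) = R \<inter> (f ` {z. z < x}) \<times> (f ` {z. z < x})"
      using that unfolding S_def U by auto
    also have "\<dots> = S x" unfolding S_def U ..
    finally show ?thesis
      using underS_Restr_ordLess[OF WS, of "f x"] fx by force
  qed
  have le: "x \<le> abs_ordinal (S x)" for x
  proof (induction x rule: less_induct)
    case (less x)
    show ?case
    proof (rule ccontr)
      assume "\<not> ?thesis"
      then have lt: "abs_ordinal (S x) < x" by simp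
      then have "abs_ordinal (S (abs_ordinal (S x))) < abs_ordinal (S x)"
        by (intro abs_ordinal_less S_mono)
      then show False using less[OF lt] by simp
    qed
  qed
  have "x < abs_ordinal R" for x
    using le[of x] abs_ordinal_less[OF less_S[of x]] by simp
  then show False by blast
qed

text \<open>
  Without a bound the initial segments below the members of the family would cover the universe,
  which would then have at most as many elements as \<open>nat + 'u\<close>.
\<close>

lemma ordinal_family_bounded:
  fixes f :: "'i \<Rightarrow> 'u ordinal"
  assumes "(card_of I, card_of (UNIV :: (nat + 'u) set)) \<in> ordLeq"
  shows "\<exists>b. \<forall>i\<in>I. f i \<le> b"
proof (rule ccontr)
  assume "\<not> ?thesis"
  then have "(\<Union>i\<in>I. {y. y < f i}) = UNIV"
    by (fastforce simp: not_le)
  moreover have "(card_of (\<Union>i\<in>I. {y. y < f i}), card_of (UNIV :: (nat + 'u) set)) \<in> ordLeq"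
    by (rule card_of_UNION_ordLeq_infinite) (use assms card_initial_segment in auto)
  ultimately obtain g :: "'u ordinal \<Rightarrow> nat + 'u" where "inj g"
    using card_of_ordLeq[of "UNIV :: 'u ordinal set" "UNIV :: (nat + 'u) set"] by auto
  then show False by (rule no_injection_from_ordinals)
qed

lemma lub_ordinal:
  fixes A :: "'u ordinal set"
  assumes "\<And>a. a \<in> A \<Longrightarrow> a \<le> b"
  shows lub_ordinal_upper: "a \<in> A \<Longrightarrow> a \<le> lub A" and lub_ordinal_least: "lub A \<le> b"
proof -
  have "\<forall>a\<in>A. a \<le> lub A" unfolding lub_def by (rule LeastI) (use assms in blast)
  then show "a \<in> A \<Longrightarrow> a \<le> lub A" by blast
  show "lub A \<le> b" unfolding lub_def by (rule Least_le) (use assms in blast)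
qed

lemma not_less_zero [simp]: "\<not> x < 0" for x :: "'u ordinal"
  using zero_le_ordinal[of x] by (simp add: not_less)

section \<open>Ordinal arithmetic\<close>

lemma is_limit_iff_osucc_closed: "is_limit x \<longleftrightarrow> 0 < x \<and> (\<forall>y<x. osucc y < x)"
proof
  assume x: "is_limit x"
  have "osucc y < x" if "y < x" for y
    using that x osucc_le_iff[of y x] by (auto simp: is_limit_def order_le_less)
  then show "0 < x \<and> (\<forall>y<x. osucc y < x)"
    using x zero_le_ordinal[of x] by (auto simp: is_limit_def)
qed (use less_osucc in \<open>auto simp: is_limit_def\<close>)

text \<open>
  For an inflationary successor step, transfinite recursion with suprema at limits is the
  least solution of \<open>z \<le> G \<xi>\<close> and \<open>s (G \<eta>) \<le> G \<xi>\<close> for \<open>\<eta> < \<xi>\<close>. Sum, product and power are all of this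
  kind, so everything about them can be derived from their upper bounds, without distinguishing
  successors from limits.
\<close>

lemma orec_lub_le_iff:
  fixes s :: "'u ordinal \<Rightarrow> 'u ordinal" and \<xi> :: "'u ordinal"
  assumes infl: "\<And>x. x \<le> s x"
  shows "orec z s lub \<xi> \<le> y \<longleftrightarrow> z \<le> y \<and> (\<forall>\<eta><\<xi>. s (orec z s lub \<eta>) \<le> y)"
proof -
  let ?G = "orec z s lub :: 'u ordinal \<Rightarrow> 'u ordinal"
  have bnd: "\<exists>b. \<forall>a \<in> ?G ` {\<zeta>. \<zeta> < x}. a \<le> b" for x
    using ordinal_family_bounded[OF card_initial_segment, where f = ?G] by auto
  have A: "z \<le> ?G \<xi> \<and> (\<forall>\<eta><\<xi>. s (?G \<eta>) \<le> ?G \<xi>)" for \<xi> :: "'u ordinal"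
  proof (induction \<xi> rule: less_induct)
    case (less \<xi>)
    consider "\<xi> = 0" | \<zeta> where "\<xi> = osucc \<zeta>" | "is_limit \<xi>"
      by (auto simp: is_limit_def)
    then show ?case
    proof cases
      case 1
      then show ?thesis by (auto simp: orec_zero)
    next
      case 2
      then have IH: "z \<le> ?G \<zeta>" "\<forall>\<eta><\<zeta>. s (?G \<eta>) \<le> ?G \<zeta>"
        using less[of \<zeta>] less_osucc by auto
      have "s (?G \<eta>) \<le> s (?G \<zeta>)" if "\<eta> < \<xi>" for \<eta>
      proof -
        have "\<eta> \<le> \<zeta>" using that 2 osucc_le_iff[of \<zeta> \<eta>] linorder_not_le by blast
        then show ?thesis using IH(2) order_trans[OF _ infl[of "?G \<zeta>"]] by (auto simp: order_le_less)
      qed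
      then show ?thesis using 2 IH infl[of "?G \<zeta>"] by (auto simp: orec_osucc)
    next
      case 3
      then have G: "?G \<xi> = lub (?G ` {\<zeta>. \<zeta> < \<xi>})" by (rule orec_limit)
      have up: "?G \<eta> \<le> ?G \<xi>" if "\<eta> < \<xi>" for \<eta>
      proof -
        obtain b where "\<forall>a \<in> ?G ` {\<zeta>. \<zeta> < \<xi>}. a \<le> b" using bnd by blast
        then show ?thesis
          unfolding G by (intro lub_ordinal_upper[of _ b]) (use that in auto)
      qed
      have "s (?G \<eta>) \<le> ?G \<xi>" if "\<eta> < \<xi>" for \<eta>
        using up[of "osucc \<eta>"] 3 that by (simp add: orec_osucc is_limit_iff_osucc_closed)
      moreover have "z \<le> ?G \<xi>"
        using up[of 0] 3 by (simp add: orec_zero is_limit_iff_osucc_closed)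
      ultimately show ?thesis by blast
    qed
  qed
  show ?thesis
  proof
    assume "z \<le> y \<and> (\<forall>\<eta><\<xi>. s (?G \<eta>) \<le> y)"
    then have zy: "z \<le> y" and sy: "\<And>\<eta>. \<eta> < \<xi> \<Longrightarrow> s (?G \<eta>) \<le> y" by auto
    consider "\<xi> = 0" | \<zeta> where "\<xi> = osucc \<zeta>" | "is_limit \<xi>"
      by (auto simp: is_limit_def)
    then show "?G \<xi> \<le> y"
    proof cases
      case 3
      show ?thesis unfolding orec_limit[OF 3]
        by (rule lub_ordinal_least) (use order_trans[OF infl sy] in auto)
    qed (use zy sy less_osucc in \<open>auto simp: orec_zero orec_osucc\<close>)
  next
    assume "?G \<xi> \<le> y"
    then show "z \<le> y \<and> (\<forall>\<eta><\<xi>. s (?G \<eta>) \<le> y)"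
      using A[of \<xi>] by (meson order_trans)
  qed
qed

lemma add_le_iff: "a + b \<le> y \<longleftrightarrow> a \<le> y \<and> (\<forall>\<eta><b. a + \<eta> < y)" for a b y :: "'u ordinal"
  unfolding plus_ordinal_def
  using orec_lub_le_iff[of osucc a b y, OF less_imp_le[OF less_osucc]] by (simp add: osucc_le_iff)

lemma less_add_iff: "y < a + b \<longleftrightarrow> y < a \<or> (\<exists>\<eta><b. y \<le> a + \<eta>)" for a b y :: "'u ordinal"
  using add_le_iff[of a b y] by (meson not_le)

lemma le_add1: "a \<le> a + b" for a b :: "'u ordinal"
  using add_le_iff[of a b "a + b"] by simp

lemma add_less_mono2: "b < c \<Longrightarrow> a + b < a + c" for a b c :: "'u ordinal"
  using add_le_iff[of a c "a + c"] by simp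

lemma add_le_mono2: "b \<le> c \<Longrightarrow> a + b \<le> a + c" for a b c :: "'u ordinal"
  using add_less_mono2[of b c a] by (auto simp: order_le_less)

lemma add_zero_ordinal [simp]: "a + 0 = a" for a :: "'u ordinal"
  by (simp add: plus_ordinal_def orec_zero)

lemma add_osucc: "a + osucc b = osucc (a + b)" for a b :: "'u ordinal"
  by (simp add: plus_ordinal_def orec_osucc)

lemma zero_less_osucc: "0 < osucc x"
  using less_osucc[of x] zero_le_ordinal[of x] by order

lemma one_ordinal_eq: "(1 :: 'u ordinal) = osucc 0"
  by (simp add: one_ordinal_def osucc_def)

lemma less_osucc_iff: "x < osucc y \<longleftrightarrow> x < y \<or> x = y"
  by (metis osucc_le_iff not_le order_le_less)

text \<open>
  Used to prove the algebraic laws: two ordinals agree when the conditions for being an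
  upper bound of them, as unfolded by the rules above, agree.
\<close>

lemma ordinal_eqI: "(\<And>y. a \<le> y \<longleftrightarrow> b \<le> y) \<Longrightarrow> a = b" for a b :: "'u ordinal"
  by (metis order.refl order.antisym)

lemma zero_add_ordinal [simp]: "0 + a = a" for a :: "'u ordinal"
proof (induction a rule: less_induct)
  case (less a)
  show ?case
  proof (rule ordinal_eqI)
    fix y
    have "0 + a \<le> y \<longleftrightarrow> (\<forall>\<eta><a. \<eta> < y)" using less by (simp add: add_le_iff zero_le_ordinal)
    also have "\<dots> \<longleftrightarrow> a \<le> y" by (meson less_irrefl not_le order_less_le_trans)
    finally show "0 + a \<le> y \<longleftrightarrow> a \<le> y" .
  qed
qed

lemma add_le_mono1: "a \<le> b \<Longrightarrow> a + c \<le> b + c" for a b c :: "'u ordinal"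
proof (induction c rule: less_induct)
  case (less c)
  then show ?case
    unfolding add_le_iff[of a c] using le_add1[of b c] add_less_mono2[of _ c b]
    by (meson order_le_less_trans order_trans)
qed

lemma add_mono_ordinal: "a \<le> b \<Longrightarrow> c \<le> d \<Longrightarrow> a + c \<le> b + d" for a b c d :: "'u ordinal"
  using add_le_mono1 add_le_mono2 order_trans by blast

lemma add_assoc_ordinal: "(a + b) + c = a + (b + c)" for a b c :: "'u ordinal"
proof (induction c rule: less_induct)
  case (less c)
  show ?case
  proof (rule ordinal_eqI)
    fix y
    have "a + (b + c) \<le> y \<longleftrightarrow> a \<le> y \<and> (\<forall>\<zeta><b + c. a + \<zeta> < y)" by (rule add_le_iff)
    also have "\<dots> \<longleftrightarrow> a \<le> y \<and> (\<forall>\<zeta><b. a + \<zeta> < y) \<and> (\<forall>\<eta><c. \<forall>\<zeta>\<le>b + \<eta>. a + \<zeta> < y)"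
      by (auto simp: less_add_iff)
    also have "\<dots> \<longleftrightarrow> a \<le> y \<and> (\<forall>\<zeta><b. a + \<zeta> < y) \<and> (\<forall>\<eta><c. a + (b + \<eta>) < y)"
      using add_le_mono2 order_le_less_trans by blast
    also have "\<dots> \<longleftrightarrow> (a + b) + c \<le> y"
      using less by (simp add: add_le_iff[of "a + b"] add_le_iff[of a b])
    finally show "(a + b) + c \<le> y \<longleftrightarrow> a + (b + c) \<le> y" by simp
  qed
qed

lemma mult_le_iff: "a * b \<le> y \<longleftrightarrow> (\<forall>\<eta><b. a * \<eta> + a \<le> y)" for a b y :: "'u ordinal"
  unfolding times_ordinal_def
  using orec_lub_le_iff[of "\<lambda>x. x + a" 0 b y, OF le_add1] by (simp add: zero_le_ordinal)

lemma less_mult_iff: "y < a * b \<longleftrightarrow> (\<exists>\<eta><b. y < a * \<eta> + a)" for a b y :: "'u ordinal"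
  using mult_le_iff[of a b y] by (meson not_le)

lemma mult_zero_ordinal [simp]: "a * 0 = 0" for a :: "'u ordinal"
  by (simp add: times_ordinal_def orec_zero)

lemma mult_osucc: "a * osucc b = a * b + a" for a b :: "'u ordinal"
  by (simp add: times_ordinal_def orec_osucc)

lemma mult_add_le: "\<eta> < b \<Longrightarrow> a * \<eta> + a \<le> a * b" for a b :: "'u ordinal"
  using mult_le_iff[of a b "a * b"] by simp

lemma mult_le_mono2: "b \<le> c \<Longrightarrow> a * b \<le> a * c" for a b c :: "'u ordinal"
  using mult_add_le[of b c a] le_add1[of "a * b" a] by (auto simp: order_le_less)

lemma mult_one_ordinal [simp]: "a * 1 = a" for a :: "'u ordinal"
  by (simp add: one_ordinal_eq mult_osucc)

lemma mult_le_mono1: "a \<le> b \<Longrightarrow> a * c \<le> b * c" for a b c :: "'u ordinal"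
proof (induction c rule: less_induct)
  case (less c)
  then show ?case
    unfolding mult_le_iff[of a c] using mult_add_le[of _ c b] add_mono_ordinal
    by (meson order_trans)
qed

lemma add_mult_distrib_ordinal: "a * (b + c) = a * b + a * c" for a b c :: "'u ordinal"
proof (induction c rule: less_induct)
  case (less c)
  show ?case
  proof (rule ordinal_eqI)
    fix y
    have "a * (b + c) \<le> y \<longleftrightarrow> (\<forall>\<zeta><b + c. a * \<zeta> + a \<le> y)" by (rule mult_le_iff)
    also have "\<dots> \<longleftrightarrow> (\<forall>\<zeta><b. a * \<zeta> + a \<le> y) \<and> (\<forall>\<eta><c. \<forall>\<zeta>\<le>b + \<eta>. a * \<zeta> + a \<le> y)"
      by (auto simp: less_add_iff)
    also have "\<dots> \<longleftrightarrow> a * b \<le> y \<and> (\<forall>\<eta><c. a * (b + \<eta>) + a \<le> y)"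
      unfolding mult_le_iff[of a b] using mult_le_mono2 add_le_mono1 order_trans by blast
    also have "\<dots> \<longleftrightarrow> a * b \<le> y \<and> (\<forall>\<eta><c. a * b + (a * \<eta> + a) \<le> y)"
      using less by (simp add: add_assoc_ordinal)
    also have "\<dots> \<longleftrightarrow> a * b \<le> y \<and> (\<forall>\<eta><c. \<forall>\<zeta><a * \<eta> + a. a * b + \<zeta> < y)"
      by (auto simp: add_le_iff[of "a * b"])
    also have "\<dots> \<longleftrightarrow> a * b \<le> y \<and> (\<forall>\<zeta><a * c. a * b + \<zeta> < y)"
      by (auto simp: less_mult_iff)
    also have "\<dots> \<longleftrightarrow> a * b + a * c \<le> y" by (simp add: add_le_iff)
    finally show "a * (b + c) \<le> y \<longleftrightarrow> a * b + a * c \<le> y" .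
  qed
qed

lemma mult_assoc_ordinal: "(a * b) * c = a * (b * c)" for a b c :: "'u ordinal"
proof (induction c rule: less_induct)
  case (less c)
  show ?case
  proof (rule ordinal_eqI)
    fix y
    have "a * (b * c) \<le> y \<longleftrightarrow> (\<forall>\<zeta><b * c. a * \<zeta> + a \<le> y)" by (rule mult_le_iff)
    also have "\<dots> \<longleftrightarrow> (\<forall>\<eta><c. \<forall>\<zeta><b * \<eta> + b. a * \<zeta> + a \<le> y)"
      by (auto simp: less_mult_iff)
    also have "\<dots> \<longleftrightarrow> (\<forall>\<eta><c. a * (b * \<eta> + b) \<le> y)" by (simp add: mult_le_iff[of a])
    also have "\<dots> \<longleftrightarrow> (a * b) * c \<le> y"
      using less by (simp add: add_mult_distrib_ordinal mult_le_iff[of "a * b"])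
    finally show "(a * b) * c \<le> y \<longleftrightarrow> a * (b * c) \<le> y" by simp
  qed
qed

lemma ex_limit_ordinal: "\<exists>x :: 'u ordinal. is_limit x"
proof -
  have "(card_of (UNIV :: nat set), card_of (UNIV :: (nat + 'u) set)) \<in> ordLeq"
    by (rule card_of_ordLeqI[of Inl]) auto
  from ordinal_family_bounded[OF this, of "\<lambda>n. (osucc ^^ n) 0"]
  obtain b :: "'u ordinal" where b: "(osucc ^^ n) 0 \<le> b" for n by auto
  define x :: "'u ordinal" where "x = (LEAST b. \<forall>n. (osucc ^^ n) 0 \<le> b)"
  have x: "(osucc ^^ n) 0 \<le> x" for n
    unfolding x_def using LeastI[of "\<lambda>b. \<forall>n. (osucc ^^ n) 0 \<le> b" b] b by blast
  have "osucc y < x" if "y < x" for y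
  proof -
    have "\<not> (\<forall>n. (osucc ^^ n) 0 \<le> y)"
      using that not_less_Least unfolding x_def by blast
    then obtain n where "y < (osucc ^^ n) 0" by (auto simp: not_le)
    then have "osucc y \<le> (osucc ^^ n) 0" by (simp add: osucc_le_iff)
    also have "\<dots> < (osucc ^^ Suc n) 0" using less_osucc by simp
    also have "\<dots> \<le> x" by (rule x)
    finally show ?thesis .
  qed
  moreover have "0 < x"
    using order_less_le_trans[OF zero_less_osucc x[of 1, simplified]] .
  ultimately show ?thesis by (auto simp: is_limit_iff_osucc_closed)
qed

lemma is_limit_omega: "is_limit omega"
  unfolding omega_def using ex_limit_ordinal by (rule LeastI_ex)

lemma omega_le: "is_limit x \<Longrightarrow> omega \<le> x"
  unfolding omega_def by (rule Least_le)

lemma funpow_osucc_less_limit: "is_limit l \<Longrightarrow> x < l \<Longrightarrow> (osucc ^^ n) x < l"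
  by (induction n) (auto simp: is_limit_iff_osucc_closed)

lemma zero_less_omega: "0 < omega"
  by (rule is_limit_omega[unfolded is_limit_iff_osucc_closed, THEN conjunct1])

lemma one_less_omega: "1 < omega"
  using funpow_osucc_less_limit[OF is_limit_omega zero_less_omega, of 1] by (simp add: one_ordinal_eq)

lemma add_funpow_osucc: "a + (osucc ^^ n) b = (osucc ^^ n) (a + b)" for a b :: "'u ordinal"
  by (induction n) (auto simp: add_osucc)

lemma one_add_finite: "1 + (osucc ^^ n) 0 = (osucc ^^ Suc n) (0 :: 'u ordinal)"
  by (simp add: add_funpow_osucc one_ordinal_eq funpow_swap1)

lemma less_omegaE:
  assumes "x < omega"
  obtains n where "x = (osucc ^^ n) 0"
  using assms
proof (induction x arbitrary: thesis rule: less_induct)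
  case (less x)
  have "\<not> is_limit x" using less.prems(2) omega_le by (auto simp flip: not_less)
  then consider "x = 0" | y where "x = osucc y" by (auto simp: is_limit_def)
  then show ?case
  proof cases
    case 1
    then show ?thesis using less.prems(1)[of 0] by simp
  next
    case 2
    then have "y < x" using less_osucc by simp
    with less.IH[of y] less.prems obtain n where "y = (osucc ^^ n) 0" by (meson less_trans)
    then show ?thesis using 2 less.prems(1)[of "Suc n"] by simp
  qed
qed

lemma is_limit_add: "is_limit b \<Longrightarrow> is_limit (a + b)"
  unfolding is_limit_iff_osucc_closed
proof safe
  assume b: "0 < b" "\<forall>y<b. osucc y < b"
  show "0 < a + b" using add_less_mono2[OF b(1), of a] zero_le_ordinal[of "a + 0"] by order
  fix y assume "y < a + b"
  then obtain \<eta> where \<eta>: "\<eta> < b" "y \<le> a + \<eta>"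
    using b(1) by (auto simp: less_add_iff intro: less_imp_le)
  then have "osucc y \<le> a + osucc \<eta>" using less_osucc[of "a + \<eta>"] by (simp add: osucc_le_iff add_osucc)
  also have "\<dots> < a + b" using b \<eta> by (intro add_less_mono2) auto
  finally show "osucc y < a + b" .
qed

lemma le_mult_omega: "x \<le> x * omega"
  using mult_le_mono2[OF less_imp_le[OF one_less_omega], of x] by simp

lemma omega_pow_le_iff:
  "omega_pow b \<le> y \<longleftrightarrow> 1 \<le> y \<and> (\<forall>\<eta><b. omega_pow \<eta> * omega \<le> y)"
  unfolding omega_pow_def by (rule orec_lub_le_iff) (rule le_mult_omega)

lemma less_omega_pow_iff:
  "y < omega_pow b \<longleftrightarrow> y = 0 \<or> (\<exists>\<eta><b. y < omega_pow \<eta> * omega)"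
proof -
  have "y < 1 \<longleftrightarrow> y = 0"
    using zero_le_ordinal[of y] osucc_le_iff[of 0 y] by (metis not_le one_ordinal_eq order_le_less)
  then show ?thesis using omega_pow_le_iff[of b y] by (meson not_le)
qed

lemma omega_pow_mult_omega_le: "a < b \<Longrightarrow> omega_pow a * omega \<le> omega_pow b"
  using omega_pow_le_iff[of b "omega_pow b"] by simp

lemma zero_less_omega_pow: "0 < omega_pow a"
  by (simp add: less_omega_pow_iff)

lemma omega_pow_strict_mono: "a < b \<Longrightarrow> omega_pow a < omega_pow b"
proof -
  assume ab: "a < b"
  have "omega_pow a < omega_pow a + omega_pow a"
    using add_less_mono2[OF zero_less_omega_pow, of "omega_pow a"] by simp
  also have "\<dots> \<le> omega_pow a * omega"
    using mult_add_le[OF one_less_omega, of "omega_pow a"] by simp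
  also have "\<dots> \<le> omega_pow b" by (rule omega_pow_mult_omega_le[OF ab])
  finally show ?thesis .
qed

lemma omega_pow_le_cancel: "omega_pow a \<le> omega_pow b \<Longrightarrow> a \<le> b"
  using omega_pow_strict_mono[of b a] by (auto simp flip: not_less)

lemma le_omega_pow: "a \<le> omega_pow a"
proof (induction a rule: less_induct)
  case (less a)
  show ?case
  proof (rule ccontr)
    assume "\<not> ?thesis"
    then have "omega_pow a < a" by simp
    with less[OF this] omega_pow_strict_mono[OF this] show False by simp
  qed
qed

text \<open>
  The induction runs over \<open>\<omega> * (\<omega>\<^sup>\<eta> * \<omega>) = (\<omega> * \<omega>\<^sup>\<eta>) * \<omega> \<le> \<omega>\<^sup>1\<^sup>+\<^sup>\<eta> * \<omega>\<close>; the leading \<open>1\<close> disappears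
  for infinite exponents.
\<close>

lemma omega_mult_omega_pow_le: "omega * omega_pow a \<le> omega_pow (1 + a)"
proof (induction a rule: less_induct)
  case (less a)
  have "omega * \<zeta> + omega \<le> omega_pow (1 + a)" if "\<zeta> < omega_pow a" for \<zeta>
  proof (cases "\<zeta> = 0")
    case True
    have "(1 :: 'a ordinal) * omega \<le> omega_pow (1 + a)"
    proof -
      have "(0 :: 'a ordinal) < 1 + a"
        using le_add1[of 1 a] zero_less_osucc[of 0] unfolding one_ordinal_eq
        by (rule order_less_le_trans[rotated])
      then show ?thesis
        using omega_pow_mult_omega_le[of 0 "1 + a"] by (simp add: omega_pow_def orec_zero)
    qed
    moreover have "omega \<le> (1 :: 'a ordinal) * omega"
    proof (rule ccontr)
      have one: "(1 :: 'a ordinal) * x = x" if "x < omega" for x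
        using that
      proof (rule less_omegaE)
        fix n assume "x = (osucc ^^ n) 0"
        then show ?thesis
          by (induction n arbitrary: x) (auto simp: mult_osucc, simp add: one_ordinal_eq add_osucc)
      qed
      have less: "x < (1 :: 'a ordinal) * omega" if "x < omega" for x
        using mult_add_le[OF that, of 1] one[OF that] less_osucc[of x]
        by (simp add: one_ordinal_eq add_osucc order_less_le_trans)
      assume "\<not> omega \<le> (1 :: 'a ordinal) * omega"
      then show False using less by (meson not_le less_irrefl)
    qed
    ultimately show ?thesis using True by simp
  next
    case False
    then obtain \<eta> where \<eta>: "\<eta> < a" "\<zeta> < omega_pow \<eta> * omega"
      using \<open>\<zeta> < omega_pow a\<close> by (auto simp: less_omega_pow_iff)
    have "omega * \<zeta> + omega \<le> omega * (omega_pow \<eta> * omega)"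
      by (rule mult_add_le[OF \<eta>(2)])
    also have "\<dots> = (omega * omega_pow \<eta>) * omega" by (simp add: mult_assoc_ordinal)
    also have "\<dots> \<le> omega_pow (1 + \<eta>) * omega" by (rule mult_le_mono1[OF less[OF \<eta>(1)]])
    also have "\<dots> \<le> omega_pow (1 + a)"
      by (rule omega_pow_mult_omega_le[OF add_less_mono2[OF \<eta>(1)]])
    finally show ?thesis .
  qed
  then show ?case by (simp add: mult_le_iff)
qed

text \<open>
  Finite blocks are absorbed by limits: \<open>n * \<omega> = \<omega>\<close> for \<open>n > 0\<close>, and every limit is a multiple of \<open>\<omega>\<close>.
\<close>

lemma finite_mult_less_limit:
  assumes "is_limit l" "x < l"
  shows "(osucc ^^ n) 0 * x < l"
  using assms
proof (induction x arbitrary: l rule: less_induct)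
  case (less x)
  have step: "(osucc ^^ n) 0 * \<eta> + (osucc ^^ n) 0 < l" if "(osucc ^^ n) 0 * \<eta> < l" "is_limit l" for \<eta> l
    using funpow_osucc_less_limit[OF that(2,1), of n] by (simp add: add_funpow_osucc)
  consider "x = 0" | y where "x = osucc y" | "is_limit x"
    by (auto simp: is_limit_def)
  then show ?case
  proof cases
    case 1
    then show ?thesis using less.prems by (simp add: is_limit_iff_osucc_closed)
  next
    case 2
    then show ?thesis using less.IH[of y l] less.prems step less_osucc[of y]
      by (auto simp: mult_osucc intro: less_trans)
  next
    case 3
    have "(osucc ^^ n) 0 * x \<le> x"
      unfolding mult_le_iff[of _ x] using less.IH[OF _ 3] step[OF _ 3] less_imp_le by blast
    then show ?thesis using less.prems by order
  qed
qed

lemma limit_part: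
  assumes "omega \<le> x"
  obtains l where "is_limit l" "l \<le> x" "x < l + omega"
  using assms
proof (induction x arbitrary: thesis rule: less_induct)
  case (less x)
  show ?case
  proof (cases "is_limit x")
    case True
    then show ?thesis
      using less.prems(1)[of x] add_less_mono2[of 0 omega x] is_limit_omega by (auto simp: is_limit_iff_osucc_closed)
  next
    case False
    moreover have "x \<noteq> 0" using order_less_le_trans[OF zero_less_omega less.prems(2)] by auto
    ultimately obtain y where y: "x = osucc y" by (auto simp: is_limit_def)
    have "x \<noteq> omega" using False is_limit_omega by auto
    then have "omega \<le> y" using less.prems(2) y osucc_le_iff[of y omega] by (auto simp flip: not_less)
    then obtain l where l: "is_limit l" "l \<le> y" "y < l + omega"
      using less.IH[of y] y less_osucc by blast
    then show ?thesis using less.prems(1)[of l] y is_limit_add[OF is_limit_omega, of l] less_osucc[of y]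
      by (auto simp: is_limit_iff_osucc_closed)
  qed
qed

section \<open>Additively indecomposable ordinals\<close>

text \<open>
  The least \<open>\<xi>\<close> with \<open>\<theta> \<le> \<omega>\<^sup>\<xi>\<close> works: closure under addition keeps all finite multiples of smaller
  powers below \<open>\<theta>\<close>, so \<open>\<theta>\<close> cannot be strictly between the earlier powers and \<open>\<omega>\<^sup>\<xi>\<close>. Doubling is
  only assumed at limits because the comparison of a space with its subspaces of finite codimension is
  limited to them.
\<close>

lemma omega_powI:
  assumes "omega \<le> \<theta>" and "\<And>l. is_limit l \<Longrightarrow> l < \<theta> \<Longrightarrow> l + l < \<theta>"
  shows "\<exists>\<xi>. \<theta> = omega_pow \<xi>" and "is_limit \<theta>"
proof -
  \<comment> \<open>Between limits: if \<open>l\<close> is the limit part of \<open>x\<close>, then \<open>x\<close> is below the limit \<open>l + l\<close>.\<close>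
  have double: "x + x < \<theta>" if "x < \<theta>" for x
  proof (cases "x < omega")
    case True
    then obtain n where n: "x = (osucc ^^ n) 0" by (rule less_omegaE)
    then have "x + x = (osucc ^^ n) x" using add_funpow_osucc[of x n 0] by simp
    also have "\<dots> < omega" using funpow_osucc_less_limit[OF is_limit_omega True] .
    finally show ?thesis using assms(1) by order
  next
    case False
    then have "omega \<le> x" by simp
    then obtain l where l: "is_limit l" "l \<le> x" "x < l + omega"
      by (rule limit_part)
    have "x \<le> l + l" using l(3) add_le_mono2[OF omega_le[OF l(1)], of l] by order
    then have "x + x \<le> (l + l) + (l + l)" by (intro add_mono_ordinal)
    also have "\<dots> < \<theta>" using l that by (intro assms(2) is_limit_add) auto
    finally show ?thesis .
  qed
  have add: "x + y < \<theta>" if "x < \<theta>" "y < \<theta>" for x y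
    using order_le_less_trans[OF add_mono_ordinal[OF max.cobounded1 max.cobounded2] double, of x y] that
    by simp
  have pos: "0 < \<theta>" by (rule order_less_le_trans[OF zero_less_omega assms(1)])
  have "omega_pow \<xi> \<le> \<theta>" if \<xi>: "\<xi> = (LEAST \<xi>. \<theta> \<le> omega_pow \<xi>)" for \<xi>
  proof (rule ccontr)
    assume "\<not> ?thesis"
    then have "\<theta> < omega_pow \<xi>" by simp
    then obtain \<eta> where \<eta>: "\<eta> < \<xi>" "\<theta> < omega_pow \<eta> * omega"
      using pos by (auto simp: less_omega_pow_iff)
    have \<eta>\<theta>: "omega_pow \<eta> < \<theta>" using \<eta>(1) not_less_Least unfolding \<xi> by (metis not_le)
    obtain k where k: "k < omega" "\<theta> < omega_pow \<eta> * k + omega_pow \<eta>"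
      using \<eta>(2) by (auto simp: less_mult_iff)
    obtain n where n: "k = (osucc ^^ n) 0" using k(1) by (rule less_omegaE)
    have "omega_pow \<eta> * (osucc ^^ n) 0 < \<theta>" for n
      by (induction n) (auto simp: pos mult_osucc intro: add \<eta>\<theta>)
    then show False using k(2) n add[of "omega_pow \<eta> * k" "omega_pow \<eta>"] \<eta>\<theta> by force
  qed
  moreover have "\<theta> \<le> omega_pow (LEAST \<xi>. \<theta> \<le> omega_pow \<xi>)"
    by (rule LeastI[of _ \<theta>]) (rule le_omega_pow)
  ultimately show "\<exists>\<xi>. \<theta> = omega_pow \<xi>" by (metis order.antisym)
  have one: "1 < \<theta>"
    by (rule order_less_le_trans[OF one_less_omega assms(1)])
  then have "osucc y < \<theta>" if "y < \<theta>" for y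
    using add[OF that one] by (simp add: one_ordinal_eq add_osucc)
  then show "is_limit \<theta>" using pos by (simp add: is_limit_iff_osucc_closed)
qed

section \<open>Derived trees\<close>

text \<open>
  The common form of the two derivations: \<open>Q i y\<close> says that \<open>y\<close> is admissible as an extension of
  quality \<open>i\<close>.
\<close>

definition ext_deriv :: "(nat \<Rightarrow> 'a \<Rightarrow> bool) \<Rightarrow> 'a list set \<Rightarrow> 'a list set" where
  "ext_deriv Q T = {t \<in> T. \<forall>i. \<exists>y. Q i y \<and> t @ [y] \<in> T}"

definition derived :: "(nat \<Rightarrow> 'a \<Rightarrow> bool) \<Rightarrow> 'a list set \<Rightarrow> 'u ordinal \<Rightarrow> 'a list set" where
  "derived Q T \<xi> = orec T (ext_deriv Q) Inter \<xi>"

definition hereditary :: "'a list set \<Rightarrow> bool" where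
  "hereditary T \<longleftrightarrow> (\<forall>t\<in>T. \<forall>s. subseq s t \<longrightarrow> s \<in> T)"

lemma sorted_wrt_subseq: "subseq s t \<Longrightarrow> sorted_wrt R t \<Longrightarrow> sorted_wrt R s"
  by (induction rule: list_emb.induct) (auto dest: list_emb_set)

lemma le_Inf_nat_iff: "S \<noteq> {} \<Longrightarrow> i \<le> Inf S \<longleftrightarrow> (\<forall>n\<in>S. i \<le> n)" for S :: "nat set"
  by (rule le_cInf_iff) auto

lemma subseq_set_mono: "subseq s t \<Longrightarrow> set s \<subseteq> set t"
  by (auto dest: list_emb_set)

text \<open>
  The ordinary derivation, on trees closed under subsequences, is the case without restriction.
\<close>

abbreviation (input) any :: "nat \<Rightarrow> 'a \<Rightarrow> bool" where
  "any \<equiv> \<lambda>_ _. True"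

text \<open>
  This removes the distinction between successor and limit stages, so that survival of nodes can be
  proved by plain well-founded induction on \<open>\<xi>\<close>.
\<close>

lemma mem_derived_iff:
  "t \<in> derived Q T \<xi> \<longleftrightarrow>
     t \<in> T \<and> (\<forall>\<zeta><\<xi>. \<forall>i. \<exists>y. Q i y \<and> t @ [y] \<in> derived Q T \<zeta>)"
proof (induction \<xi> arbitrary: t rule: less_induct)
  case (less \<xi>)
  consider "\<xi> = 0" | \<zeta> where "\<xi> = osucc \<zeta>" | "is_limit \<xi>"
    by (auto simp: is_limit_def)
  then show ?case
  proof cases
    case 1
    then show ?thesis by (simp add: derived_def orec_zero)
  next
    case 2
    then have "t \<in> derived Q T \<xi> \<longleftrightarrow>
        t \<in> derived Q T \<zeta> \<and> (\<forall>i. \<exists>y. Q i y \<and> t @ [y] \<in> derived Q T \<zeta>)"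
      by (simp add: derived_def orec_osucc ext_deriv_def)
    also have "\<dots> \<longleftrightarrow> t \<in> T \<and> (\<forall>\<eta><\<xi>. \<forall>i. \<exists>y. Q i y \<and> t @ [y] \<in> derived Q T \<eta>)"
      using less[of \<zeta> t] unfolding 2 less_osucc_iff by blast
    finally show ?thesis .
  next
    case 3
    then have "t \<in> derived Q T \<xi> \<longleftrightarrow> (\<forall>\<zeta><\<xi>. t \<in> derived Q T \<zeta>)"
      by (auto simp: derived_def orec_limit)
    also have "\<dots> \<longleftrightarrow> (\<forall>\<zeta><\<xi>. t \<in> T \<and> (\<forall>\<eta><\<zeta>. \<forall>i. \<exists>y. Q i y \<and> t @ [y] \<in> derived Q T \<eta>))"
      using less by simp
    also have "\<dots> \<longleftrightarrow> t \<in> T \<and> (\<forall>\<eta><\<xi>. \<forall>i. \<exists>y. Q i y \<and> t @ [y] \<in> derived Q T \<eta>)"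
      using 3 less_osucc unfolding is_limit_iff_osucc_closed by (meson less_trans)
    finally show ?thesis .
  qed
qed

lemma derived_subset: "derived Q T \<xi> \<subseteq> T"
  using mem_derived_iff by blast

lemma derived_antimono: "\<zeta> \<le> \<xi> \<Longrightarrow> t \<in> derived Q T \<xi> \<Longrightarrow> t \<in> derived Q T \<zeta>"
  using mem_derived_iff[of t Q T \<xi>] mem_derived_iff[of t Q T \<zeta>] order_less_le_trans by blast

lemma derived_oneI:
  assumes "t \<in> T" "\<And>i. \<exists>y. Q i y \<and> t @ [y] \<in> T"
  shows "t \<in> derived Q T (1 :: 'u ordinal)"
proof -
  have "\<zeta> = 0" if "\<zeta> < 1" for \<zeta> :: "'u ordinal"
    using that by (auto simp: one_ordinal_eq less_osucc_iff)
  then show ?thesis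
    using assms by (subst mem_derived_iff) (metis derived_def orec_zero)
qed

lemma derived_limit: "is_limit \<xi> \<Longrightarrow> (\<And>\<zeta>. \<zeta> < \<xi> \<Longrightarrow> t \<in> derived Q T \<zeta>) \<Longrightarrow> t \<in> derived Q T \<xi>"
  by (auto simp: derived_def orec_limit)

text \<open>
  An extension of the longer sequence also extends every subsequence. For the adapted derivation
  being closed under initial segments alone would not pass to the derived sets, since an initial segment
  may have just one extension.
\<close>

lemma hereditary_derived: "hereditary T \<Longrightarrow> hereditary (derived Q T \<xi>)"
proof (induction \<xi> rule: less_induct)
  case (less \<xi>)
  show ?case
    unfolding hereditary_def
  proof (intro ballI allI impI)
    fix t s :: "'a list" assume t: "t \<in> derived Q T \<xi>" and st: "subseq s t"
    have "\<exists>y. Q i y \<and> s @ [y] \<in> derived Q T \<zeta>" if \<zeta>: "\<zeta> < \<xi>" for \<zeta> i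
    proof -
      obtain y where y: "Q i y" "t @ [y] \<in> derived Q T \<zeta>"
        using t mem_derived_iff[of t Q T \<xi>] \<zeta> by blast
      have "subseq (s @ [y]) (t @ [y])" using st by simp
      with less \<zeta> y(2) have "s @ [y] \<in> derived Q T \<zeta>" unfolding hereditary_def by blast
      with y(1) show ?thesis by blast
    qed
    moreover have "s \<in> T"
      using less.prems st t derived_subset unfolding hereditary_def by blast
    ultimately show "s \<in> derived Q T \<xi>"
      by (subst mem_derived_iff) blast
  qed
qed

lemma Nil_mem_hereditary: "hereditary T \<Longrightarrow> [] \<in> T \<longleftrightarrow> T \<noteq> {}"
  by (auto simp: hereditary_def)

lemma tree_deriv_eq:
  assumes "hereditary T"
  shows "tree_deriv T = ext_deriv any T"
proof -
  \<comment> \<open>A proper extension can be shortened to one by a single entry.\<close>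
  have "\<exists>y. t @ [y] \<in> T" if s: "s \<in> T" "strict_prefix t s" for t s
  proof -
    obtain y u where "s = t @ y # u" using s(2) by (elim strict_prefixE')
    then have "prefix (t @ [y]) s" by simp
    then have "t @ [y] \<in> T"
      using assms s(1) prefix_imp_subseq unfolding hereditary_def by blast
    then show ?thesis ..
  qed
  moreover have "strict_prefix t (t @ [y])" for t :: "'a list" and y
    by (simp add: strict_prefix_def)
  ultimately show ?thesis
    unfolding tree_deriv_def ext_deriv_def by blast
qed

lemma orec_tree_deriv:
  assumes "hereditary T"
  shows "orec T tree_deriv Inter \<xi> = derived any T \<xi>"
proof (induction \<xi> rule: less_induct)
  case (less \<xi>)
  consider "\<xi> = 0" | \<zeta> where "\<xi> = osucc \<zeta>" | "is_limit \<xi>"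
    by (auto simp: is_limit_def)
  then show ?case
  proof cases
    case 1
    then show ?thesis by (simp add: derived_def orec_zero)
  next
    case 2
    then have "orec T tree_deriv Inter \<xi> = tree_deriv (derived any T \<zeta>)"
      using less[of \<zeta>] less_osucc[of \<zeta>] by (simp add: orec_osucc)
    also have "\<dots> = ext_deriv any (derived any T \<zeta>)"
      by (rule tree_deriv_eq[OF hereditary_derived[OF assms]])
    finally show ?thesis by (simp add: 2 derived_def orec_osucc)
  next
    case 3
    then show ?thesis using less by (simp add: derived_def orec_limit)
  qed
qed

lemma iter_order_neq_Minf: "iter_order D T \<noteq> Minf"
  by (simp add: iter_order_def)

lemma less_iter_order_iff_nonempty:
  fixes \<xi> :: "('a + 'u) ordinal" and T :: "'a list set"
  assumes D: "\<And>\<zeta> :: ('a + 'u) ordinal. orec T D Inter \<zeta> = derived Q T \<zeta>"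
  shows "Fin \<xi> < iter_order D T \<longleftrightarrow> derived Q T \<xi> \<noteq> {}"
proof (cases "\<exists>\<zeta> :: ('a + 'u) ordinal. derived Q T \<zeta> = {}")
  case True
  define \<theta> :: "('a + 'u) ordinal" where "\<theta> = (LEAST \<zeta>. derived Q T \<zeta> = {})"
  have \<theta>: "derived Q T \<theta> = {}" unfolding \<theta>_def using True by (rule LeastI_ex)
  have "derived Q T \<xi> = {}" if "\<theta> \<le> \<xi>"
    using \<theta> derived_antimono[OF that] by blast
  moreover have "derived Q T \<xi> \<noteq> {}" if "\<xi> < \<theta>"
    using that not_less_Least unfolding \<theta>_def by blast
  ultimately have "\<xi> < \<theta> \<longleftrightarrow> derived Q T \<xi> \<noteq> {}" by (meson not_le)
  then show ?thesis using True by (simp add: iter_order_def D \<theta>_def)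
next
  case False
  then show ?thesis by (simp add: iter_order_def D)
qed

lemma less_iter_order_iff:
  assumes "hereditary T"
  shows "Fin \<xi> < iter_order (ext_deriv Q) T \<longleftrightarrow> [] \<in> derived Q T \<xi>"
  using less_iter_order_iff_nonempty[of T "ext_deriv Q" Q \<xi>, OF derived_def[symmetric]]
    Nil_mem_hereditary[OF hereditary_derived[OF assms, of Q \<xi>]]
  by simp

lemma less_tree_order_iff:
  assumes "hereditary T"
  shows "Fin \<xi> < tree_order T \<longleftrightarrow> [] \<in> derived any T \<xi>"
  unfolding tree_order_def
  using less_iter_order_iff_nonempty[of T tree_deriv any \<xi>, OF orec_tree_deriv[OF assms]]
    Nil_mem_hereditary[OF hereditary_derived[OF assms, of any \<xi>]]
  by simp

lemma fdd_deriv_eq: "fdd_deriv E = ext_deriv (\<lambda>i y. i \<le> Inf (fdd_supp E y))"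
  by (rule ext) (auto simp: fdd_deriv_def ext_deriv_def choice_iff)

lemma less_fdd_order_iff:
  assumes "hereditary T"
  shows "Fin \<xi> < fdd_order E T \<longleftrightarrow> [] \<in> derived (\<lambda>i y. i \<le> Inf (fdd_supp E y)) T \<xi>"
  unfolding fdd_order_def fdd_deriv_eq by (rule less_iter_order_iff[OF assms])

section \<open>Comparing the derived sets of two trees\<close>

text \<open>
  A relation between nodes that can be carried along every one-step extension transfers survival.
  The index \<open>i\<close> demanded of the source may depend on the index \<open>j\<close> requested from the target, which is
  how far extensions are selected.
\<close>

lemma derived_simulation:
  assumes "t \<in> derived Q T \<xi>" and "R t b"
    and mem: "\<And>t b. t \<in> T \<Longrightarrow> R t b \<Longrightarrow> b \<in> T'"
    and step: "\<And>t b j. t \<in> T \<Longrightarrow> R t b \<Longrightarrow>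
      \<exists>i. \<forall>y. Q i y \<longrightarrow> t @ [y] \<in> T \<longrightarrow> (\<exists>y'. Q' j y' \<and> R (t @ [y]) (b @ [y']))"
  shows "b \<in> derived Q' T' \<xi>"
  using assms(1,2)
proof (induction \<xi> arbitrary: t b rule: less_induct)
  case (less \<xi>)
  have t: "t \<in> T" by (rule subsetD[OF derived_subset less.prems(1)])
  have "\<exists>y'. Q' j y' \<and> b @ [y'] \<in> derived Q' T' \<zeta>" if \<zeta>: "\<zeta> < \<xi>" for \<zeta> j
  proof -
    obtain i where i: "\<And>y. Q i y \<Longrightarrow> t @ [y] \<in> T \<Longrightarrow> \<exists>y'. Q' j y' \<and> R (t @ [y]) (b @ [y'])"
      using step[OF t less.prems(2)] by blast
    obtain y where y: "Q i y" "t @ [y] \<in> derived Q T \<zeta>"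
      using less.prems(1) \<zeta> mem_derived_iff[of t Q T \<xi>] by blast
    then have "t @ [y] \<in> T" using derived_subset by blast
    with i y(1) obtain y' where "Q' j y'" "R (t @ [y]) (b @ [y'])" by blast
    then show ?thesis using less.IH[OF \<zeta> y(2)] by blast
  qed
  then show ?case
    by (subst mem_derived_iff) (use mem[OF t less.prems(2)] in blast)
qed

lemma derived_mono:
  assumes "T \<subseteq> T'" and "t \<in> derived Q T \<xi>"
  shows "t \<in> derived Q T' \<xi>"
  by (rule derived_simulation[OF assms(2), of "(=)"]) (use assms(1) in auto)

lemma derived_imp_derived_any: "t \<in> derived Q T \<xi> \<Longrightarrow> t \<in> derived any T \<xi>"
  by (erule derived_simulation[where R = "(=)"]) auto

lemma derived_extend:
  assumes "t \<in> derived any T ((osucc ^^ n) \<xi>)"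
  shows "\<exists>s. length s = n \<and> t @ s \<in> derived any T \<xi>"
  using assms
proof (induction n arbitrary: t)
  case (Suc n)
  then have "t \<in> derived any T (osucc ((osucc ^^ n) \<xi>))" by simp
  then obtain y where "t @ [y] \<in> derived any T ((osucc ^^ n) \<xi>)"
    using mem_derived_iff[of t any T "osucc ((osucc ^^ n) \<xi>)"] less_osucc by blast
  with Suc.IH[of "t @ [y]"] obtain s where "length s = n" "t @ y # s \<in> derived any T \<xi>" by auto
  then show ?case by (intro exI[of _ "y # s"]) simp
qed simp

text \<open>
  Here one vector is added to the target for \<open>n\<close> vectors in the source. Each step uses up a summand
  \<open>a \<ge> n\<close> of the rank; with \<open>a = \<omega>\<close> the length \<open>n\<close> may depend on the node.
\<close>

lemma derived_block_simulation:
  assumes "t \<in> derived any T (a * \<xi>)" and "R t b"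
    and mem: "\<And>t b. t \<in> T \<Longrightarrow> R t b \<Longrightarrow> b \<in> T'"
    and step: "\<And>t b j. t \<in> T \<Longrightarrow> R t b \<Longrightarrow>
      \<exists>n. (osucc ^^ n) 0 \<le> a \<and>
        (\<forall>s. length s = n \<longrightarrow> t @ s \<in> T \<longrightarrow> (\<exists>y. Q' j y \<and> R (t @ s) (b @ [y])))"
  shows "b \<in> derived Q' T' \<xi>"
  using assms(1,2)
proof (induction \<xi> arbitrary: t b rule: less_induct)
  case (less \<xi>)
  have t: "t \<in> T" using less.prems(1) derived_subset by blast
  have "\<exists>y. Q' j y \<and> b @ [y] \<in> derived Q' T' \<zeta>" if "\<zeta> < \<xi>" for \<zeta> j
  proof -
    obtain n where n: "(osucc ^^ n) 0 \<le> a"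
      "\<And>s. length s = n \<Longrightarrow> t @ s \<in> T \<Longrightarrow> \<exists>y. Q' j y \<and> R (t @ s) (b @ [y])"
      using step[OF t less.prems(2)] by blast
    have "(osucc ^^ n) (a * \<zeta>) = a * \<zeta> + (osucc ^^ n) 0" by (simp add: add_funpow_osucc)
    also have "\<dots> \<le> a * \<zeta> + a" by (rule add_le_mono2[OF n(1)])
    also have "\<dots> \<le> a * \<xi>" by (rule mult_add_le[OF that])
    finally have "t \<in> derived any T ((osucc ^^ n) (a * \<zeta>))"
      using less.prems(1) derived_antimono by blast
    then obtain s where s: "length s = n" "t @ s \<in> derived any T (a * \<zeta>)"
      using derived_extend by blast
    then have "t @ s \<in> T" using derived_subset by blast
    with n(2) s(1) obtain y where "Q' j y" "R (t @ s) (b @ [y])" by blast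
    then show ?thesis using less.IH[OF that s(2)] by blast
  qed
  then show ?case
    by (subst mem_derived_iff) (use mem[OF t less.prems(2)] in blast)
qed

text \<open>
  Below the image of every node of \<open>T\<close> hangs a copy of some tree of rank \<open>l\<close>, so a node of rank \<open>\<xi>\<close>
  acquires rank \<open>l + \<xi>\<close>: the first \<open>l\<close> stages of the derivation only use up the copies.
\<close>

lemma derived_concat:
  assumes t: "t \<in> derived Q T \<xi>"
    and Q: "\<And>i y. Q i y \<Longrightarrow> Q i (\<sigma> y)"
    and tail: "\<And>t. t \<in> T \<Longrightarrow> \<exists>S. [] \<in> derived Q S l \<and> (\<forall>s\<in>S. map \<sigma> (t @ s) \<in> T')"
  shows "map \<sigma> t \<in> derived Q T' (l + \<xi>)"
  using t
proof (induction \<xi> arbitrary: t rule: less_induct)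
  case (less \<xi>)
  have "t \<in> T" using less.prems derived_subset by blast
  then obtain S where S: "[] \<in> derived Q S l" "\<forall>s\<in>S. map \<sigma> (t @ s) \<in> T'" using tail by blast
  have base: "map \<sigma> t \<in> derived Q T' l"
    by (rule derived_simulation[OF S(1), of "\<lambda>s b. b = map \<sigma> (t @ s)"]) (use S Q in auto)
  have "\<exists>y. Q i y \<and> map \<sigma> t @ [y] \<in> derived Q T' \<zeta>" if "\<zeta> < l + \<xi>" for \<zeta> i
  proof (cases "\<zeta> < l")
    case True
    then show ?thesis using base mem_derived_iff[of "map \<sigma> t" Q T' l] by blast
  next
    case False
    with that obtain \<eta> where \<eta>: "\<eta> < \<xi>" "\<zeta> \<le> l + \<eta>" by (auto simp: less_add_iff)
    then obtain y where y: "Q i y" "t @ [y] \<in> derived Q T \<eta>"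
      using less.prems mem_derived_iff[of t Q T \<xi>] by blast
    have "map \<sigma> t @ [\<sigma> y] \<in> derived Q T' (l + \<eta>)"
      using less.IH[OF \<eta>(1) y(2)] by simp
    then show ?thesis using Q[OF y(1)] derived_antimono[OF \<eta>(2)] by blast
  qed
  moreover have "map \<sigma> t \<in> T'" using base derived_subset by blast
  ultimately show ?case by (subst mem_derived_iff) blast
qed

section \<open>Suprema of indices\<close>

lemma extended_eqI:
  fixes x y :: "'u ordinal extended"
  assumes "x \<noteq> Minf" "y \<noteq> Minf" and "\<And>\<xi>. Fin \<xi> < x \<longleftrightarrow> Fin \<xi> < y"
  shows "x = y"
proof (rule ccontr)
  assume "x \<noteq> y"
  then consider "x < y" | "y < x" by fastforce
  then show False
  proof cases
    case 1
    then obtain \<xi> where "x = Fin \<xi>" using assms(1) by (cases x) auto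
    then show False using 1 assms(3)[of \<xi>] by simp
  next
    case 2
    then obtain \<xi> where "y = Fin \<xi>" using assms(2) by (cases y) auto
    then show False using 2 assms(3)[of \<xi>] by simp
  qed
qed

lemma extended_leI:
  fixes x y :: "'u ordinal extended"
  assumes "y \<noteq> Minf" and "\<And>\<xi>. Fin \<xi> < x \<Longrightarrow> Fin \<xi> < y"
  shows "x \<le> y"
proof (rule ccontr)
  assume "\<not> x \<le> y"
  then have yx: "y < x" by simp
  then obtain \<xi> where "y = Fin \<xi>" using assms(1) by (cases y) auto
  then show False using yx assms(2)[of \<xi>] by simp
qed

lemma lub_extended_le_iff:
  fixes A :: "'u ordinal extended set"
  assumes "A \<noteq> {}" "Minf \<notin> A"
  shows "lub A \<le> b \<longleftrightarrow> (\<forall>a\<in>A. a \<le> b)"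
proof -
  have notMinf: "b \<noteq> Minf" if "\<forall>a\<in>A. a \<le> b" for b
    using that assms by auto
  obtain l where l: "\<forall>a\<in>A. a \<le> l" "\<And>b. \<forall>a\<in>A. a \<le> b \<Longrightarrow> l \<le> b"
  proof (cases "\<exists>x. \<forall>a\<in>A. a \<le> Fin x")
    case True
    define x where "x = (LEAST x. \<forall>a\<in>A. a \<le> Fin x)"
    show ?thesis
    proof
      show "\<forall>a\<in>A. a \<le> Fin x" unfolding x_def using True by (rule LeastI_ex)
      fix b assume b: "\<forall>a\<in>A. a \<le> b"
      show "Fin x \<le> b"
      proof (cases b)
        case (Fin z)
        then show ?thesis using b by (auto simp: x_def intro: Least_le)
      qed (use notMinf[OF b] in auto)
    qed
  next
    case False
    show ?thesis
    proof
      show "\<forall>a\<in>A. a \<le> Pinf" by simp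
      fix b assume b: "\<forall>a\<in>A. a \<le> b"
      then show "Pinf \<le> b" using False notMinf[OF b] by (cases b) auto
    qed
  qed
  then have "lub A = l" unfolding lub_def by (intro Least_equality) auto
  then show ?thesis using l order_trans by blast
qed

lemma less_lub_extended_iff:
  fixes A :: "'u ordinal extended set"
  assumes "A \<noteq> {}" "Minf \<notin> A"
  shows "Fin \<xi> < lub A \<longleftrightarrow> (\<exists>a\<in>A. Fin \<xi> < a)"
  using lub_extended_le_iff[OF assms, of "Fin \<xi>"] by (meson not_le)

lemma lub_family_mono:
  fixes f g :: "real \<Rightarrow> 'u ordinal extended"
  assumes "\<And>K. f K \<noteq> Minf" "\<And>K. g K \<noteq> Minf" and le: "\<And>K. 1 \<le> K \<Longrightarrow> f K \<le> g K"
  shows "lub {f K | K. K \<ge> 1} \<le> lub {g K | K. K \<ge> 1}"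
proof -
  have ne: "{h K | K :: real. K \<ge> 1} \<noteq> {}" for h :: "real \<Rightarrow> 'u ordinal extended"
    using order_refl[of "1::real"] by blast
  have fg: "Minf \<notin> {f K | K. K \<ge> 1}" "Minf \<notin> {g K | K. K \<ge> 1}"
    using assms(1,2) by (auto simp: eq_commute[of Minf])
  have "g K \<le> lub {g K | K. K \<ge> 1}" if "1 \<le> K" for K
    using lub_extended_le_iff[OF ne fg(2), of "lub {g K | K. K \<ge> 1}"] that by blast
  then have "\<forall>a\<in>{f K | K. K \<ge> 1}. a \<le> lub {g K | K. K \<ge> 1}"
    using le order_trans by blast
  then show ?thesis using lub_extended_le_iff[OF ne fg(1)] by blast
qed

text \<open>
  The form in which the indices are handled, with \<open>f K\<close> the index for the constant \<open>K\<close>. The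
  assumption \<open>limit\<close> says that survival to all stages below a limit means survival to the limit; as
  the supremum is a limit ordinal, no \<open>f K\<close> can attain it.
\<close>

lemma index_omega_pow:
  fixes f :: "real \<Rightarrow> 'u ordinal extended"
  assumes Minf: "\<And>K. f K \<noteq> Minf"
    and finite: "\<And>n. \<exists>K\<ge>1. Fin ((osucc ^^ n) 0) < f K"
    and double: "\<And>K l. K \<ge> 1 \<Longrightarrow> is_limit l \<Longrightarrow> Fin l < f K \<Longrightarrow> \<exists>K'\<ge>1. Fin (l + l) < f K'"
    and limit: "\<And>K l. K \<ge> 1 \<Longrightarrow> is_limit l \<Longrightarrow> (\<And>\<zeta>. \<zeta> < l \<Longrightarrow> Fin \<zeta> < f K) \<Longrightarrow> Fin l < f K"
    and fin: "lub {f K | K. K \<ge> 1} \<noteq> Pinf"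
  shows "\<exists>\<xi>. lub {f K | K. K \<ge> 1} = Fin (omega_pow \<xi>)"
    and "K \<ge> 1 \<Longrightarrow> f K < lub {f K | K. K \<ge> 1}"
proof -
  let ?A = "{f K | K. K \<ge> 1}"
  have A: "?A \<noteq> {}" "Minf \<notin> ?A" using Minf by (auto intro: exI[of _ 1]) (metis Minf)
  note less_iff = less_lub_extended_iff[OF A]
  have "lub ?A \<noteq> Minf" using finite[of 0] less_iff[of 0] by auto
  then obtain \<theta> where \<theta>: "lub ?A = Fin \<theta>" using fin by (cases "lub ?A") auto
  have \<theta>_iff: "\<xi> < \<theta> \<longleftrightarrow> (\<exists>K\<ge>1. Fin \<xi> < f K)" for \<xi>
    using less_iff[of \<xi>] unfolding \<theta> by auto
  have "x < \<theta>" if "x < omega" for x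
    using that finite \<theta>_iff by (metis less_omegaE)
  then have om: "omega \<le> \<theta>" by (meson not_le less_irrefl)
  have db: "l + l < \<theta>" if "is_limit l" "l < \<theta>" for l
    using that \<theta>_iff double by blast
  show "\<exists>\<xi>. lub ?A = Fin (omega_pow \<xi>)" using omega_powI(1)[OF om db] \<theta> by simp
  have lim: "is_limit \<theta>" using omega_powI(2)[OF om db] .
  assume K: "K \<ge> 1"
  have "f K \<le> lub ?A" using lub_extended_le_iff[OF A, of "lub ?A"] K by auto
  moreover have "f K \<noteq> lub ?A"
    using limit[OF K lim] \<theta> by auto
  ultimately show "f K < lub ?A" by simp
qed

section \<open>Norms of linear combinations\<close>

text \<open>
  The norm of the two-dimensional space \<open>\<ell>\<^sub>p\<close> on non-negative arguments; it computes the norm of a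
  concatenation of two coefficient sequences.
\<close>

definition lp_join :: "ereal \<Rightarrow> real \<Rightarrow> real \<Rightarrow> real" where
  "lp_join p u v =
     (if p = PInfty then max u v
      else (u powr real_of_ereal p + v powr real_of_ereal p) powr (1 / real_of_ereal p))"

definition comb :: "(nat \<Rightarrow> real) \<Rightarrow> 'a::real_vector list \<Rightarrow> 'a" where
  "comb a xs = (\<Sum>i<length xs. a i *\<^sub>R xs ! i)"

lemma lp_exponent:
  assumes "(1::ereal) \<le> p"
  shows "p = PInfty \<or> 1 \<le> real_of_ereal p"
  using assms by (cases p) (auto simp: one_ereal_def)

lemma lp_join_zero_left: "1 \<le> p \<Longrightarrow> 0 \<le> v \<Longrightarrow> lp_join p 0 v = v"
  using lp_exponent[of p] by (auto simp: lp_join_def powr_powr)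

lemma lp_join_commute: "lp_join p u v = lp_join p v u"
  by (simp add: lp_join_def max.commute add.commute)

lemma lp_join_upper:
  assumes p: "1 \<le> p" and "0 \<le> u" "0 \<le> v"
  shows "u \<le> lp_join p u v" "v \<le> lp_join p u v"
proof -
  have "u \<le> lp_join p u v \<and> v \<le> lp_join p u v"
  proof (cases "p = PInfty")
    case False
    define r where "r = real_of_ereal p"
    have r: "1 \<le> r" using lp_exponent[OF p] False by (simp add: r_def)
    have *: "w = (w powr r) powr (1 / r)" if "0 \<le> w" for w
      using that r by (simp add: powr_powr)
    have "(u powr r) powr (1 / r) \<le> (u powr r + v powr r) powr (1 / r)"
      "(v powr r) powr (1 / r) \<le> (u powr r + v powr r) powr (1 / r)"
      using r by (auto intro!: powr_mono2)
    then show ?thesis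
      using *[OF assms(2)] *[OF assms(3)] False by (simp add: lp_join_def r_def)
  qed (simp add: lp_join_def)
  then show "u \<le> lp_join p u v" "v \<le> lp_join p u v" by auto
qed

text \<open>
  The constant \<open>2\<close> is good for all exponents at once, since \<open>2\<^bsup>1/p\<^esup> \<le> 2\<close>.
\<close>

lemma lp_join_le:
  assumes p: "1 \<le> p" and "0 \<le> u" "0 \<le> v"
  shows "lp_join p u v \<le> 2 * max u v"
proof (cases "p = PInfty")
  case False
  define r where "r = real_of_ereal p"
  have r: "1 \<le> r" using lp_exponent[OF p] False by (simp add: r_def)
  define m where "m = max u v"
  have m: "0 \<le> m" using assms by (simp add: m_def)
  have "u powr r \<le> m powr r" "v powr r \<le> m powr r"
    using assms r by (auto simp: m_def intro!: powr_mono2)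
  then have "(u powr r + v powr r) powr (1 / r) \<le> (2 * m powr r) powr (1 / r)"
    using r by (intro powr_mono2) auto
  also have "\<dots> = 2 powr (1 / r) * m"
    using r m by (simp add: powr_mult powr_powr)
  also have "\<dots> \<le> 2 powr 1 * m"
    using r m by (intro mult_right_mono powr_mono) auto
  finally show ?thesis using False by (simp add: lp_join_def r_def m_def)
qed (use assms in \<open>auto simp: lp_join_def max_def\<close>)

lemma lp_norm_nonneg: "0 \<le> lp_norm p n a"
  by (auto simp: lp_norm_def)

lemma lp_norm_cong: "(\<And>i. i < n \<Longrightarrow> a i = b i) \<Longrightarrow> lp_norm p n a = lp_norm p n b"
  unfolding lp_norm_def by (auto intro!: arg_cong[of _ _ Max] arg_cong[of _ _ "\<lambda>x. x powr _"] sum.cong)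

lemma lp_norm_0: "lp_norm p 0 a = 0"
  by (simp add: lp_norm_def)

lemma lp_norm_add:
  assumes p: "1 \<le> p"
  shows "lp_norm p (m + n) a = lp_join p (lp_norm p m a) (lp_norm p n (\<lambda>i. a (m + i)))"
proof (cases "p = PInfty")
  case True
  have "{..<m + n} = {..<m} \<union> (\<lambda>i. m + i) ` {..<n}"
    by (auto simp: image_iff Bex_def) (metis add_diff_inverse_nat nat_add_left_cancel_less)
  then have eq: "insert 0 ((\<lambda>i. \<bar>a i\<bar>) ` {..<m + n}) =
    insert 0 ((\<lambda>i. \<bar>a i\<bar>) ` {..<m}) \<union> insert 0 ((\<lambda>i. \<bar>a (m + i)\<bar>) ` {..<n})"
    by (auto simp: image_Un image_image)
  show ?thesis
    unfolding lp_norm_def lp_join_def eq using True by (subst Max_Un) auto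
next
  case False
  define r where "r = real_of_ereal p"
  have r: "1 \<le> r" using lp_exponent[OF p] False by (simp add: r_def)
  have "(\<Sum>i<m + n. \<bar>a i\<bar> powr r) = (\<Sum>i<m. \<bar>a i\<bar> powr r) + (\<Sum>i<n. \<bar>a (m + i)\<bar> powr r)"
    by (induction n) (auto simp: algebra_simps)
  moreover have "(x powr (1 / r)) powr r = x" if "0 \<le> x" for x
    using r that by (simp add: powr_powr)
  ultimately show ?thesis
    using False r by (simp add: lp_norm_def lp_join_def sum_nonneg flip: r_def)
qed

lemma lp_norm_1: "1 \<le> p \<Longrightarrow> lp_norm p 1 a = \<bar>a 0\<bar>"
  using lp_exponent[of p] by (auto simp: lp_norm_def powr_powr lessThan_Suc)

lemma lp_norm_Suc: "1 \<le> p \<Longrightarrow> lp_norm p (Suc n) a = lp_join p \<bar>a 0\<bar> (lp_norm p n (\<lambda>i. a (Suc i)))"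
  using lp_norm_add[of p 1 n a] by (simp add: lp_norm_1[simplified])

lemma lp_norm_scale:
  assumes p: "1 \<le> p"
  shows "lp_norm p n (\<lambda>i. c * a i) = \<bar>c\<bar> * lp_norm p n a"
proof -
  have join: "lp_join p (\<bar>c\<bar> * u) (\<bar>c\<bar> * v) = \<bar>c\<bar> * lp_join p u v" if "0 \<le> u" "0 \<le> v" for u v
  proof (cases "p = PInfty")
    case True
    then show ?thesis by (simp add: lp_join_def max_mult_distrib_left)
  next
    case False
    define r where "r = real_of_ereal p"
    have r: "1 \<le> r" using lp_exponent[OF p] False by (simp add: r_def)
    have "(\<bar>c\<bar> * u) powr r + (\<bar>c\<bar> * v) powr r = \<bar>c\<bar> powr r * (u powr r + v powr r)"
      using that by (simp add: powr_mult distrib_left)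
    then show ?thesis
      using False r that by (simp add: lp_join_def powr_mult powr_powr flip: r_def)
  qed
  show ?thesis
  proof (induction n arbitrary: a)
    case (Suc n)
    then show ?case
      using join[of "\<bar>a 0\<bar>" "lp_norm p n (\<lambda>i. a (Suc i))"]
      by (simp add: lp_norm_Suc[OF p] abs_mult lp_norm_nonneg)
  qed (simp add: lp_norm_0)
qed

lemma abs_le_lp_norm:
  assumes p: "1 \<le> p" and "i < n"
  shows "\<bar>a i\<bar> \<le> lp_norm p n a"
  using assms(2)
proof (induction n arbitrary: a i)
  case (Suc n)
  have up: "\<bar>a 0\<bar> \<le> lp_norm p (Suc n) a" "lp_norm p n (\<lambda>i. a (Suc i)) \<le> lp_norm p (Suc n) a"
    unfolding lp_norm_Suc[OF p] by (rule lp_join_upper[OF p]; simp add: lp_norm_nonneg)+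
  show ?case
  proof (cases i)
    case (Suc j)
    then show ?thesis using Suc.IH[of j "\<lambda>i. a (Suc i)"] Suc.prems up(2) by simp
  qed (use up in simp)
qed simp

lemma lp_norm_pos: "1 \<le> p \<Longrightarrow> i < n \<Longrightarrow> a i \<noteq> 0 \<Longrightarrow> 0 < lp_norm p n a"
  using abs_le_lp_norm[of p i n a] by linarith

lemma lp_norm_zero: "1 \<le> p \<Longrightarrow> lp_norm p n (\<lambda>_. 0) = 0"
  using lp_norm_scale[of p n 0 "\<lambda>_. 0"] by simp

lemma lp_norm_single:
  assumes p: "1 \<le> p"
  shows "j < n \<Longrightarrow> lp_norm p n (\<lambda>i. if i = j then c else 0) = \<bar>c\<bar>"
proof (induction n arbitrary: j)
  case (Suc n)
  show ?case
  proof (cases j)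
    case 0
    have "lp_join p \<bar>c\<bar> 0 = \<bar>c\<bar>"
      using lp_join_zero_left[OF p, of "\<bar>c\<bar>"] by (simp add: lp_join_commute)
    then show ?thesis by (simp add: lp_norm_Suc[OF p] 0 lp_norm_zero[OF p])
  next
    case (Suc k)
    then show ?thesis
      using Suc.IH[of k] Suc.prems by (simp add: lp_norm_Suc[OF p] lp_join_zero_left[OF p])
  qed
qed simp

lemma comb_Nil [simp]: "comb a [] = 0"
  by (simp add: comb_def)

lemma comb_append: "comb a (xs @ ys) = comb a xs + comb (\<lambda>i. a (length xs + i)) ys"
proof -
  have "(\<Sum>i<m + n. f i) = (\<Sum>i<m. f i) + (\<Sum>i<n. f (m + i))" for f :: "nat \<Rightarrow> 'a" and m n
    by (induction n) (auto simp: algebra_simps)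
  then show ?thesis by (simp add: comb_def nth_append)
qed

lemma comb_Cons: "comb a (x # xs) = a 0 *\<^sub>R x + comb (\<lambda>i. a (Suc i)) xs"
  using comb_append[of a "[x]" xs] by (simp add: comb_def)

lemma comb_scale: "comb (\<lambda>i. c * a i) xs = c *\<^sub>R comb a xs"
  by (simp add: comb_def scaleR_sum_right)

lemma comb_map_scale: "comb a (map ((*\<^sub>R) c) xs) = c *\<^sub>R comb a xs"
  by (simp add: comb_def scaleR_sum_right mult.commute)

lemma comb_cong: "(\<And>i. i < length xs \<Longrightarrow> a i = b i) \<Longrightarrow> comb a xs = comb b xs"
  by (simp add: comb_def)

lemma comb_zero: "(\<And>i. i < length xs \<Longrightarrow> a i = 0) \<Longrightarrow> comb a xs = 0"
  by (simp add: comb_def)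

lemma comb_single: "j < length xs \<Longrightarrow> comb (\<lambda>i. if i = j then c else 0) xs = c *\<^sub>R xs ! j"
  by (simp add: comb_def if_distrib[of "\<lambda>x. x *\<^sub>R _"] sum.delta cong: if_cong)

lemma linear_comb: "linear f \<Longrightarrow> f (comb a xs) = (\<Sum>i<length xs. a i *\<^sub>R f (xs ! i))"
  by (simp add: comb_def linear_sum linear_scale)

section \<open>Trees of sequences equivalent to the unit vector basis\<close>

text \<open>
  The homogeneous form: coefficients of norm \<open>1\<close> can be replaced by arbitrary ones, and the condition that
  the vectors lie in the unit ball is the upper estimate at the unit vectors.
\<close>

lemma Tp_iff:
  assumes p: "1 \<le> p" and K: "1 \<le> K"
  shows "xs \<in> Tp p X K \<longleftrightarrow> set xs \<subseteq> X \<and>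
    (\<forall>a. lp_norm p (length xs) a \<le> K * norm (comb a xs) \<and> norm (comb a xs) \<le> lp_norm p (length xs) a)"
proof
  let ?n = "length xs"
  assume xs: "xs \<in> Tp p X K"
  have "lp_norm p ?n a \<le> K * norm (comb a xs) \<and> norm (comb a xs) \<le> lp_norm p ?n a" for a
  proof (cases "lp_norm p ?n a = 0")
    case True
    then have "comb a xs = 0" using abs_le_lp_norm[OF p, of _ ?n a] by (intro comb_zero) auto
    then show ?thesis using True by simp
  next
    case False
    define c where "c = lp_norm p ?n a"
    have c: "0 < c" using False lp_norm_nonneg[of p ?n a] by (simp add: c_def)
    have "lp_norm p ?n (\<lambda>i. inverse c * a i) = 1"
      using c by (simp add: lp_norm_scale[OF p] flip: c_def)
    then have "inverse K \<le> norm (comb (\<lambda>i. inverse c * a i) xs)"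
      "norm (comb (\<lambda>i. inverse c * a i) xs) \<le> 1"
      using xs unfolding Tp_def comb_def by blast+
    then have "inverse K \<le> norm (comb a xs) / c" "norm (comb a xs) / c \<le> 1"
      using c unfolding comb_scale by (auto simp: divide_inverse mult.commute)
    then show ?thesis using c K unfolding c_def[symmetric] by (auto simp: field_simps)
  qed
  then show "set xs \<subseteq> X \<and>
    (\<forall>a. lp_norm p ?n a \<le> K * norm (comb a xs) \<and> norm (comb a xs) \<le> lp_norm p ?n a)"
    using xs by (auto simp: Tp_def)
next
  let ?n = "length xs"
  assume *: "set xs \<subseteq> X \<and>
    (\<forall>a. lp_norm p ?n a \<le> K * norm (comb a xs) \<and> norm (comb a xs) \<le> lp_norm p ?n a)"
  have "norm x \<le> 1" if x: "x \<in> set xs" for x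
  proof -
    obtain j where j: "j < ?n" "x = xs ! j" using x unfolding in_set_conv_nth by blast
    have "norm (comb (\<lambda>i. if i = j then 1 else 0) xs) \<le> lp_norm p ?n (\<lambda>i. if i = j then 1 else 0)"
      by (rule *[THEN conjunct2, rule_format, THEN conjunct2])
    then show ?thesis using j lp_norm_single[OF p j(1), of 1] by (simp add: comb_single)
  qed
  moreover have "inverse K \<le> norm (comb a xs) \<and> norm (comb a xs) \<le> 1" if "lp_norm p ?n a = 1" for a
    using *[THEN conjunct2, rule_format, of a] that K by (auto simp: field_simps)
  ultimately show "xs \<in> Tp p X K"
    using * by (auto simp: Tp_def comb_def)
qed

lemma Tp_mono: "X \<subseteq> Y \<Longrightarrow> Tp p X K \<subseteq> Tp p Y K"
  by (auto simp: Tp_def)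

lemma singleton_in_Tp: "1 \<le> p \<Longrightarrow> 1 \<le> K \<Longrightarrow> x \<in> X \<Longrightarrow> norm x = 1 \<Longrightarrow> [x] \<in> Tp p X K"
  by (auto simp: Tp_iff lp_norm_1[simplified] comb_Cons intro: mult_right_mono[of 1 K, simplified])

text \<open>
  Every combination of \<open>b\<close> is a combination of \<open>t\<close> with coefficients of the same norm. This holds
  when \<open>b\<close> is a subsequence of \<open>t\<close> or consists of normalized successive blocks of \<open>t\<close>, and it is all
  that is needed of blocks.
\<close>

definition lp_embeds :: "ereal \<Rightarrow> 'a::real_vector list \<Rightarrow> 'a list \<Rightarrow> bool" where
  "lp_embeds p t b \<longleftrightarrow>
     (\<forall>c. \<exists>a. lp_norm p (length t) a = lp_norm p (length b) c \<and> comb a t = comb c b)"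

lemma lp_embeds_Tp:
  assumes "1 \<le> p" "1 \<le> K" "t \<in> Tp p X K" "lp_embeds p t b" "set b \<subseteq> Y"
  shows "b \<in> Tp p Y K"
  unfolding Tp_iff[OF assms(1,2)]
  using assms(3)[unfolded Tp_iff[OF assms(1,2)]] assms(4,5) unfolding lp_embeds_def by metis

lemma lp_embeds_Nil: "lp_embeds p [] []"
  by (auto simp: lp_embeds_def)

lemma lp_embeds_snoc:
  assumes p: "1 \<le> p" and tb: "lp_embeds p t b"
    and e: "lp_norm p (length s) e = 1" and v: "v = comb e s"
  shows "lp_embeds p (t @ s) (b @ [v])"
  unfolding lp_embeds_def
proof
  fix c
  let ?m = "length t"
  obtain a where a: "lp_norm p ?m a = lp_norm p (length b) c" "comb a t = comb c b"
    using tb unfolding lp_embeds_def by blast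
  define c' where "c' = c (length b)"
  define a' where "a' i = (if i < ?m then a i else c' * e (i - ?m))" for i
  have "comb a' (t @ s) = comb a t + comb (\<lambda>i. c' * e i) s"
    unfolding comb_append by (intro arg_cong2[of _ _ _ _ "(+)"] comb_cong) (auto simp: a'_def)
  also have "\<dots> = comb c (b @ [v])"
    unfolding comb_append comb_scale a(2) v by (simp add: comb_Cons c'_def)
  finally have 1: "comb a' (t @ s) = comb c (b @ [v])" .
  have "lp_norm p ?m a' = lp_norm p ?m a"
    by (rule lp_norm_cong) (simp add: a'_def)
  moreover have "lp_norm p (length s) (\<lambda>i. a' (?m + i)) = \<bar>c'\<bar>"
    by (simp add: a'_def lp_norm_scale[OF p] e)
  ultimately have "lp_norm p (length (t @ s)) a' = lp_join p (lp_norm p (length b) c) \<bar>c'\<bar>"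
    using lp_norm_add[OF p, of ?m "length s" a'] a(1) by simp
  also have "\<dots> = lp_norm p (length (b @ [v])) c"
    using lp_norm_add[OF p, of "length b" 1 c] by (simp add: lp_norm_1[OF p, simplified] c'_def)
  finally show "\<exists>a. lp_norm p (length (t @ s)) a = lp_norm p (length (b @ [v])) c \<and>
      comb a (t @ s) = comb c (b @ [v])"
    using 1 by blast
qed

lemma lp_embeds_subseq:
  assumes p: "1 \<le> p"
  shows "subseq b t \<Longrightarrow> lp_embeds p t b"
proof (induction rule: list_emb.induct)
  case (list_emb_Nil ys)
  show ?case
    unfolding lp_embeds_def
    using lp_norm_zero[OF p] by (intro allI exI[of _ "\<lambda>_. 0"]) (auto simp: lp_norm_0 comb_zero)
next
  case (list_emb_Cons xs ys y)
  show ?case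
    unfolding lp_embeds_def
  proof
    fix c
    obtain a where a: "lp_norm p (length ys) a = lp_norm p (length xs) c" "comb a ys = comb c xs"
      using list_emb_Cons.IH unfolding lp_embeds_def by blast
    then show "\<exists>a. lp_norm p (length (y # ys)) a = lp_norm p (length xs) c \<and> comb a (y # ys) = comb c xs"
      by (intro exI[of _ "case_nat 0 a"])
        (simp add: lp_norm_Suc[OF p] lp_join_zero_left[OF p] lp_norm_nonneg comb_Cons)
  qed
next
  case (list_emb_Cons2 x y xs ys)
  show ?case
    unfolding lp_embeds_def
  proof
    fix c
    obtain a where a: "lp_norm p (length ys) a = lp_norm p (length xs) (\<lambda>i. c (Suc i))"
      "comb a ys = comb (\<lambda>i. c (Suc i)) xs"
      using list_emb_Cons2.IH unfolding lp_embeds_def by blast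
    then show "\<exists>a. lp_norm p (length (y # ys)) a = lp_norm p (length (x # xs)) c \<and>
        comb a (y # ys) = comb c (x # xs)"
      using list_emb_Cons2.hyps
      by (intro exI[of _ "case_nat (c 0) a"]) (simp add: lp_norm_Suc[OF p] comb_Cons)
  qed
qed

lemma hereditary_Tp:
  assumes "1 \<le> p" "1 \<le> K"
  shows "hereditary (Tp p X K)"
  unfolding hereditary_def
proof (intro ballI allI impI)
  fix t s assume t: "t \<in> Tp p X K" and s: "subseq s t"
  have "set s \<subseteq> X" using t s by (auto simp: Tp_def dest: list_emb_set)
  then show "s \<in> Tp p X K"
    using lp_embeds_Tp[OF assms t lp_embeds_subseq[OF assms(1) s]] by blast
qed

lemma Nil_in_Tp: "1 \<le> p \<Longrightarrow> [] \<in> Tp p X K"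
  by (simp add: Tp_def lp_norm_0)

text \<open>
  From \<open>\<parallel>x\<parallel> \<le> C \<parallel>x + y\<parallel>\<close> also \<open>\<parallel>y\<parallel> \<le> (1 + C) \<parallel>x + y\<parallel>\<close>, so \<open>\<parallel>x + y\<parallel>\<close> is equivalent to
  the maximum of the two norms. One factor \<open>2\<close> of the constant compares the maximum with the
  \<open>\<ell>\<^sub>p\<close> sum; the other comes from halving, which brings the upper estimate \<open>2\<close> back to \<open>1\<close>.
\<close>

lemma glue_Tp:
  fixes t s :: "'a::banach list"
  assumes p: "1 \<le> p" and K: "1 \<le> K" and C: "0 \<le> C"
    and t: "t \<in> Tp p X K" and s: "s \<in> Tp p X K"
    and sep: "\<And>a b. norm (comb a t) \<le> C * norm (comb a t + comb b s)"
  shows "map ((*\<^sub>R) (1/2)) (t @ s) \<in> Tp p UNIV (4 * (1 + C) * K)"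
proof -
  have K': "1 \<le> 4 * (1 + C) * K"
  proof -
    have "1 * 1 \<le> (4 * (1 + C)) * K" using K C by (intro mult_mono) auto
    then show ?thesis by simp
  qed
  let ?m = "length t" and ?n = "length s"
  have "lp_norm p (?m + ?n) a \<le> 4 * (1 + C) * K * norm ((1/2) *\<^sub>R comb a (t @ s)) \<and>
      norm ((1/2) *\<^sub>R comb a (t @ s)) \<le> lp_norm p (?m + ?n) a" for a
  proof -
    define b where "b i = a (?m + i)" for i
    define x y where "x = comb a t" and "y = comb b s"
    define u v where "u = lp_norm p ?m a" and "v = lp_norm p ?n b"
    have uv: "0 \<le> u" "0 \<le> v" by (auto simp: u_def v_def lp_norm_nonneg)
    have split: "comb a (t @ s) = x + y" unfolding comb_append x_def y_def b_def ..
    have J: "lp_norm p (?m + ?n) a = lp_join p u v"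
      unfolding lp_norm_add[OF p] u_def v_def b_def ..
    have x: "u \<le> K * norm x" "norm x \<le> u"
      using t unfolding Tp_iff[OF p K] x_def u_def by blast+
    have y: "v \<le> K * norm y" "norm y \<le> v"
      using s unfolding Tp_iff[OF p K] y_def v_def by blast+
    have xC: "norm x \<le> C * norm (x + y)" using sep unfolding x_def y_def .
    have yC: "norm y \<le> (1 + C) * norm (x + y)"
      using norm_triangle_ineq4[of "x + y" x] xC by (simp add: algebra_simps)
    have xC': "norm x \<le> (1 + C) * norm (x + y)"
      using xC by (simp add: algebra_simps add_increasing)
    have "u \<le> K * ((1 + C) * norm (x + y))" "v \<le> K * ((1 + C) * norm (x + y))"
      using x(1) y(1) xC' yC K by (meson mult_left_mono order_trans zero_le_one)+
    then have "lp_join p u v \<le> 2 * (K * ((1 + C) * norm (x + y)))"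
      using lp_join_le[OF p uv] by linarith
    moreover have "norm (x + y) \<le> 2 * lp_join p u v"
      using norm_triangle_ineq[of x y] x(2) y(2) lp_join_upper[OF p uv] by linarith
    moreover have "4 * (1 + C) * K * norm ((1/2) *\<^sub>R (x + y)) = 2 * (K * ((1 + C) * norm (x + y)))"
      by (simp only: norm_scaleR) simp
    moreover have "norm ((1/2) *\<^sub>R (x + y)) = norm (x + y) / 2"
      by (simp only: norm_scaleR)
    ultimately show ?thesis unfolding split J by (intro conjI) linarith+
  qed
  then show ?thesis
    unfolding Tp_iff[OF p K'] comb_map_scale by simp
qed

section \<open>Subspaces of finite codimension\<close>

text \<open>
  A homogeneous system with more unknowns than equations. For one more equation, take a solution
  \<open>e1\<close> of the old ones that is nonzero at \<open>j\<close> and another, \<open>e2\<close>, that vanishes at \<open>j\<close>: the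
  combination of both that solves the new equation is nonzero.
\<close>

lemma homogeneous_system:
  fixes r :: "'i \<Rightarrow> 'b \<Rightarrow> real"
  assumes "finite B" "finite A" "card B < card A"
  shows "\<exists>e. (\<exists>j\<in>A. e j \<noteq> 0) \<and> (\<forall>b\<in>B. (\<Sum>j\<in>A. e j * r j b) = 0)"
  using assms
proof (induction B arbitrary: A rule: finite_induct)
  case empty
  then have "A \<noteq> {}" by auto
  then show ?case by (intro exI[of _ "\<lambda>_. 1"]) auto
next
  case (insert b B)
  have sub: "\<exists>e. e a = 0 \<and> (\<exists>j\<in>A. e j \<noteq> 0) \<and> (\<forall>b\<in>B. (\<Sum>j\<in>A. e j * r j b) = 0)"
    if a: "a \<in> A" for a
  proof -
    have "card B < card (A - {a})" using insert.hyps insert.prems a by simp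
    then obtain e where e: "\<exists>j\<in>A - {a}. e j \<noteq> 0" "\<forall>b\<in>B. (\<Sum>j\<in>A - {a}. e j * r j b) = 0"
      using insert.IH[of "A - {a}"] insert.prems by blast
    let ?e = "e(a := 0)"
    have "(\<Sum>j\<in>A. ?e j * r j c) = (\<Sum>j\<in>A - {a}. e j * r j c)" for c
      using a insert.prems(1) by (subst sum.remove[of A a]) (auto intro: sum.cong)
    then show ?thesis using e by (intro exI[of _ ?e]) auto
  qed
  obtain a where a: "a \<in> A" using insert.prems by fastforce
  obtain e1 j where e1: "j \<in> A" "e1 j \<noteq> 0" "\<forall>b\<in>B. (\<Sum>j\<in>A. e1 j * r j b) = 0"
    using sub[OF a] by blast
  obtain e2 where e2: "e2 j = 0" "\<exists>j\<in>A. e2 j \<noteq> 0" "\<forall>b\<in>B. (\<Sum>j\<in>A. e2 j * r j b) = 0"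
    using sub[OF e1(1)] by blast
  define s1 s2 where "s1 = (\<Sum>j\<in>A. e1 j * r j b)" and "s2 = (\<Sum>j\<in>A. e2 j * r j b)"
  show ?case
  proof (cases "s1 = 0 \<or> s2 = 0")
    case True
    then show ?thesis using e1 e2 unfolding s1_def s2_def by blast
  next
    case False
    define e where "e i = e2 i - s2 / s1 * e1 i" for i
    have "(\<Sum>j\<in>A. e j * r j c) = (\<Sum>j\<in>A. e2 j * r j c) - s2 / s1 * (\<Sum>j\<in>A. e1 j * r j c)" for c
      by (simp add: e_def algebra_simps sum_subtractf sum_distrib_left)
    then have "\<forall>c\<in>insert b B. (\<Sum>j\<in>A. e j * r j c) = 0"
      using e1(3) e2(3) False by (auto simp flip: s1_def s2_def)
    moreover have "e j \<noteq> 0" using e2(1) e1(2) False by (simp add: e_def)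
    ultimately show ?thesis using e1(1) by blast
  qed
qed

lemma kernel_combination:
  fixes r :: "'a::real_vector \<Rightarrow> 'b \<Rightarrow> real"
  assumes p: "1 \<le> p" and B: "finite B" "card B < length s" and lin: "\<And>b. b \<in> B \<Longrightarrow> linear (\<lambda>x. r x b)"
  shows "\<exists>e. lp_norm p (length s) e = 1 \<and> (\<forall>b\<in>B. r (comb e s) b = 0)"
proof -
  let ?n = "length s"
  obtain e j where e: "j < ?n" "e j \<noteq> 0" "\<forall>b\<in>B. (\<Sum>j<?n. e j * r (s ! j) b) = 0"
    using homogeneous_system[of B "{..<?n}" "\<lambda>j. r (s ! j)"] B by auto
  define c where "c = lp_norm p ?n e"
  have c: "0 < c" unfolding c_def using lp_norm_pos[OF p] e by blast
  let ?e = "\<lambda>i. inverse c * e i"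
  have "lp_norm p ?n ?e = 1" using c by (simp add: lp_norm_scale[OF p] flip: c_def)
  moreover have "r (comb ?e s) b = 0" if b: "b \<in> B" for b
  proof -
    have "r (comb e s) b = 0" using linear_comb[OF lin[OF b], of e s] e(3) b by simp
    then show ?thesis unfolding comb_scale using linear_scale[OF lin[OF b]] by simp
  qed
  ultimately show ?thesis by blast
qed

text \<open>
  With \<open>n\<close> equations, blocks of \<open>n + 1\<close> vectors contain a normalized combination in the kernel, and
  \<open>(n + 1) * \<zeta> < l\<close> for \<open>\<zeta>\<close> below the limit \<open>l\<close>. The constant \<open>K\<close> does not change.
\<close>

lemma derived_Tp_kernel:
  fixes F :: "('a::banach \<Rightarrow> real) set" and l :: "'u ordinal"
  assumes p: "1 \<le> p" and K: "1 \<le> K" and F: "finite F" "\<And>f. f \<in> F \<Longrightarrow> linear f"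
    and l: "is_limit l" and nonempty: "[] \<in> derived any (Tp p (UNIV :: 'a set) K) l"
  shows "[] \<in> derived any (Tp p (\<Inter>f\<in>F. {x. f x = 0}) K) l"
proof (rule derived_limit[OF l])
  let ?Y = "\<Inter>f\<in>F. {x. f x = 0}"
  let ?k = "Suc (card F)"
  fix \<zeta> assume "\<zeta> < l"
  then have "(osucc ^^ ?k) 0 * \<zeta> < l" by (rule finite_mult_less_limit[OF l])
  from less_imp_le[OF this] nonempty
  have "[] \<in> derived any (Tp p (UNIV :: 'a set) K) ((osucc ^^ ?k) 0 * \<zeta>)"
    by (rule derived_antimono)
  then show "[] \<in> derived any (Tp p ?Y K) \<zeta>"
  proof (rule derived_block_simulation[where R = "\<lambda>t b. lp_embeds p t b \<and> set b \<subseteq> ?Y"])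
    show "lp_embeds p [] [] \<and> set [] \<subseteq> ?Y" by (simp add: lp_embeds_Nil)
    show "b \<in> Tp p ?Y K" if "t \<in> Tp p UNIV K" "lp_embeds p t b \<and> set b \<subseteq> ?Y" for t b
      using lp_embeds_Tp[OF p K] that by blast
  next
    fix t b :: "'a list" and j :: nat
    assume tb: "lp_embeds p t b \<and> set b \<subseteq> ?Y"
    have "\<exists>y. lp_embeds p (t @ s) (b @ [y]) \<and> set (b @ [y]) \<subseteq> ?Y" if s: "length s = ?k" for s
    proof -
      obtain e where "lp_norm p (length s) e = 1" "\<forall>f\<in>F. f (comb e s) = 0"
        using kernel_combination[OF p F(1), of s "\<lambda>x f. f x"] F(2) s by auto
      then show ?thesis using lp_embeds_snoc[OF p, of t b s e] tb by (intro exI[of _ "comb e s"]) auto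
    qed
    then show "\<exists>n. (osucc ^^ n) 0 \<le> ((osucc ^^ ?k) 0 :: 'u ordinal) \<and> (\<forall>s. length s = n \<longrightarrow>
      t @ s \<in> Tp p UNIV K \<longrightarrow> (\<exists>y. True \<and> lp_embeds p (t @ s) (b @ [y]) \<and> set (b @ [y]) \<subseteq> ?Y))"
      by (intro exI[of _ ?k]) auto
  qed
qed

section \<open>Separating a finite sequence from a subspace of finite codimension\<close>

text \<open>
  The Hahn--Banach theorem, for the functional with value \<open>\<parallel>x\<parallel>\<close> at \<open>x\<close>. Functionals on subspaces are
  represented by their graphs, subspaces of the product with the real line, and Zorn's lemma is applied
  to subspaces that lie below the norm; such a subspace is automatically single-valued.
\<close>

lemma norming_functional:
  fixes x :: "'a::real_normed_vector"
  obtains f :: "'a \<Rightarrow> real" where "linear f" "\<And>y. f y \<le> norm y" "f x = norm x"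
proof -
  define \<G> where "\<G> = {G :: ('a \<times> real) set. subspace G \<and> (x, norm x) \<in> G \<and> (\<forall>(y, r)\<in>G. r \<le> norm y)}"
  have "c * norm x \<le> norm (c *\<^sub>R x)" for c
    by (simp add: mult_right_mono)
  then have "span {(x, norm x)} \<in> \<G>"
    unfolding \<G>_def using span_base[of "(x, norm x)" "{(x, norm x)}"] subspace_span[of "{(x, norm x)}"]
    by (auto simp: span_singleton simp del: norm_scaleR)
  then have ne: "\<G> \<noteq> {}" by blast
  have chain: "\<Union>\<C> \<in> \<G>" if C: "\<C> \<noteq> {}" "subset.chain \<G> \<C>" for \<C>
  proof -
    have sub: "\<C> \<subseteq> \<G>" and total: "\<And>A B. A \<in> \<C> \<Longrightarrow> B \<in> \<C> \<Longrightarrow> A \<subseteq> B \<or> B \<subseteq> A"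
      using C(2) by (auto simp: subset.chain_def)
    have subsp: "subspace A" if "A \<in> \<C>" for A using sub that by (auto simp: \<G>_def)
    have "subspace (\<Union>\<C>)"
      unfolding subspace_def
    proof (intro conjI ballI allI)
      show "0 \<in> \<Union>\<C>" using C(1) subsp subspace_0 by blast
      fix u v assume "u \<in> \<Union>\<C>" "v \<in> \<Union>\<C>"
      then obtain A B where AB: "A \<in> \<C>" "u \<in> A" "B \<in> \<C>" "v \<in> B" by blast
      then consider "u \<in> B" | "v \<in> A" using total by blast
      then show "u + v \<in> \<Union>\<C>" using AB subsp subspace_add by cases blast+
    next
      fix c u assume "u \<in> \<Union>\<C>"
      then show "c *\<^sub>R u \<in> \<Union>\<C>" using subsp subspace_scale by blast
    qed
    then show ?thesis using C(1) sub unfolding \<G>_def by blast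
  qed
  obtain M where M: "M \<in> \<G>" and max: "\<And>G. G \<in> \<G> \<Longrightarrow> M \<subseteq> G \<Longrightarrow> G = M"
    using subset_Zorn_nonempty[OF ne chain] by blast
  have sM: "subspace M" and xM: "(x, norm x) \<in> M" and dom: "\<And>y r. (y, r) \<in> M \<Longrightarrow> r \<le> norm y"
    using M by (auto simp: \<G>_def)
  have total: "\<exists>r. (z, r) \<in> M" for z
  proof -
    define L where "L = {r - norm (y - z) | y r. (y, r) \<in> M}"
    have key: "r - norm (y - z) \<le> norm (y' + z) - r'" if "(y, r) \<in> M" "(y', r') \<in> M" for y r y' r'
    proof -
      have "(y + y', r + r') \<in> M" using subspace_add[OF sM that] by simp
      then have "r + r' \<le> norm (y + y')" by (rule dom)
      also have "\<dots> \<le> norm (y - z) + norm (y' + z)"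
        using norm_triangle_ineq[of "y - z" "y' + z"] by simp
      finally show ?thesis by simp
    qed
    have 0: "(0, 0) \<in> M" using subspace_0[OF sM] by (simp add: zero_prod_def)
    have ne: "L \<noteq> {}" unfolding L_def using 0 by blast
    have bdd: "bdd_above L" unfolding L_def using key[OF _ 0] by (intro bdd_aboveI[of _ "norm (0 + z) - 0"]) auto
    \<comment> \<open>By \<open>key\<close> there is room for a value \<open>c\<close> at \<open>z\<close> between all lower and upper constraints.\<close>
    define c where "c = Sup L"
    have lower: "r - norm (y - z) \<le> c" if "(y, r) \<in> M" for y r
      unfolding c_def using bdd that by (intro cSup_upper) (auto simp: L_def)
    have upper: "c \<le> norm (y + z) - r" if "(y, r) \<in> M" for y r
      unfolding c_def using ne key[OF _ that] by (intro cSup_least) (auto simp: L_def)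
    let ?N = "span (insert (z, c) M)"
    have "r \<le> norm y" if yr: "(y, r) \<in> ?N" for y r
    proof -
      obtain a where "(y, r) - a *\<^sub>R (z, c) \<in> M"
        using yr sM unfolding span_breakdown_eq by (auto simp: span_eq_iff[THEN iffD2])
      then have a: "(y - a *\<^sub>R z, r - a * c) \<in> M" by simp
      consider "a = 0" | "0 < a" | "a < 0" by linarith
      then show ?thesis
      proof cases
        case 1
        then show ?thesis using dom[OF a] by simp
      next
        case 2
        have "(1 / a) *\<^sub>R (y - a *\<^sub>R z, r - a * c) \<in> M" by (rule subspace_scale[OF sM a])
        then have "((1 / a) *\<^sub>R y - z, r / a - c) \<in> M"
          using 2 by (simp add: scaleR_diff_right right_diff_distrib)
        from upper[OF this] have "r / a \<le> norm ((1 / a) *\<^sub>R y)" by simp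
        then show ?thesis using 2 by (simp add: field_simps)
      next
        case 3
        have "(- 1 / a) *\<^sub>R (y - a *\<^sub>R z, r - a * c) \<in> M" by (rule subspace_scale[OF sM a])
        then have "((- 1 / a) *\<^sub>R y + z, - r / a + c) \<in> M"
          using 3 by (simp add: scaleR_diff_right right_diff_distrib)
        from lower[OF this] have "- r / a \<le> norm ((- 1 / a) *\<^sub>R y)" by simp
        then show ?thesis using 3 by (simp add: field_simps)
      qed
    qed
    then have "?N \<in> \<G>" unfolding \<G>_def using xM by (auto intro: span_base)
    moreover have "M \<subseteq> ?N" by (auto intro: span_base)
    ultimately have "?N = M" by (rule max)
    then show ?thesis using span_base[of "(z, c)" "insert (z, c) M"] by auto
  qed
  then obtain f where f: "(z, f z) \<in> M" for z by metis
  have unique: "r = f z" if "(z, r) \<in> M" for z r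
  proof -
    have "(0, r - f z) \<in> M" "(0, f z - r) \<in> M"
      using subspace_diff[OF sM that f[of z]] subspace_diff[OF sM f[of z] that] by simp_all
    then show ?thesis using dom[of 0 "r - f z"] dom[of 0 "f z - r"] by simp
  qed
  have "linear f"
  proof (rule linearI)
    fix u v c
    show "f (u + v) = f u + f v"
      using unique[of "u + v" "f u + f v"] subspace_add[OF sM f f, of u v] by simp
    show "f (c *\<^sub>R u) = c *\<^sub>R f u"
      using unique[of "c *\<^sub>R u" "c * f u"] subspace_scale[OF sM f, of c u] by simp
  qed
  moreover have "f x = norm x" using unique[OF xM] by simp
  ultimately show ?thesis using that[of f] dom[OF f] by blast
qed

lemma compact_combinations:
  fixes xs :: "'a::real_normed_vector list"
  shows "compact {comb a xs | a. \<forall>i<length xs. \<bar>a i\<bar> \<le> 1}"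
proof (induction xs)
  case (Cons x xs)
  let ?S = "{comb a xs | a. \<forall>i<length xs. \<bar>a i\<bar> \<le> 1}"
  have "compact ((\<lambda>c. c *\<^sub>R x) ` {-1..1::real})"
    by (intro compact_continuous_image continuous_intros) auto
  from compact_sums[OF this Cons.IH]
  have "compact {u + v | u v. u \<in> (\<lambda>c. c *\<^sub>R x) ` {-1..1::real} \<and> v \<in> ?S}" .
  moreover have "{u + v | u v. u \<in> (\<lambda>c. c *\<^sub>R x) ` {-1..1::real} \<and> v \<in> ?S} =
      {comb a (x # xs) | a. \<forall>i<length (x # xs). \<bar>a i\<bar> \<le> 1}" (is "?L = ?R")
  proof (intro equalityI subsetI)
    fix w assume "w \<in> ?L"
    then obtain c a where c: "-1 \<le> c" "c \<le> 1" and a: "\<forall>i<length xs. \<bar>a i\<bar> \<le> 1"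
      and w: "w = c *\<^sub>R x + comb a xs" by auto
    have "w = comb (case_nat c a) (x # xs)" by (simp add: comb_Cons w)
    moreover have "\<forall>i<length (x # xs). \<bar>case_nat c a i\<bar> \<le> 1"
      using a c by (auto split: nat.split)
    ultimately show "w \<in> ?R" by blast
  next
    fix w assume "w \<in> ?R"
    then obtain a where a: "\<forall>i<Suc (length xs). \<bar>a i\<bar> \<le> 1" and w: "w = a 0 *\<^sub>R x + comb (\<lambda>i. a (Suc i)) xs"
      by (auto simp: comb_Cons)
    have "a 0 \<in> {-1..1}" using a[rule_format, of 0] by auto
    moreover have "comb (\<lambda>i. a (Suc i)) xs \<in> ?S" using a by auto
    ultimately show "w \<in> ?L" unfolding w by blast
  qed
  ultimately show ?case by simp
qed simp

text \<open>
  A functional norming a nearby vector bounds \<open>\<parallel>x + y\<parallel>\<close> from below by almost \<open>\<parallel>x\<parallel>\<close>, for all \<open>y\<close> in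
  its kernel. By compactness finitely many functionals serve all normalized combinations \<open>x\<close> of \<open>t\<close>.
\<close>

lemma separating_functionals:
  fixes t :: "'a::banach list"
  assumes p: "1 \<le> p" and K: "1 \<le> K" and t: "t \<in> Tp p X K"
  shows "\<exists>F :: ('a \<Rightarrow> real) set. finite F \<and> (\<forall>f\<in>F. linear f) \<and>
    (\<forall>a y. (\<forall>f\<in>F. f y = 0) \<longrightarrow> norm (comb a t) \<le> 2 * norm (comb a t + y))"
proof -
  let ?n = "length t"
  define S where "S = {comb a t | a. \<forall>i<?n. \<bar>a i\<bar> \<le> 1}"
  \<comment> \<open>Normalized combinations have norm at least \<open>1 / K = 4 \<epsilon>\<close>, so losing \<open>2 \<epsilon>\<close> leaves one half.\<close>
  define \<epsilon> where "\<epsilon> = 1 / (4 * K)"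
  have \<epsilon>: "0 < \<epsilon>" using K by (simp add: \<epsilon>_def)
  have "compact S" unfolding S_def by (rule compact_combinations)
  then obtain k where k: "finite k" "S \<subseteq> (\<Union>x\<in>k. ball x \<epsilon>)"
    using \<epsilon> unfolding compact_eq_totally_bounded by blast
  obtain g :: "'a \<Rightarrow> 'a \<Rightarrow> real" where g: "linear (g x)" "g x y \<le> norm y" "g x x = norm x" for x y
    by (metis norming_functional)
  show ?thesis
  proof (intro exI[of _ "g ` k"] conjI ballI allI impI)
    show "finite (g ` k)" using k by simp
    show "linear f" if "f \<in> g ` k" for f using that g by auto
    fix a y assume y: "\<forall>f\<in>g ` k. f y = 0"
    define c where "c = lp_norm p ?n a"
    show "norm (comb a t) \<le> 2 * norm (comb a t + y)"
    proof (cases "c = 0")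
      case True
      then have "norm (comb a t) \<le> 0" using t unfolding Tp_iff[OF p K] c_def by metis
      then show ?thesis by simp
    next
      case False
      then have c: "0 < c" using lp_norm_nonneg[of p ?n a] by (simp add: c_def)
      define x where "x = (1 / c) *\<^sub>R comb a t"
      have x: "x = comb (\<lambda>i. 1 / c * a i) t" unfolding x_def comb_scale ..
      have "x \<in> S"
        unfolding S_def x using abs_le_lp_norm[OF p, of _ ?n a] c
        by (auto simp: abs_mult simp flip: c_def intro!: exI[of _ "\<lambda>i. 1 / c * a i"])
      then obtain x0 where x0: "x0 \<in> k" "norm (x0 - x) < \<epsilon>"
        using k(2) by (auto simp: dist_norm)
      have "c \<le> K * norm (comb a t)" using t unfolding Tp_iff[OF p K] c_def by blast
      then have nx: "4 * \<epsilon> \<le> norm x"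
        using c K by (simp add: x_def \<epsilon>_def field_simps)
      let ?f = "g x0"
      have "?f (x + (1 / c) *\<^sub>R y) = ?f x0 - ?f (x0 - x)"
        using y x0(1) by (simp add: linear_add[OF g(1)] linear_diff[OF g(1)] linear_scale[OF g(1)])
      moreover have "?f (x + (1 / c) *\<^sub>R y) \<le> norm (x + (1 / c) *\<^sub>R y)" by (rule g)
      moreover have "?f (x0 - x) \<le> norm (x0 - x)" "?f x0 = norm x0" by (rule g)+
      moreover have "norm x \<le> norm x0 + norm (x0 - x)"
        using norm_triangle_ineq4[of x0 "x0 - x"] by simp
      ultimately have "norm x \<le> 2 * norm (x + (1 / c) *\<^sub>R y)"
        using x0(2) nx by linarith
      also have "x + (1 / c) *\<^sub>R y = (1 / c) *\<^sub>R (comb a t + y)"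
        by (simp add: x_def scaleR_add_right)
      finally show ?thesis using c unfolding x_def norm_scaleR by (simp add: field_simps)
    qed
  qed
qed

text \<open>
  The constant \<open>12\<close> is \<open>4 (1 + C)\<close> for the separation constant \<open>C = 2\<close>.
\<close>

lemma derived_Tp_concat:
  fixes t :: "'a::banach list"
  assumes p: "1 \<le> p" and K: "1 \<le> K"
    and l: "\<And>F :: ('a \<Rightarrow> real) set. finite F \<Longrightarrow> (\<And>f. f \<in> F \<Longrightarrow> linear f) \<Longrightarrow>
      [] \<in> derived any (Tp p (\<Inter>f\<in>F. {x. f x = 0}) K) l"
    and t: "t \<in> derived any (Tp p UNIV K) \<xi>"
  shows "map ((*\<^sub>R) (1/2)) t \<in> derived any (Tp p UNIV (12 * K)) (l + \<xi>)"
  using t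
proof (rule derived_concat)
  fix t :: "'a list" assume t: "t \<in> Tp p UNIV K"
  obtain F :: "('a \<Rightarrow> real) set" where F: "finite F" "\<And>f. f \<in> F \<Longrightarrow> linear f"
    "\<And>a y. \<forall>f\<in>F. f y = 0 \<Longrightarrow> norm (comb a t) \<le> 2 * norm (comb a t + y)"
    using separating_functionals[OF p K t] by blast
  let ?S = "Tp p (\<Inter>f\<in>F. {x. f x = 0}) K"
  have "map ((*\<^sub>R) (1/2)) (t @ s) \<in> Tp p UNIV (12 * K)" if s: "s \<in> ?S" for s
  proof -
    have "norm (comb a t) \<le> 2 * norm (comb a t + comb b s)" for a b
    proof (rule F(3), rule ballI)
      fix f assume f: "f \<in> F"
      have "f v = 0" if "v \<in> set s" for v using s f that by (auto simp: Tp_def)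
      then show "f (comb b s) = 0" unfolding linear_comb[OF F(2)[OF f]] by simp
    qed
    then show ?thesis
      using glue_Tp[OF p K, of 2 t UNIV s] t s Tp_mono[of "\<Inter>f\<in>F. {x. f x = 0}" UNIV p K] by auto
  qed
  then show "\<exists>S. [] \<in> derived any S l \<and> (\<forall>s\<in>S. map ((*\<^sub>R) (1/2)) (t @ s) \<in> Tp p UNIV (12 * K))"
    using l[OF F(1,2)] by blast
qed simp

lemma kernel_unit_vector:
  fixes F :: "('a::real_normed_vector \<Rightarrow> real) set"
  assumes inf: "\<not> (\<exists>B :: 'a set. finite B \<and> span B = UNIV)"
    and F: "finite F" "\<And>f. f \<in> F \<Longrightarrow> linear f"
  obtains y where "norm y = 1" "\<And>f. f \<in> F \<Longrightarrow> f y = 0"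
proof -
  obtain B :: "'a set" where "B \<subseteq> UNIV" and B: "independent B" "UNIV \<subseteq> span B"
    by (rule maximal_independent_subset)
  then have "infinite B" using inf by blast
  then obtain A where A: "A \<subseteq> B" "finite A" "card A = Suc (card F)"
    using infinite_arbitrarily_large by blast
  obtain s where s: "set s = A" "distinct s" using finite_distinct_list[OF A(2)] by blast
  have len: "length s = Suc (card F)" using A s distinct_card by fastforce
  obtain e where e: "lp_norm 1 (length s) e = 1" "\<forall>f\<in>F. f (comb e s) = 0"
    using kernel_combination[of 1 F s "\<lambda>x f. f x"] F len by auto
  \<comment> \<open>The exponent \<open>1\<close> in the choice of \<open>e\<close> is arbitrary; what matters is that some coefficient is nonzero.\<close>
  have "comb e s \<noteq> 0"
  proof
    assume 0: "comb e s = 0"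
    define u where "u v = e (the_inv_into {..<length s} ((!) s) v)" for v
    have inj: "inj_on ((!) s) {..<length s}" using s(2) by (auto simp: inj_on_def nth_eq_iff_index_eq)
    have img: "((!) s) ` {..<length s} = A"
      unfolding s(1)[symmetric] by (auto simp: in_set_conv_nth)
    have u: "u (s ! i) = e i" if "i < length s" for i
      using that by (simp add: u_def the_inv_into_f_f[OF inj])
    have "(\<Sum>v\<in>A. u v *\<^sub>R v) = comb e s"
      unfolding img[symmetric] comb_def by (subst sum.reindex[OF inj]) (auto simp: u intro: sum.cong)
    then have "\<forall>v\<in>A. u v = 0"
      using 0 independent_mono[OF B(1) A(1)] A(2) unfolding dependent_finite[OF A(2)] by auto
    then have "e i = 0" if "i < length s" for i using u that img by fastforce
    then have "lp_norm 1 (length s) e = lp_norm 1 (length s) (\<lambda>_. 0)" by (intro lp_norm_cong) auto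
    then show False using e(1) lp_norm_zero[of 1] by simp
  qed
  then show ?thesis
    using that[of "(1 / norm (comb e s)) *\<^sub>R comb e s"] e(2) F(2) by (auto simp: linear_scale)
qed

lemma double_Tp:
  fixes l :: "'u ordinal"
  assumes "1 \<le> p" "1 \<le> K" "is_limit l" "[] \<in> derived any (Tp p (UNIV :: 'a::banach set) K) l"
  shows "[] \<in> derived any (Tp p (UNIV :: 'a set) (12 * K)) (l + l)"
  using derived_Tp_concat[OF assms(1,2) derived_Tp_kernel[OF assms(1,2) _ _ assms(3,4)] assms(4)]
  by simp

text \<open>
  Adding one vector at a time, each from the kernel of functionals separating it from the
  previous ones; finite ordinals are not covered by the doubling argument, which needs a limit.
\<close>

lemma finite_less_Tp:
  assumes inf: "\<not> (\<exists>B :: 'a::banach set. finite B \<and> span B = UNIV)" and p: "1 \<le> p"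
  shows "\<exists>K\<ge>1. [] \<in> derived any (Tp p (UNIV :: 'a set) K) ((osucc ^^ n) 0 :: 'u ordinal)"
proof (induction n)
  case 0
  then show ?case using Nil_in_Tp[OF p] by (auto simp: derived_def orec_zero intro: exI[of _ 1])
next
  case (Suc n)
  then obtain K where K: "1 \<le> K"
    "[] \<in> derived any (Tp p (UNIV :: 'a set) K) ((osucc ^^ n) 0 :: 'u ordinal)" by blast
  have "[] \<in> derived any (Tp p (\<Inter>f\<in>F. {x. f x = 0}) K) (1 :: 'u ordinal)"
    if F: "finite F" "\<And>f. f \<in> F \<Longrightarrow> linear f" for F :: "('a \<Rightarrow> real) set"
  proof (rule derived_oneI)
    obtain y :: 'a where "norm y = 1" "\<And>f. f \<in> F \<Longrightarrow> f y = 0"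
      using kernel_unit_vector[OF inf F] by blast
    then show "\<exists>y. True \<and> [] @ [y] \<in> Tp p (\<Inter>f\<in>F. {x. f x = 0}) K"
      using singleton_in_Tp[OF p K(1), of y "\<Inter>f\<in>F. {x. f x = 0}"] by auto
  qed (rule Nil_in_Tp[OF p])
  \<comment> \<open>Hanging trees of rank \<open>1\<close>, that is, single vectors, below all nodes gives \<open>1 + n\<close>.\<close>
  from derived_Tp_concat[OF p K(1) this K(2)]
  have "[] \<in> derived any (Tp p (UNIV :: 'a set) (12 * K)) ((osucc ^^ Suc n) 0 :: 'u ordinal)"
    unfolding one_add_finite by simp
  then show ?case using K(1) by (intro exI[of _ "12 * K"]) auto
qed

section \<open>Uniform boundedness of the partial sum projections\<close>

text \<open>
  Adding a vector \<open>b\<close> at distance \<open>d > 0\<close> from a closed subspace: the coefficient of \<open>b\<close> is then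
  bounded by \<open>1 / d\<close> times the norm, so it converges along convergent sequences.
\<close>

lemma closed_span_finite:
  fixes B :: "'a::real_normed_vector set"
  assumes "finite B"
  shows "closed (span B)"
  using assms
proof (induction B rule: finite_induct)
  case (insert b B)
  show ?case
  proof (cases "b \<in> span B")
    case True
    then show ?thesis using insert.IH by (simp add: span_redundant)
  next
    case False
    define d where "d = infdist b (span B)"
    have d: "0 < d"
      unfolding d_def using insert.IH False span_zero[of B] by (intro infdist_pos_not_in_closed) auto
    have far: "\<bar>a\<bar> * d \<le> norm (a *\<^sub>R b + v)" if v: "v \<in> span B" for a v
    proof (cases "a = 0")
      case False
      have "(- inverse a) *\<^sub>R v \<in> span B" using v by (rule span_scale)
      then have "d \<le> norm (b - (- inverse a) *\<^sub>R v)"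
        unfolding d_def dist_norm[symmetric] by (rule infdist_le)
      then have "\<bar>a\<bar> * d \<le> \<bar>a\<bar> * norm (b - (- inverse a) *\<^sub>R v)" by (rule mult_left_mono) simp
      also have "\<dots> = norm (a *\<^sub>R (b - (- inverse a) *\<^sub>R v))" by simp
      also have "a *\<^sub>R (b - (- inverse a) *\<^sub>R v) = a *\<^sub>R b + v"
        using False by (simp add: scaleR_add_right)
      finally show ?thesis .
    qed simp
    show ?thesis
      unfolding closed_sequential_limits
    proof (intro allI impI)
      fix w l assume "(\<forall>n. w n \<in> span (insert b B)) \<and> w \<longlonglongrightarrow> l"
      then have w: "\<And>n. w n \<in> span (insert b B)" and wl: "w \<longlonglongrightarrow> l" by auto
      obtain a where a: "\<And>n. w n - a n *\<^sub>R b \<in> span B"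
        using w unfolding span_breakdown_eq by metis
      have "Cauchy w" using wl by (rule LIMSEQ_imp_Cauchy)
      have "Cauchy a"
      proof (rule metric_CauchyI)
        fix e :: real assume "0 < e"
        then obtain M where M: "\<And>m n. m \<ge> M \<Longrightarrow> n \<ge> M \<Longrightarrow> dist (w m) (w n) < e * d"
          using metric_CauchyD[OF \<open>Cauchy w\<close>, of "e * d"] d by auto
        have "dist (a m) (a n) < e" if "m \<ge> M" "n \<ge> M" for m n
        proof -
          have "(w m - a m *\<^sub>R b) - (w n - a n *\<^sub>R b) \<in> span B" by (rule span_diff[OF a a])
          from far[OF this, of "a m - a n"] have "\<bar>a m - a n\<bar> * d \<le> norm (w m - w n)"
            by (simp add: algebra_simps)
          also have "\<dots> < e * d" using M[OF that] by (simp add: dist_norm)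
          finally show ?thesis using d by (simp add: dist_real_def)
        qed
        then show "\<exists>M. \<forall>m\<ge>M. \<forall>n\<ge>M. dist (a m) (a n) < e" by blast
      qed
      then obtain \<alpha> where "a \<longlonglongrightarrow> \<alpha>" using Cauchy_convergent convergent_def by blast
      then have "(\<lambda>n. w n - a n *\<^sub>R b) \<longlonglongrightarrow> l - \<alpha> *\<^sub>R b"
        by (intro tendsto_intros wl)
      then have "l - \<alpha> *\<^sub>R b \<in> span B"
        by (rule closed_sequentially[OF insert.IH a])
      then show "l \<in> span (insert b B)" unfolding span_breakdown_eq by blast
    qed
  qed
qed simp

definition partial_sum :: "(nat \<Rightarrow> 'a::banach set) \<Rightarrow> nat \<Rightarrow> 'a \<Rightarrow> 'a" where
  "partial_sum E N x = (\<Sum>n<N. fdd_proj E n x)"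

lemma fdd_subspace: "is_fdd X E \<Longrightarrow> subspace (E n)"
  by (metis is_fdd_def subspace_span)

lemma fdd_closed: "is_fdd X E \<Longrightarrow> closed (E n)"
  by (metis is_fdd_def closed_span_finite)

lemma fdd_expansion:
  assumes "is_fdd UNIV E"
  shows fdd_proj_mem: "fdd_proj E n x \<in> E n"
    and fdd_sums: "(\<lambda>n. fdd_proj E n x) sums x"
    and fdd_proj_unique: "(\<And>n. f n \<in> E n) \<Longrightarrow> f sums x \<Longrightarrow> fdd_proj E n x = f n"
proof -
  have ex1: "\<exists>!f. (\<forall>n. f n \<in> E n) \<and> f sums x" using assms by (simp add: is_fdd_def)
  have eq: "(\<lambda>n. fdd_proj E n x) = (THE f. (\<forall>n. f n \<in> E n) \<and> f sums x)"
    by (simp add: fdd_proj_def)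
  have *: "(\<forall>n. fdd_proj E n x \<in> E n) \<and> (\<lambda>n. fdd_proj E n x) sums x"
    using theI'[OF ex1] unfolding eq[symmetric] by simp
  then show "fdd_proj E n x \<in> E n" "(\<lambda>n. fdd_proj E n x) sums x" by auto
  assume "\<And>n. f n \<in> E n" "f sums x"
  then have "(\<lambda>n. fdd_proj E n x) = f" unfolding eq by (intro the1_equality[OF ex1]) blast
  then show "fdd_proj E n x = f n" by (rule fun_cong)
qed

lemma linear_fdd_proj:
  assumes "is_fdd UNIV E"
  shows "linear (fdd_proj E n)"
proof (rule linearI)
  note sub = fdd_subspace[OF assms] and ex = fdd_proj_mem[OF assms] fdd_sums[OF assms]
  fix x y c
  show "fdd_proj E n (x + y) = fdd_proj E n x + fdd_proj E n y"
    by (rule fdd_proj_unique[OF assms]) (intro subspace_add[OF sub] sums_add ex)+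
  show "fdd_proj E n (c *\<^sub>R x) = c *\<^sub>R fdd_proj E n x"
    by (rule fdd_proj_unique[OF assms]) (intro subspace_scale[OF sub] sums_scaleR_right ex)+
qed

lemma linear_partial_sum: "is_fdd UNIV E \<Longrightarrow> linear (partial_sum E N)"
  unfolding partial_sum_def by (intro linear_compose_sum ballI linear_fdd_proj)

lemma partial_sum_tendsto: "is_fdd UNIV E \<Longrightarrow> (\<lambda>N. partial_sum E N x) \<longlonglongrightarrow> x"
  using fdd_sums[of E x] by (simp add: sums_def partial_sum_def)

lemma fdd_proj_eq_partial_sum_diff: "fdd_proj E n x = partial_sum E (Suc n) x - partial_sum E n x"
  by (simp add: partial_sum_def)

text \<open>
  The partial sum projections are closed, jointly: if they are uniformly Cauchy along \<open>z\<close>, their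
  limits are the partial sums of an expansion of \<open>x\<close>, and expansions are unique. The summands of the
  limit lie in the right subspaces because these are closed.
\<close>

lemma partial_sum_limit:
  assumes E: "is_fdd UNIV E" and z: "z \<longlonglongrightarrow> x" and \<delta>: "\<delta> \<longlonglongrightarrow> 0"
    and cauchy: "\<And>N n k. k \<le> n \<Longrightarrow> norm (partial_sum E N (z n - z k)) \<le> \<delta> k"
  shows "norm (partial_sum E N x - partial_sum E N (z k)) \<le> \<delta> k"
proof -
  let ?S = "partial_sum E"
  have diff: "?S N (u - v) = ?S N u - ?S N v" for N u v
    by (rule linear_diff[OF linear_partial_sum[OF E]])
  have "convergent (\<lambda>n. ?S N (z n))" for N
  proof (rule Cauchy_convergent, rule metric_CauchyI)
    fix e :: real assume "0 < e"
    then obtain k where k: "\<delta> k < e / 2"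
      using \<delta> order_tendstoD(2)[of \<delta> 0 sequentially "e / 2"] eventually_sequentially by force
    have "dist (?S N (z m)) (?S N (z n)) < e" if "m \<ge> k" "n \<ge> k" for m n
    proof -
      have "dist (?S N (z m)) (?S N (z k)) < e / 2" "dist (?S N (z n)) (?S N (z k)) < e / 2"
        using cauchy[OF that(1), of N] cauchy[OF that(2), of N] k unfolding diff dist_norm by linarith+
      then show ?thesis by (rule dist_triangle_half_l)
    qed
    then show "\<exists>M. \<forall>m\<ge>M. \<forall>n\<ge>M. dist (?S N (z m)) (?S N (z n)) < e" by blast
  qed
  then obtain L where L: "(\<lambda>n. ?S N (z n)) \<longlonglongrightarrow> L N" for N
    unfolding convergent_def by metis
  have close: "norm (L N - ?S N (z k)) \<le> \<delta> k" for N k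
  proof (rule tendsto_upperbound)
    show "(\<lambda>n. norm (?S N (z n) - ?S N (z k))) \<longlonglongrightarrow> norm (L N - ?S N (z k))"
      by (intro tendsto_intros L)
    show "\<forall>\<^sub>F n in sequentially. norm (?S N (z n) - ?S N (z k)) \<le> \<delta> k"
      using cauchy[of k _ N] unfolding diff by (intro eventually_sequentiallyI[of k])
  qed simp
  have "L \<longlonglongrightarrow> x"
  proof (rule metric_LIMSEQ_I)
    fix e :: real assume e: "0 < e"
    have "\<forall>\<^sub>F k in sequentially. \<delta> k < e / 3 \<and> dist (z k) x < e / 3"
      using order_tendstoD(2)[OF \<delta>, of "e / 3"] tendstoD[OF z, of "e / 3"] e
      by (intro eventually_conj) auto
    then obtain k where k: "\<delta> k < e / 3" "dist (z k) x < e / 3"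
      unfolding eventually_sequentially by blast
    obtain N0 where N0: "\<And>N. N \<ge> N0 \<Longrightarrow> dist (?S N (z k)) (z k) < e / 3"
      using metric_LIMSEQ_D[OF partial_sum_tendsto[OF E, of "z k"], of "e / 3"] e by auto
    have "dist (L N) x < e" if "N \<ge> N0" for N
    proof -
      have "dist (L N) x \<le> dist (L N) (?S N (z k)) + dist (?S N (z k)) (z k) + dist (z k) x"
        using dist_triangle[of "L N" x "?S N (z k)"] dist_triangle[of "?S N (z k)" x "z k"] by linarith
      then show ?thesis using close[of N k] k N0[OF that] by (simp add: dist_norm)
    qed
    then show "\<exists>no. \<forall>n\<ge>no. dist (L n) x < e" by blast
  qed
  define f where "f n = L (Suc n) - L n" for n
  have L0: "L 0 = 0" using L[of 0] by (simp add: partial_sum_def LIMSEQ_const_iff)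
  have sum_f: "(\<Sum>n<N. f n) = L N" for N
    by (induction N) (auto simp: f_def L0)
  have "f n \<in> E n" for n
  proof -
    have "(\<lambda>i. fdd_proj E n (z i)) \<longlonglongrightarrow> f n"
      unfolding fdd_proj_eq_partial_sum_diff f_def by (intro tendsto_intros L)
    then show ?thesis by (rule closed_sequentially[OF fdd_closed[OF E] fdd_proj_mem[OF E]])
  qed
  moreover have "f sums x" using \<open>L \<longlonglongrightarrow> x\<close> by (simp add: sums_def sum_f)
  ultimately have "fdd_proj E n x = f n" for n by (rule fdd_proj_unique[OF E])
  then have "?S N x = L N" by (simp add: partial_sum_def sum_f)
  then show ?thesis using close by simp
qed

text \<open>
  The first half of the open mapping argument. By Baire's theorem the closure of some set of vectors
  with partial sums bounded by \<open>k\<close> has an interior point. Symmetry and convexity move it to the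
  origin, and homogeneity spreads the estimate to all vectors.
\<close>

lemma partial_sum_approximation:
  assumes E: "is_fdd UNIV E"
  obtains M where "0 \<le> M"
    "\<And>y \<eta>. 0 < \<eta> \<Longrightarrow> \<exists>a. norm (y - a) < \<eta> \<and> (\<forall>N. norm (partial_sum E N a) \<le> M * norm y)"
proof -
  let ?S = "partial_sum E"
  note lin = linear_partial_sum[OF E]
  define A where "A k = {x. \<forall>N. norm (?S N x) \<le> real k}" for k
  have "\<exists>k. x \<in> A k" for x
  proof -
    have "Bseq (\<lambda>N. ?S N x)"
      by (rule convergent_imp_Bseq[OF convergentI[OF partial_sum_tendsto[OF E]]])
    then obtain K where K: "\<forall>N. norm (?S N x) \<le> K" unfolding Bseq_def by blast
    obtain k where "K \<le> real k" using real_arch_simple[of K] by blast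
    then have "norm (?S N x) \<le> real k" for N using K[rule_format, of N] by linarith
    then show ?thesis unfolding A_def by blast
  qed
  then have "x \<in> \<Union> (range (\<lambda>k. closure (A k)))" for x
    using subsetD[OF closure_subset, of x "A _"] by (simp add: Bex_def) metis
  then have cover: "\<Union> (range (\<lambda>k. closure (A k))) = UNIV" by (intro equalityI subsetI UNIV_I)
  have "\<exists>k. interior (closure (A k)) \<noteq> {}"
  proof (rule ccontr)
    assume "\<not> ?thesis"
    then have "euclidean interior_of \<Union> (range (\<lambda>k. closure (A k))) = {}"
      by (intro Baire_category_alt disjI1 completely_metrizable_space_euclidean) auto
    then show False unfolding cover by simp
  qed
  then obtain k c where "c \<in> interior (closure (A k))" by blast
  then obtain \<epsilon> where \<epsilon>: "0 < \<epsilon>" "ball c \<epsilon> \<subseteq> closure (A k)"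
    unfolding mem_interior by blast
  have near0: "\<exists>a\<in>A k. norm (y - a) < \<eta>" if y: "norm y < \<epsilon>" and \<eta>: "0 < \<eta>" for y \<eta>
  proof -
    have "c + y \<in> closure (A k)" "c - y \<in> closure (A k)"
      using \<epsilon> y by (auto simp: dist_norm intro!: subsetD[OF \<epsilon>(2)])
    then obtain u v where u: "u \<in> A k" "dist u (c + y) < \<eta>" and v: "v \<in> A k" "dist v (c - y) < \<eta>"
      using \<eta> unfolding closure_approachable by meson
    \<comment> \<open>\<open>y\<close> is half the difference of \<open>c + y\<close> and \<open>c - y\<close>.\<close>
    define a where "a = (1/2) *\<^sub>R (u - v)"
    have "norm (?S N a) \<le> real k" for N
    proof -
      have "?S N a = (1/2) *\<^sub>R (?S N u - ?S N v)"
        unfolding a_def by (simp add: linear_scale[OF lin] linear_diff[OF lin])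
      moreover have "norm (?S N u) \<le> real k" "norm (?S N v) \<le> real k"
        using u(1) v(1) by (auto simp: A_def)
      ultimately show ?thesis using norm_triangle_ineq4[of "?S N u" "?S N v"] by simp
    qed
    moreover have "norm (y - a) < \<eta>"
    proof -
      have "y - a = (1/2) *\<^sub>R ((c + y - u) - (c - y - v))"
        unfolding a_def by (simp add: algebra_simps flip: scaleR_add_left)
      then have "norm (y - a) \<le> (norm (c + y - u) + norm (c - y - v)) / 2"
        using norm_triangle_ineq4[of "c + y - u" "c - y - v"] by simp
      then show ?thesis using u(2) v(2) by (simp add: dist_norm norm_minus_commute)
    qed
    ultimately show ?thesis unfolding A_def by blast
  qed
  define M where "M = 2 * real k / \<epsilon>"
  have "\<exists>a. norm (y - a) < \<eta> \<and> (\<forall>N. norm (?S N a) \<le> M * norm y)" if \<eta>: "0 < \<eta>" for y \<eta>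
  proof (cases "y = 0")
    case True
    then show ?thesis using \<eta> linear_0[OF lin] by (intro exI[of _ 0]) simp
  next
    case False
    define \<rho> where "\<rho> = \<epsilon> / (2 * norm y)"
    have \<rho>: "0 < \<rho>" using False \<epsilon>(1) by (simp add: \<rho>_def)
    have "norm (\<rho> *\<^sub>R y) < \<epsilon>" using False \<epsilon>(1) by (simp add: \<rho>_def)
    from near0[OF this, of "\<rho> * \<eta>"] obtain a where a: "a \<in> A k" "norm (\<rho> *\<^sub>R y - a) < \<rho> * \<eta>"
      using \<rho> \<eta> by auto
    have "norm (y - (1 / \<rho>) *\<^sub>R a) = norm ((1 / \<rho>) *\<^sub>R (\<rho> *\<^sub>R y - a))"
      using \<rho> by (simp add: scaleR_diff_right)
    also have "\<dots> = norm (\<rho> *\<^sub>R y - a) / \<rho>" using \<rho> by simp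
    also have "\<dots> < \<eta>" using a(2) \<rho> by (simp add: field_simps)
    finally have "norm (y - (1 / \<rho>) *\<^sub>R a) < \<eta>" .
    moreover have "norm (?S N ((1 / \<rho>) *\<^sub>R a)) \<le> M * norm y" for N
    proof -
      have "norm (?S N ((1 / \<rho>) *\<^sub>R a)) = norm (?S N a) / \<rho>"
        using \<rho> by (simp add: linear_scale[OF lin])
      also have "\<dots> \<le> real k / \<rho>" using a(1) \<rho> by (intro divide_right_mono) (auto simp: A_def)
      also have "\<dots> = M * norm y" by (simp add: \<rho>_def M_def)
      finally show ?thesis .
    qed
    ultimately show ?thesis by blast
  qed
  moreover have "0 \<le> M" using \<epsilon>(1) by (simp add: M_def)
  ultimately show ?thesis using that by blast
qed

text \<open>
  The second half of the open mapping argument: approximating the remaining error again and again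
  reaches \<open>x\<close> itself, and as the errors are halved each time, the bounds for the partial sums of the
  corrections add up to a multiple of \<open>\<parallel>x\<parallel>\<close>.
\<close>

theorem fdd_constant:
  assumes E: "is_fdd UNIV E"
  shows "\<exists>C\<ge>1. \<forall>N x. norm (partial_sum E N x) \<le> C * norm x"
proof -
  let ?S = "partial_sum E"
  note lin = linear_partial_sum[OF E]
  obtain M where M: "0 \<le> M"
    "\<And>y \<eta>. 0 < \<eta> \<Longrightarrow> \<exists>a. norm (y - a) < \<eta> \<and> (\<forall>N. norm (?S N a) \<le> M * norm y)"
    using partial_sum_approximation[OF E] by blast
  have "\<forall>y \<eta>. \<exists>a. 0 < \<eta> \<longrightarrow> norm (y - a) < \<eta> \<and> (\<forall>N. norm (?S N a) \<le> M * norm y)"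
    using M(2) by blast
  then obtain g where g: "\<And>y \<eta>. 0 < \<eta> \<Longrightarrow> norm (y - g y \<eta>) < \<eta>"
    "\<And>y \<eta> N. 0 < \<eta> \<Longrightarrow> norm (?S N (g y \<eta>)) \<le> M * norm y" by metis
  have bound: "norm (?S N x) \<le> 2 * M * norm x" for N x
  proof (cases "x = 0")
    case True
    then show ?thesis using linear_0[OF lin] by simp
  next
    case False
    define r where "r = norm x"
    have r: "0 < r" using False by (simp add: r_def)
    \<comment> \<open>\<open>z n\<close> approximates \<open>x\<close> with error \<open>r / 2\<^sup>n\<close>; the next correction is the approximation \<open>g\<close> of
      that error.\<close>
    define z where "z = rec_nat 0 (\<lambda>n w. w + g (x - w) (r * (1/2) ^ Suc n))"
    have z0: "z 0 = 0" and zS: "z (Suc n) = z n + g (x - z n) (r * (1/2) ^ Suc n)" for n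
      by (simp_all add: z_def)
    have close: "norm (x - z n) \<le> r * (1/2) ^ n" for n
    proof (cases n)
      case 0
      then show ?thesis by (simp add: z0 r_def)
    next
      case (Suc m)
      have "norm ((x - z m) - g (x - z m) (r * (1/2) ^ Suc m)) < r * (1/2) ^ Suc m"
        using r by (intro g) simp
      then show ?thesis unfolding Suc zS by (simp add: algebra_simps)
    qed
    have step: "norm (?S N (z (Suc n) - z n)) \<le> M * (r * (1/2) ^ n)" for N n
    proof -
      have "norm (?S N (g (x - z n) (r * (1/2) ^ Suc n))) \<le> M * norm (x - z n)"
        using r by (intro g) simp
      also have "\<dots> \<le> M * (r * (1/2) ^ n)" using close M(1) by (rule mult_left_mono)
      finally show ?thesis by (simp add: zS)
    qed
    define \<delta> where "\<delta> k = 2 * M * r * (1/2) ^ k" for k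
    have "norm (?S N (z (k + j) - z k)) \<le> \<delta> k - \<delta> (k + j)" for N k j
    proof (induction j)
      case 0
      then show ?case using linear_0[OF lin] by simp
    next
      case (Suc j)
      have "?S N (z (k + Suc j) - z k) = ?S N (z (Suc (k + j)) - z (k + j)) + ?S N (z (k + j) - z k)"
        by (simp flip: linear_add[OF lin])
      then have "norm (?S N (z (k + Suc j) - z k)) \<le> M * (r * (1/2) ^ (k + j)) + (\<delta> k - \<delta> (k + j))"
        using norm_triangle_le add_mono[OF step Suc.IH] by metis
      then show ?case by (simp add: \<delta>_def)
    qed
    moreover have "0 \<le> \<delta> k" for k using M(1) r by (simp add: \<delta>_def)
    ultimately have cauchy: "norm (?S N (z n - z k)) \<le> \<delta> k" if "k \<le> n" for N n k
      using that by (metis le_iff_add diff_ge_0_iff_ge order_trans diff_left_mono diff_zero)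
    have half: "(\<lambda>n. c * (1/2) ^ n) \<longlonglongrightarrow> 0" for c :: real
      by (intro tendsto_mult_right_zero LIMSEQ_power_zero) simp
    have "(\<lambda>n. x - z n) \<longlonglongrightarrow> 0"
      by (rule Lim_null_comparison[OF _ half[of r]]) (use close in simp)
    then have "z \<longlonglongrightarrow> x" by (rule Lim_transform2[OF tendsto_const])
    from partial_sum_limit[OF E this _ cauchy, of N 0] half
    have "norm (?S N x - ?S N (z 0)) \<le> \<delta> 0" by (simp add: \<delta>_def)
    then show ?thesis using linear_0[OF lin] by (simp add: z0 \<delta>_def r_def)
  qed
  show ?thesis
  proof (intro exI[of _ "max 1 (2 * M)"] conjI allI)
    show "norm (?S N x) \<le> max 1 (2 * M) * norm x" for N x
      using bound[of N x] mult_right_mono[of "2 * M" "max 1 (2 * M)" "norm x"] by simp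
  qed simp
qed

section \<open>Supports and tails\<close>

definition fdd_tail :: "(nat \<Rightarrow> 'a::banach set) \<Rightarrow> nat \<Rightarrow> 'a set" where
  "fdd_tail E m = {x. \<forall>n<m. fdd_proj E n x = 0}"

text \<open>
  On finitely supported nonzero vectors this is the condition on consecutive members of block
  sequences. It is transitive there, so it can be imposed on all pairs.
\<close>

definition before :: "(nat \<Rightarrow> 'a::banach set) \<Rightarrow> 'a \<Rightarrow> 'a \<Rightarrow> bool" where
  "before E x y \<longleftrightarrow> (\<forall>i\<in>fdd_supp E x. \<forall>j\<in>fdd_supp E y. i < j)"

text \<open>
  The restriction on extensions in the derivation adapted to \<open>E\<close>.
\<close>

abbreviation (input) far :: "(nat \<Rightarrow> 'a::banach set) \<Rightarrow> nat \<Rightarrow> 'a \<Rightarrow> bool" where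
  "far E \<equiv> \<lambda>i y. i \<le> Inf (fdd_supp E y)"

lemma mem_fdd_tail_iff: "x \<in> fdd_tail E m \<longleftrightarrow> (\<forall>n\<in>fdd_supp E x. m \<le> n)"
  by (force simp: fdd_tail_def fdd_supp_def not_less[symmetric])

lemma fdd_supp_nonempty:
  assumes "is_fdd UNIV E" "x \<noteq> 0"
  shows "fdd_supp E x \<noteq> {}"
proof
  assume "fdd_supp E x = {}"
  then have "(\<lambda>n. fdd_proj E n x) = (\<lambda>n. 0)" by (auto simp: fdd_supp_def)
  then show False using fdd_sums[OF assms(1), of x] assms(2) sums_unique2[OF sums_zero] by metis
qed

lemma fdd_supp_scale: "is_fdd UNIV E \<Longrightarrow> c \<noteq> 0 \<Longrightarrow> fdd_supp E (c *\<^sub>R x) = fdd_supp E x"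
  by (simp add: fdd_supp_def linear_scale[OF linear_fdd_proj])

lemma fdd_proj_component:
  assumes "is_fdd UNIV E" "x \<in> E n"
  shows "fdd_proj E k x = (if k = n then x else 0)"
  by (rule fdd_proj_unique[OF assms(1)])
    (use assms(2) subspace_0[OF fdd_subspace[OF assms(1)]] sums_single[of n "\<lambda>_. x"] in auto)

lemma fdd_proj_sum:
  assumes "is_fdd UNIV E" "finite A"
  shows "fdd_proj E k (\<Sum>n\<in>A. fdd_proj E n x) = (if k \<in> A then fdd_proj E k x else 0)"
  using assms(2)
  by (simp add: linear_sum[OF linear_fdd_proj[OF assms(1)]]
      fdd_proj_component[OF assms(1) fdd_proj_mem[OF assms(1)]] sum.delta)

text \<open>
  A tail is closed because the coordinate projections are bounded.
\<close>

lemma closure_span_tail: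
  assumes E: "is_fdd UNIV E"
  shows "closure (span (\<Union>n\<in>{m..}. E n)) = fdd_tail E m"
proof (rule antisym)
  obtain C where C: "\<And>N x. norm (partial_sum E N x) \<le> C * norm x"
    using fdd_constant[OF E] by blast
  have "bounded_linear (fdd_proj E n)" for n
  proof (rule bounded_linear_intro[where K = "2 * C"])
    fix x y c
    show "fdd_proj E n (x + y) = fdd_proj E n x + fdd_proj E n y"
      by (rule linear_add[OF linear_fdd_proj[OF E]])
    show "fdd_proj E n (c *\<^sub>R x) = c *\<^sub>R fdd_proj E n x"
      by (rule linear_scale[OF linear_fdd_proj[OF E]])
    show "norm (fdd_proj E n x) \<le> norm x * (2 * C)"
      unfolding fdd_proj_eq_partial_sum_diff
      using norm_triangle_ineq4[of "partial_sum E (Suc n) x" "partial_sum E n x"] C[of "Suc n" x] C[of n x]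
      by (simp add: mult_ac)
  qed
  then have cont: "continuous_on UNIV (fdd_proj E n)" for n
    by (rule linear_continuous_on)
  have "fdd_tail E m = (\<Inter>n\<in>{..<m}. {x. fdd_proj E n x = 0})" by (auto simp: fdd_tail_def)
  also have "closed \<dots>"
    by (intro closed_INT ballI closed_Collect_eq cont continuous_on_const)
  finally have closed: "closed (fdd_tail E m)" .
  have sub: "subspace (fdd_tail E m)"
    by (auto simp: fdd_tail_def subspace_def linear_0[OF linear_fdd_proj[OF E]]
        linear_add[OF linear_fdd_proj[OF E]] linear_scale[OF linear_fdd_proj[OF E]])
  have "(\<Union>n\<in>{m..}. E n) \<subseteq> fdd_tail E m"
    by (auto simp: fdd_tail_def fdd_proj_component[OF E])
  then show "closure (span (\<Union>n\<in>{m..}. E n)) \<subseteq> fdd_tail E m"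
    by (intro closure_minimal span_minimal closed sub)
next
  show "fdd_tail E m \<subseteq> closure (span (\<Union>n\<in>{m..}. E n))"
  proof
    fix x assume x: "x \<in> fdd_tail E m"
    have "partial_sum E N x \<in> span (\<Union>n\<in>{m..}. E n)" for N
      unfolding partial_sum_def
    proof (rule span_sum)
      fix n
      show "fdd_proj E n x \<in> span (\<Union>n\<in>{m..}. E n)"
      proof (cases "n < m")
        case True
        then show ?thesis using x by (simp add: fdd_tail_def span_zero)
      next
        case False
        then show ?thesis using fdd_proj_mem[OF E, of n x] by (intro span_base) auto
      qed
    qed
    then show "x \<in> closure (span (\<Union>n\<in>{m..}. E n))"
      unfolding closure_sequential using partial_sum_tendsto[OF E, of x]
      by (intro exI[of _ "\<lambda>N. partial_sum E N x"]) simp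
  qed
qed

lemma fdd_proj_shift:
  assumes E: "is_fdd UNIV E" and x: "x \<in> fdd_tail E m"
  shows "fdd_proj (\<lambda>n. E (m + n)) n x = fdd_proj E (m + n) x"
proof -
  have "(\<lambda>n. fdd_proj E (n + m) x) sums (x - (\<Sum>n<m. fdd_proj E n x))"
    using fdd_sums[OF E, of x] by (rule sums_split_initial_segment)
  moreover have "(\<Sum>n<m. fdd_proj E n x) = 0" using x by (simp add: fdd_tail_def)
  ultimately have sums: "(\<lambda>n. fdd_proj E (m + n) x) sums x" by (simp add: add.commute)
  have "(THE f. (\<forall>n. f n \<in> E (m + n)) \<and> f sums x) = (\<lambda>n. fdd_proj E (m + n) x)"
  proof (rule the_equality)
    show "(\<forall>n. fdd_proj E (m + n) x \<in> E (m + n)) \<and> (\<lambda>n. fdd_proj E (m + n) x) sums x"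
      using sums fdd_proj_mem[OF E] by blast
    fix f assume f: "(\<forall>n. f n \<in> E (m + n)) \<and> f sums x"
    \<comment> \<open>An expansion along the shifted decomposition is one along \<open>E\<close>, padded with zeros.\<close>
    define f' where "f' n = (if n < m then 0 else f (n - m))" for n
    have "f' n \<in> E n" for n
    proof (cases "n < m")
      case True
      then show ?thesis using subspace_0[OF fdd_subspace[OF E]] by (simp add: f'_def)
    next
      case False
      then show ?thesis using f[THEN conjunct1, rule_format, of "n - m"] by (simp add: f'_def)
    qed
    moreover have "f' sums x"
    proof -
      have "(\<lambda>n. f' (n + m)) sums (x - (\<Sum>n<m. f' n))" using f by (simp add: f'_def)
      then show ?thesis by (simp only: sums_iff_shift) (simp add: f'_def)
    qed
    ultimately have "fdd_proj E (m + n) x = f' (m + n)" for n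
      by (intro fdd_proj_unique[OF E])
    then show "f = (\<lambda>n. fdd_proj E (m + n) x)" by (simp add: f'_def)
  qed
  then show ?thesis by (simp add: fdd_proj_def)
qed

lemma fdd_supp_shift:
  assumes "is_fdd UNIV E" and "x \<in> fdd_tail E m"
  shows "fdd_supp E x = (\<lambda>n. m + n) ` fdd_supp (\<lambda>n. E (m + n)) x"
proof (intro equalityI subsetI)
  fix n assume n: "n \<in> fdd_supp E x"
  then have "m \<le> n" using assms(2) by (simp add: mem_fdd_tail_iff)
  then obtain k where "n = m + k" using le_Suc_ex by blast
  then show "n \<in> (\<lambda>n. m + n) ` fdd_supp (\<lambda>n. E (m + n)) x"
    using n by (auto simp: fdd_supp_def fdd_proj_shift[OF assms])
qed (auto simp: fdd_supp_def fdd_proj_shift[OF assms])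

section \<open>Trees of block sequences\<close>

lemma block_seqs_iff:
  assumes ne: "\<And>x. x \<in> X \<Longrightarrow> x \<noteq> 0 \<Longrightarrow> fdd_supp E x \<noteq> {}"
  shows "xs \<in> block_seqs X E \<longleftrightarrow>
    (\<forall>x\<in>set xs. x \<in> X \<and> x \<noteq> 0 \<and> finite (fdd_supp E x)) \<and> sorted_wrt (before E) xs"
proof (cases "\<forall>x\<in>set xs. x \<in> X \<and> x \<noteq> 0 \<and> finite (fdd_supp E x)")
  case True
  define G where "G x \<longleftrightarrow> fdd_supp E x \<noteq> {} \<and> finite (fdd_supp E x)" for x
  \<comment> \<open>\<open>before\<close> is transitive only past vectors with nonempty support.\<close>
  define R where "R x y \<longleftrightarrow> G x \<and> G y \<and> before E x y" for x y
  have G: "G x" if "x \<in> set xs" for x using True ne that by (auto simp: G_def)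
  have before: "before E x y \<longleftrightarrow> Max (fdd_supp E x) < Min (fdd_supp E y)" if "G x" "G y" for x y
    using that unfolding before_def G_def by (auto simp: Max_less_iff Min_gr_iff)
  have "transp R"
  proof (rule transpI)
    fix x y z assume "R x y" "R y z"
    then show "R x z" unfolding R_def before_def G_def by (meson all_not_in_conv less_trans)
  qed
  then have "sorted_wrt R xs \<longleftrightarrow> (\<forall>i. Suc i < length xs \<longrightarrow> R (xs ! i) (xs ! Suc i))"
    by (rule sorted_wrt_iff_nth_Suc_transp)
  also have "\<dots> \<longleftrightarrow> (\<forall>i. Suc i < length xs \<longrightarrow>
      Max (fdd_supp E (xs ! i)) < Min (fdd_supp E (xs ! Suc i)))"
    using G before by (simp add: R_def Suc_lessD)
  finally have "sorted_wrt R xs \<longleftrightarrow> xs \<in> block_seqs X E"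
    using True by (simp add: block_seqs_def)
  moreover have "sorted_wrt R xs \<longleftrightarrow> sorted_wrt (before E) xs"
    using G by (auto simp: R_def intro: sorted_wrt_mono_rel[rotated])
  ultimately show ?thesis using True by blast
qed (auto simp: block_seqs_def)

lemma TpE_iff:
  assumes "is_fdd UNIV E"
  shows "xs \<in> TpE p UNIV E K \<longleftrightarrow>
    xs \<in> Tp p UNIV K \<and> (\<forall>x\<in>set xs. x \<noteq> 0 \<and> finite (fdd_supp E x)) \<and> sorted_wrt (before E) xs"
  using block_seqs_iff[of UNIV E xs] fdd_supp_nonempty[OF assms] by (auto simp: TpE_def)

text \<open>
  Re-indexing the decomposition shifts all supports by \<open>m\<close> and so does not affect their order.
\<close>

lemma TpE_tail_eq:
  assumes E: "is_fdd UNIV E"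
  shows "TpE p (fdd_tail E m) (\<lambda>n. E (m + n)) K = {xs \<in> TpE p UNIV E K. set xs \<subseteq> fdd_tail E m}"
proof -
  let ?F = "\<lambda>n. E (m + n)"
  note shift = fdd_supp_shift[OF E]
  have ne: "fdd_supp ?F x \<noteq> {}" if "x \<in> fdd_tail E m" "x \<noteq> 0" for x
    using fdd_supp_nonempty[OF E that(2)] shift[OF that(1)] by auto
  have fin: "finite (fdd_supp ?F x) \<longleftrightarrow> finite (fdd_supp E x)" if "x \<in> fdd_tail E m" for x
    unfolding shift[OF that] by (rule finite_image_iff[symmetric]) simp
  have before: "before ?F x y \<longleftrightarrow> before E x y" if "x \<in> fdd_tail E m" "y \<in> fdd_tail E m" for x y
    unfolding before_def shift[OF that(1)] shift[OF that(2)] by simp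
  have sorted: "sorted_wrt (before ?F) xs \<longleftrightarrow> sorted_wrt (before E) xs" if "set xs \<subseteq> fdd_tail E m" for xs
    using that by (induction xs) (auto simp: before subset_iff)
  have Tp: "xs \<in> Tp p (fdd_tail E m) K \<longleftrightarrow> xs \<in> Tp p UNIV K \<and> set xs \<subseteq> fdd_tail E m" for xs
    by (auto simp: Tp_def)
  show ?thesis
  proof (rule set_eqI)
    fix xs
    have "xs \<in> TpE p (fdd_tail E m) ?F K \<longleftrightarrow> xs \<in> Tp p UNIV K \<and> set xs \<subseteq> fdd_tail E m \<and>
        (\<forall>x\<in>set xs. x \<noteq> 0 \<and> finite (fdd_supp ?F x)) \<and> sorted_wrt (before ?F) xs"
      using block_seqs_iff[of "fdd_tail E m" ?F xs, OF ne] unfolding TpE_def Int_iff Tp by auto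
    also have "\<dots> \<longleftrightarrow> xs \<in> TpE p UNIV E K \<and> set xs \<subseteq> fdd_tail E m"
      unfolding TpE_iff[OF E] using sorted[of xs] fin by (auto simp: subset_iff)
    finally show "xs \<in> TpE p (fdd_tail E m) ?F K \<longleftrightarrow>
        xs \<in> {xs \<in> TpE p UNIV E K. set xs \<subseteq> fdd_tail E m}" by simp
  qed
qed

lemma hereditary_TpE:
  assumes "is_fdd UNIV E" "1 \<le> p" "1 \<le> K"
  shows "hereditary (TpE p UNIV E K)"
  unfolding hereditary_def
proof (intro ballI allI impI)
  fix t s assume t: "t \<in> TpE p UNIV E K" and s: "subseq s t"
  have "s \<in> Tp p UNIV K"
    using hereditary_Tp[OF assms(2,3), of UNIV] t s unfolding hereditary_def TpE_def by blast
  then show "s \<in> TpE p UNIV E K"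
    using t subseq_set_mono[OF s] sorted_wrt_subseq[OF s] unfolding TpE_iff[OF assms(1)] by blast
qed

lemma Nil_in_TpE: "is_fdd UNIV E \<Longrightarrow> 1 \<le> p \<Longrightarrow> [] \<in> TpE p UNIV E K"
  by (simp add: TpE_iff Nil_in_Tp)

lemma hereditary_TpE_tail:
  assumes "is_fdd UNIV E" "1 \<le> p" "1 \<le> K"
  shows "hereditary {xs \<in> TpE p UNIV E K. set xs \<subseteq> fdd_tail E m}"
  using hereditary_TpE[OF assms] subseq_set_mono unfolding hereditary_def by fastforce

text \<open>
  Supports start at \<open>0\<close> and move to the right by at least one in each step.
\<close>

lemma sorted_before_supp_ge:
  assumes E: "is_fdd UNIV E"
  shows "sorted_wrt (before E) (s @ [x]) \<Longrightarrow> \<forall>y\<in>set s. y \<noteq> 0 \<Longrightarrow> i \<in> fdd_supp E x \<Longrightarrow> length s \<le> i"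
proof (induction s arbitrary: x i rule: rev_induct)
  case (snoc y s)
  obtain j where j: "j \<in> fdd_supp E y" using fdd_supp_nonempty[OF E, of y] snoc.prems(2) by auto
  then have "length s \<le> j" using snoc.IH[of y j] snoc.prems by (auto simp: sorted_wrt_append)
  moreover have "j < i" using j snoc.prems by (auto simp: sorted_wrt_append before_def)
  ultimately show ?case by simp
qed simp

text \<open>
  A node of length \<open>m\<close> pushes everything below it into the tail. It costs \<open>m\<close> stages, which
  do not matter at a limit.
\<close>

lemma derived_TpE_tail:
  fixes l :: "'u ordinal"
  assumes E: "is_fdd UNIV E" and p: "1 \<le> p" and K: "1 \<le> K" and l: "is_limit l"
    and ne: "[] \<in> derived any (TpE p UNIV E K) l"
  shows "[] \<in> derived any {xs \<in> TpE p UNIV E K. set xs \<subseteq> fdd_tail E m} l"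
proof (rule derived_limit[OF l])
  let ?T = "TpE p UNIV E K"
  fix \<zeta> assume "\<zeta> < l"
  then have "(osucc ^^ m) \<zeta> \<le> l" using funpow_osucc_less_limit[OF l] less_imp_le by blast
  from derived_antimono[OF this ne] obtain s where s: "length s = m" "s \<in> derived any ?T \<zeta>"
    using derived_extend[of "[]" ?T m \<zeta>] by auto
  show "[] \<in> derived any {xs \<in> ?T. set xs \<subseteq> fdd_tail E m} \<zeta>"
  proof (rule derived_simulation[OF s(2), of "\<lambda>t b. t = s @ b"])
    fix t b assume "t \<in> ?T" "t = s @ b"
    then have t: "s @ b \<in> ?T" by simp
    have "b \<in> ?T"
      using hereditary_TpE[OF E p K] t unfolding hereditary_def by (meson list_emb_append2 subseq_order.refl)
    moreover have "x \<in> fdd_tail E m" if "x \<in> set b" for x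
      unfolding mem_fdd_tail_iff
    proof
      fix i assume "i \<in> fdd_supp E x"
      moreover have "sorted_wrt (before E) (s @ [x])" "\<forall>y\<in>set s. y \<noteq> 0"
        using t that unfolding TpE_iff[OF E] by (auto simp: sorted_wrt_append)
      ultimately show "m \<le> i" using sorted_before_supp_ge[OF E] s(1) by blast
    qed
    ultimately show "b \<in> {xs \<in> ?T. set xs \<subseteq> fdd_tail E m}" by blast
  qed auto
qed

lemma le_Inf_supp_iff_tail:
  assumes "is_fdd UNIV E" "t @ [y] \<in> TpE p UNIV E K"
  shows "i \<le> Inf (fdd_supp E y) \<longleftrightarrow> y \<in> fdd_tail E i"
  using assms fdd_supp_nonempty[OF assms(1), of y] unfolding mem_fdd_tail_iff TpE_iff[OF assms(1)]
  by (subst le_Inf_nat_iff) auto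

lemma fdd_tail_antimono: "i \<le> j \<Longrightarrow> fdd_tail E j \<subseteq> fdd_tail E i"
  by (auto simp: fdd_tail_def)

text \<open>
  Nothing is lost here at any ordinal: the derivation demands extensions arbitrarily far out, so they
  may be chosen beyond \<open>m\<close>.
\<close>

lemma derived_far_tail:
  assumes E: "is_fdd UNIV E" and ne: "[] \<in> derived (far E) (TpE p UNIV E K) \<xi>"
  shows "[] \<in> derived (far E) {xs \<in> TpE p UNIV E K. set xs \<subseteq> fdd_tail E m} \<xi>"
proof (rule derived_simulation[OF ne, of "\<lambda>t b. t = b \<and> set b \<subseteq> fdd_tail E m"])
  let ?T = "TpE p UNIV E K"
  fix t b :: "'a list" and j
  assume tb: "t = b \<and> set b \<subseteq> fdd_tail E m"
  have "\<exists>y'. j \<le> Inf (fdd_supp E y') \<and> t @ [y] = b @ [y'] \<and> set (b @ [y']) \<subseteq> fdd_tail E m"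
    if "max j m \<le> Inf (fdd_supp E y)" "t @ [y] \<in> ?T" for y
  proof -
    have "y \<in> fdd_tail E m"
      using that le_Inf_supp_iff_tail[OF E that(2), of "max j m"] fdd_tail_antimono[of m "max j m" E] by auto
    then show ?thesis using tb that by auto
  qed
  then show "\<exists>i. \<forall>y. i \<le> Inf (fdd_supp E y) \<longrightarrow> t @ [y] \<in> ?T \<longrightarrow>
      (\<exists>y'. j \<le> Inf (fdd_supp E y') \<and> t @ [y] = b @ [y'] \<and> set (b @ [y']) \<subseteq> fdd_tail E m)"
    by blast
qed auto

lemma derived_far_shift:
  fixes E :: "nat \<Rightarrow> 'a::banach set"
  assumes E: "is_fdd UNIV E"
  shows "[] \<in> derived (far (\<lambda>n. E (m + n))) (TpE p (fdd_tail E m) (\<lambda>n. E (m + n)) K) \<xi> \<longleftrightarrow>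
    [] \<in> derived (far E) (TpE p UNIV E K) \<xi>" (is "_ \<in> derived (far ?F) ?T' _ \<longleftrightarrow> _ \<in> derived _ ?T _")
proof -
  have T': "?T' = {xs \<in> ?T. set xs \<subseteq> fdd_tail E m}" by (rule TpE_tail_eq[OF E])
  have far: "i \<le> Inf (fdd_supp ?F y) \<longleftrightarrow> y \<in> fdd_tail E (m + i)" if "t @ [y] \<in> ?T'" for t y i
  proof -
    have y: "y \<in> fdd_tail E m" "y \<noteq> 0" using that unfolding T' TpE_iff[OF E] by auto
    then have "fdd_supp ?F y \<noteq> {}"
      using fdd_supp_nonempty[OF E y(2)] fdd_supp_shift[OF E y(1)] by auto
    then show ?thesis
      unfolding mem_fdd_tail_iff fdd_supp_shift[OF E y(1)] by (simp add: le_Inf_nat_iff)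
  qed
  show ?thesis
  proof
    assume "[] \<in> derived (far E) ?T \<xi>"
    then have "[] \<in> derived (far E) ?T' \<xi>" unfolding T' by (rule derived_far_tail[OF E])
    then show "[] \<in> derived (far ?F) ?T' \<xi>"
    proof (rule derived_simulation[where R = "(=)"])
      fix t b :: "'a list" and j assume "t = b"
      have "j \<le> Inf (fdd_supp ?F y)" if "m + j \<le> Inf (fdd_supp E y)" "t @ [y] \<in> ?T'" for y
        using that far[OF that(2)] le_Inf_supp_iff_tail[OF E, of t y p K "m + j"] unfolding T' by simp
      then show "\<exists>i. \<forall>y. i \<le> Inf (fdd_supp E y) \<longrightarrow> t @ [y] \<in> ?T' \<longrightarrow>
          (\<exists>y'. j \<le> Inf (fdd_supp ?F y') \<and> t @ [y] = b @ [y'])"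
        using \<open>t = b\<close> by blast
    qed auto
  next
    assume "[] \<in> derived (far ?F) ?T' \<xi>"
    then show "[] \<in> derived (far E) ?T \<xi>"
    proof (rule derived_simulation[where R = "(=)"])
      fix t b :: "'a list" and j assume "t = b"
      have "j \<le> Inf (fdd_supp E y)" if "j \<le> Inf (fdd_supp ?F y)" "t @ [y] \<in> ?T'" for y
        using that far[OF that(2), of j] le_Inf_supp_iff_tail[OF E, of t y p K j] fdd_tail_antimono[of j "m + j" E]
        unfolding T' by auto
      then show "\<exists>i. \<forall>y. i \<le> Inf (fdd_supp ?F y) \<longrightarrow> t @ [y] \<in> ?T' \<longrightarrow>
          (\<exists>y'. j \<le> Inf (fdd_supp E y') \<and> t @ [y] = b @ [y'])"
        using \<open>t = b\<close> by blast
    qed (auto simp: T')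
  qed
qed

lemma supports_bounded:
  assumes "\<forall>x\<in>set t. finite (fdd_supp E x)"
  shows "\<exists>M\<ge>j. \<forall>x\<in>set t. \<forall>n\<in>fdd_supp E x. n < M"
proof -
  have "finite (\<Union>x\<in>set t. fdd_supp E x)" using assms by blast
  then obtain N where "\<forall>n\<in>(\<Union>x\<in>set t. fdd_supp E x). n \<le> N"
    unfolding finite_nat_set_iff_bounded_le by blast
  then show ?thesis by (intro exI[of _ "max j (Suc N)"]) fastforce
qed

lemma partial_sum_tail_eq: "y \<in> fdd_tail E M \<Longrightarrow> partial_sum E M y = 0"
  by (simp add: partial_sum_def fdd_tail_def)

lemma partial_sum_supp_less:
  assumes E: "is_fdd UNIV E" and "\<And>n. n \<in> fdd_supp E x \<Longrightarrow> n < M"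
  shows "partial_sum E M x = x"
proof -
  have "(\<lambda>n. fdd_proj E n x) sums partial_sum E M x"
    unfolding partial_sum_def using assms(2) by (intro sums_finite) (auto simp: fdd_supp_def)
  then show ?thesis using fdd_sums[OF E] sums_unique2 by blast
qed

lemma fdd_unit_vector:
  fixes E :: "nat \<Rightarrow> 'a::banach set"
  assumes inf: "\<not> (\<exists>B :: 'a set. finite B \<and> span B = UNIV)" and E: "is_fdd UNIV E"
  shows "\<exists>y. norm y = 1 \<and> finite (fdd_supp E y) \<and> y \<in> fdd_tail E i"
proof -
  have "\<exists>n\<ge>i. \<exists>v\<in>E n. v \<noteq> 0"
  proof (rule ccontr)
    assume "\<not> ?thesis"
    then have zero: "v = 0" if "n \<ge> i" "v \<in> E n" for n v using that by blast
    have "\<exists>B. finite B \<and> E n = span B" for n using E by (simp add: is_fdd_def)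
    then obtain B where B: "\<And>n. finite (B n)" "\<And>n. E n = span (B n)" by metis
    have "x \<in> span (\<Union>n<i. B n)" for x
    proof -
      have "n < i" if "n \<in> fdd_supp E x" for n
        using that zero[OF _ fdd_proj_mem[OF E, of n x]] by (force simp: fdd_supp_def not_less[symmetric])
      then have "partial_sum E i x = x" by (rule partial_sum_supp_less[OF E])
      moreover have "partial_sum E i x \<in> span (\<Union>n<i. B n)"
        unfolding partial_sum_def
      proof (rule span_sum)
        fix n assume "n \<in> {..<i}"
        then have "span (B n) \<subseteq> span (\<Union>n<i. B n)" by (intro span_mono) auto
        then show "fdd_proj E n x \<in> span (\<Union>n<i. B n)" using fdd_proj_mem[OF E, of n x] B(2) by auto
      qed
      ultimately show ?thesis by simp
    qed
    then have "span (\<Union>n<i. B n) = UNIV" by blast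
    moreover have "finite (\<Union>n<i. B n)" using B(1) by blast
    ultimately show False using inf by blast
  qed
  then obtain n v where v: "i \<le> n" "v \<in> E n" "v \<noteq> 0" by blast
  define y where "y = (1 / norm v) *\<^sub>R v"
  have yE: "y \<in> E n" unfolding y_def by (rule subspace_scale[OF fdd_subspace[OF E] v(2)])
  have "fdd_supp E y \<subseteq> {n}" by (auto simp: fdd_supp_def fdd_proj_component[OF E yE] split: if_splits)
  then have "finite (fdd_supp E y)" "y \<in> fdd_tail E i"
    using v(1) by (auto simp: mem_fdd_tail_iff intro: finite_subset)
  moreover have "norm y = 1" using v(3) by (simp add: y_def)
  ultimately show ?thesis by blast
qed

text \<open>
  The partial sum projection onto the first \<open>m\<close> coordinates is the identity on \<open>t\<close> and vanishes on the
  tail, which separates the two spans with constant \<open>C\<close>.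
\<close>

lemma derived_TpE_concat:
  fixes t :: "'a::banach list"
  assumes E: "is_fdd UNIV E" and p: "1 \<le> p" and K: "1 \<le> K"
    and C: "1 \<le> C" "\<And>N x. norm (partial_sum E N x) \<le> C * norm x"
    and Q: "\<And>i y. Q i y \<Longrightarrow> Q i ((1/2) *\<^sub>R y)"
    and l: "\<And>m. [] \<in> derived Q {xs \<in> TpE p UNIV E K. set xs \<subseteq> fdd_tail E m} l"
    and t: "t \<in> derived Q (TpE p UNIV E K) \<xi>"
  shows "map ((*\<^sub>R) (1/2)) t \<in> derived Q (TpE p UNIV E (4 * (1 + C) * K)) (l + \<xi>)"
  using t
proof (rule derived_concat)
  let ?T = "TpE p UNIV E K"
  fix t assume t: "t \<in> ?T"
  then have fin: "\<forall>x\<in>set t. finite (fdd_supp E x)" unfolding TpE_iff[OF E] by blast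
  obtain m where m: "\<And>x n. x \<in> set t \<Longrightarrow> n \<in> fdd_supp E x \<Longrightarrow> n < m"
    using supports_bounded[OF fin, of 0] by metis
  have "map ((*\<^sub>R) (1/2)) (t @ s) \<in> TpE p UNIV E (4 * (1 + C) * K)"
    if s: "s \<in> ?T" "set s \<subseteq> fdd_tail E m" for s
  proof -
    note lin = linear_partial_sum[OF E]
    have "norm (comb a t) \<le> C * norm (comb a t + comb b s)" for a b
    proof -
      have "partial_sum E m x = x" if "x \<in> set t" for x
        by (rule partial_sum_supp_less[OF E m[OF that]])
      then have "partial_sum E m (comb a t) = comb a t"
        unfolding linear_comb[OF lin] unfolding comb_def
        by (intro sum.cong refl) simp
      moreover have "partial_sum E m (comb b s) = 0"
        unfolding linear_comb[OF lin] using s(2)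
        by (intro sum.neutral) (auto simp: partial_sum_tail_eq subset_iff)
      ultimately have "partial_sum E m (comb a t + comb b s) = comb a t"
        by (simp add: linear_add[OF lin])
      then show ?thesis using C(2)[of m "comb a t + comb b s"] by simp
    qed
    then have "map ((*\<^sub>R) (1/2)) (t @ s) \<in> Tp p UNIV (4 * (1 + C) * K)"
      using glue_Tp[OF p K, of C t UNIV s] C(1) t s(1) unfolding TpE_iff[OF E] by auto
    moreover have "before E x y" if "x \<in> set t" "y \<in> set s" for x y
      using m[OF that(1)] subsetD[OF s(2) that(2)] unfolding before_def mem_fdd_tail_iff by fastforce
    moreover have "before E ((1/2) *\<^sub>R x) ((1/2) *\<^sub>R y) \<longleftrightarrow> before E x y" for x y
      by (simp add: before_def fdd_supp_scale[OF E])
    ultimately show ?thesis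
      using t s(1) unfolding TpE_iff[OF E]
      by (auto simp: sorted_wrt_append sorted_wrt_map fdd_supp_scale[OF E])
  qed
  then show "\<exists>S. [] \<in> derived Q S l \<and>
      (\<forall>s\<in>S. map ((*\<^sub>R) (1/2)) (t @ s) \<in> TpE p UNIV E (4 * (1 + C) * K))"
    using l[of m] by blast
qed (rule Q)

section \<open>From arbitrary sequences to block sequences\<close>

text \<open>
  Vanishing of the first \<open>M\<close> coordinates is a finite system of equations, with respect to
  finite spanning sets of the corresponding subspaces.
\<close>

lemma tail_combination:
  assumes E: "is_fdd UNIV E" and p: "1 \<le> p"
  shows "\<exists>k. \<forall>s. length s = k \<longrightarrow> (\<exists>e. lp_norm p k e = 1 \<and> comb e s \<in> fdd_tail E M)"
proof -
  have "\<exists>B. finite B \<and> E n = span B" for n using E by (simp add: is_fdd_def)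
  then obtain B where B: "\<And>n. finite (B n)" "\<And>n. E n = span (B n)" by metis
  define I where "I = (SIGMA n:{..<M}. B n)"
  have I: "finite I" unfolding I_def using B(1) by auto
  define k where "k = Suc (card I)"
  have "\<exists>e. lp_norm p k e = 1 \<and> comb e s \<in> fdd_tail E M" if s: "length s = k" for s
  proof -
    have "\<exists>u. fdd_proj E n x = (\<Sum>b\<in>B n. u b *\<^sub>R b)" for n x
      using fdd_proj_mem[OF E, of n x] unfolding B(2) span_finite[OF B(1)] by auto
    then obtain u where u: "\<And>n x. fdd_proj E n x = (\<Sum>b\<in>B n. u n x b *\<^sub>R b)" by metis
    obtain e j where e: "j < k" "e j \<noteq> 0"
      "\<And>n b. (n, b) \<in> I \<Longrightarrow> (\<Sum>j<k. e j * u n (s ! j) b) = 0"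
      using homogeneous_system[OF I, of "{..<k}" "\<lambda>j (n, b). u n (s ! j) b"]
      by (fastforce simp: k_def)
    define c where "c = lp_norm p k e"
    have c: "0 < c" unfolding c_def by (rule lp_norm_pos[of p j k e, OF p e(1,2)])
    have "fdd_proj E n (comb e s) = 0" if n: "n < M" for n
    proof -
      have "fdd_proj E n (comb e s) = (\<Sum>j<k. \<Sum>b\<in>B n. (e j * u n (s ! j) b) *\<^sub>R b)"
        unfolding linear_comb[OF linear_fdd_proj[OF E]] s by (simp add: u scaleR_sum_right)
      also have "\<dots> = (\<Sum>b\<in>B n. (\<Sum>j<k. e j * u n (s ! j) b) *\<^sub>R b)"
        by (subst sum.swap) (simp add: scaleR_sum_left)
      also have "\<dots> = 0" using e(3) n by (intro sum.neutral) (simp add: I_def)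
      finally show ?thesis .
    qed
    then have "comb (\<lambda>i. inverse c * e i) s \<in> fdd_tail E M"
      unfolding comb_scale by (simp add: fdd_tail_def linear_scale[OF linear_fdd_proj[OF E]])
    moreover have "lp_norm p k (\<lambda>i. inverse c * e i) = 1"
      using c by (simp add: lp_norm_scale[OF p] flip: c_def)
    ultimately show ?thesis by blast
  qed
  then show ?thesis by blast
qed

text \<open>
  Halving makes room for the perturbation. The errors add up to at most
  \<open>1 / (4 K)\<close> times the norm of the coefficients, half of the lower estimate \<open>1 / (2 K)\<close> for the halved sequence.
\<close>

lemma perturbed_Tp:
  fixes b b0 :: "'a::banach list"
  assumes p: "1 \<le> p" and K: "1 \<le> K" and b0: "b0 \<in> Tp p UNIV K" and len: "length b0 = length b"
    and close: "\<And>i. i < length b \<Longrightarrow> norm (b ! i - (1/2) *\<^sub>R b0 ! i) \<le> (1/2) ^ i / (8 * K)"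
  shows "b \<in> Tp p UNIV (4 * K)"
proof -
  let ?n = "length b"
  have K4: "1 \<le> 4 * K" using K by simp
  have "lp_norm p ?n c \<le> 4 * K * norm (comb c b) \<and> norm (comb c b) \<le> lp_norm p ?n c" for c
  proof -
    define L where "L = lp_norm p ?n c"
    have L: "0 \<le> L" unfolding L_def by (rule lp_norm_nonneg)
    have b0': "L \<le> K * norm (comb c b0)" "norm (comb c b0) \<le> L"
      using b0 unfolding Tp_iff[OF p K] L_def len by blast+
    have "comb c b - (1/2) *\<^sub>R comb c b0 = (\<Sum>i<?n. c i *\<^sub>R (b ! i - (1/2) *\<^sub>R b0 ! i))"
      by (simp add: comb_def len scaleR_sum_right sum_subtractf scaleR_diff_right mult.commute)
    also have "norm \<dots> \<le> (\<Sum>i<?n. L * ((1/2) ^ i / (8 * K)))"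
    proof (rule sum_norm_le)
      fix i assume "i \<in> {..<?n}"
      then have "\<bar>c i\<bar> \<le> L" "norm (b ! i - (1/2) *\<^sub>R b0 ! i) \<le> (1/2) ^ i / (8 * K)"
        using abs_le_lp_norm[OF p, of i ?n c] close by (auto simp: L_def)
      then show "norm (c i *\<^sub>R (b ! i - (1/2) *\<^sub>R b0 ! i)) \<le> L * ((1/2) ^ i / (8 * K))"
        unfolding norm_scaleR using L by (intro mult_mono) auto
    qed
    also have "\<dots> = L / (8 * K) * (\<Sum>i<?n. (1/2) ^ i)"
      by (simp add: sum_distrib_left)
    also have "\<dots> \<le> L / (8 * K) * 2"
    proof (rule mult_left_mono)
      show "(\<Sum>i<?n. (1/2 :: real) ^ i) \<le> 2"
        using sum_gp_strict[of "1/2 :: real" ?n] by simp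
    qed (use L K in simp)
    finally have d: "norm (comb c b - (1/2) *\<^sub>R comb c b0) \<le> L / (4 * K)" by simp
    have L4: "L / (4 * K) \<le> L / 4" using L K by (intro divide_left_mono) auto
    have half: "norm ((1/2) *\<^sub>R comb c b0) = norm (comb c b0) / 2" by simp
    have up: "norm (comb c b) \<le> norm (comb c b0) / 2 + L / (4 * K)"
      using norm_triangle_sub[of "comb c b" "(1/2) *\<^sub>R comb c b0"] d unfolding half by linarith
    have "norm (comb c b0) / 2 \<le> norm (comb c b) + L / (4 * K)"
      using norm_triangle_sub[of "(1/2) *\<^sub>R comb c b0" "comb c b"] d
      unfolding half norm_minus_commute[of "comb c b"] by linarith
    then have "K * (norm (comb c b0) / 2) \<le> K * (norm (comb c b) + L / (4 * K))"
      using K by (intro mult_left_mono) auto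
    also have "\<dots> = K * norm (comb c b) + L / 4" using K by (simp add: field_simps)
    finally have "L / 2 \<le> K * norm (comb c b) + L / 4" using b0'(1) by linarith
    then show ?thesis using up b0'(2) L4 L by (simp flip: L_def)
  qed
  then show ?thesis unfolding Tp_iff[OF p K4] by simp
qed

text \<open>
  To a node \<open>t\<close> corresponds a block sequence \<open>b\<close> which is half of a sequence \<open>b0\<close> of normalized successive
  blocks of \<open>t\<close>, up to a perturbation. The number of new vectors of \<open>t\<close> needed to place the next
  block far out depends on \<open>b\<close> and \<open>j\<close>, whence the factor \<open>\<omega>\<close>.
\<close>

lemma derived_Tp_imp_TpE:
  fixes E :: "nat \<Rightarrow> 'a::banach set" and \<xi> :: "'u ordinal"
  assumes E: "is_fdd UNIV E" and p: "1 \<le> p" and K: "1 \<le> K"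
    and ne: "[] \<in> derived any (Tp p (UNIV :: 'a set) K) (omega * \<xi>)"
  shows "[] \<in> derived (far E) (TpE p UNIV E (4 * K)) \<xi>"
proof -
  let ?T = "Tp p (UNIV :: 'a set) K"
  define near where "near b b0 \<longleftrightarrow> length b0 = length b \<and>
      (\<forall>i<length b. norm (b ! i - (1/2) *\<^sub>R b0 ! i) \<le> (1/2) ^ i / (8 * K))" for b b0 :: "'a list"
  define blk where "blk b \<longleftrightarrow> (\<forall>x\<in>set b. x \<noteq> 0 \<and> finite (fdd_supp E x)) \<and> sorted_wrt (before E) b" for b
  define R where "R t b \<longleftrightarrow> (\<exists>b0. lp_embeds p t b0 \<and> near b b0) \<and> blk b" for t b
  from ne show ?thesis
  proof (rule derived_block_simulation[where R = R])
    show "R [] []" by (auto simp: R_def near_def blk_def lp_embeds_Nil)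
  next
    fix t b assume t: "t \<in> ?T" and "R t b"
    then obtain b0 where b0: "lp_embeds p t b0" "near b b0" and b: "blk b" unfolding R_def by blast
    have "b0 \<in> ?T" using lp_embeds_Tp[OF p K t b0(1)] by blast
    then have "b \<in> Tp p UNIV (4 * K)" using perturbed_Tp[OF p K] b0(2) unfolding near_def by blast
    then show "b \<in> TpE p UNIV E (4 * K)" using b unfolding TpE_iff[OF E] blk_def by blast
  next
    fix t b :: "'a list" and j :: nat assume t: "t \<in> ?T" and "R t b"
    then obtain b0 where b0: "lp_embeds p t b0" "near b b0" and b: "blk b" unfolding R_def by blast
    have "\<forall>x\<in>set b. finite (fdd_supp E x)" using b unfolding blk_def by blast
    then obtain M where M: "j \<le> M" "\<forall>x\<in>set b. \<forall>n\<in>fdd_supp E x. n < M" using supports_bounded by blast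
    obtain k where k: "\<And>s. length s = k \<Longrightarrow> \<exists>e. lp_norm p k e = 1 \<and> comb e s \<in> fdd_tail E M"
      using tail_combination[OF E p] by blast
    have "\<exists>y. j \<le> Inf (fdd_supp E y) \<and> R (t @ s) (b @ [y])" if s: "length s = k" "t @ s \<in> ?T" for s
    proof -
      obtain e where e: "lp_norm p k e = 1" "comb e s \<in> fdd_tail E M" using k s(1) by blast
      define y0 where "y0 = comb e s"
      \<comment> \<open>The tolerance at position \<open>length b\<close>. It also keeps \<open>y\<close> nonzero, as \<open>y0\<close> has norm at least \<open>1 / K\<close>.\<close>
      define \<epsilon> where "\<epsilon> = (1/2) ^ length b / (8 * K)"
      have \<epsilon>: "0 < \<epsilon>" "\<epsilon> \<le> 1 / (8 * K)"
        using K by (auto simp: \<epsilon>_def intro!: divide_right_mono power_le_one)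
      have "subseq s (t @ s)" by (rule list_emb_append2) simp
      then have "s \<in> ?T" using hereditary_Tp[OF p K] s(2) unfolding hereditary_def by blast
      then have "1 \<le> K * norm y0" unfolding Tp_iff[OF p K] y0_def using e(1) s(1) by metis
      then have "1 / K \<le> norm y0" using K by (simp add: field_simps)
      then have y0: "4 * \<epsilon> \<le> norm y0 / 2" using \<epsilon>(2) by simp
      obtain N where N: "norm (partial_sum E N y0 - y0) < \<epsilon>"
        using LIMSEQ_D[OF partial_sum_tendsto[OF E, of y0] \<epsilon>(1)] by blast
      define y where "y = (1/2) *\<^sub>R partial_sum E N y0"
      have proj: "fdd_proj E n y = (if n < N then (1/2) *\<^sub>R fdd_proj E n y0 else 0)" for n
        by (simp add: y_def partial_sum_def linear_scale[OF linear_fdd_proj[OF E]] fdd_proj_sum[OF E])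
      have "y - (1/2) *\<^sub>R y0 = (1/2) *\<^sub>R (partial_sum E N y0 - y0)"
        by (simp add: y_def scaleR_diff_right)
      then have close: "norm (y - (1/2) *\<^sub>R y0) \<le> \<epsilon>" using N \<epsilon>(1) by simp
      have "norm ((1/2) *\<^sub>R y0) \<le> norm y + norm (y - (1/2) *\<^sub>R y0)"
        using norm_triangle_sub[of "(1/2) *\<^sub>R y0" y] by (simp add: norm_minus_commute)
      then have y: "y \<noteq> 0" using close y0 \<epsilon>(1) by auto
      have "fdd_supp E y \<subseteq> {..<N}" by (auto simp: fdd_supp_def proj split: if_splits)
      then have fin: "finite (fdd_supp E y)" by (rule finite_subset) simp
      have tail: "y \<in> fdd_tail E M" using e(2) by (simp add: fdd_tail_def proj flip: y0_def)
      then have "j \<le> Inf (fdd_supp E y)"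
        using fdd_supp_nonempty[OF E y] M(1) unfolding mem_fdd_tail_iff
        by (auto simp: le_Inf_nat_iff)
      moreover have "blk (b @ [y])"
        using b y fin tail M(2) unfolding blk_def before_def mem_fdd_tail_iff
        by (fastforce simp: sorted_wrt_append before_def)
      moreover have "near (b @ [y]) (b0 @ [y0])"
        using b0(2) close unfolding near_def \<epsilon>_def by (auto simp: nth_append less_Suc_eq)
      moreover have "lp_embeds p (t @ s) (b0 @ [y0])"
        using lp_embeds_snoc[OF p b0(1), of s e y0] e(1) s(1) by (simp add: y0_def)
      ultimately show ?thesis unfolding R_def by blast
    qed
    moreover have "(osucc ^^ k) 0 \<le> omega"
      by (intro less_imp_le funpow_osucc_less_limit is_limit_omega zero_less_omega)
    ultimately show "\<exists>n. (osucc ^^ n) 0 \<le> (omega :: 'u ordinal) \<and> (\<forall>s. length s = n \<longrightarrow>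
        t @ s \<in> ?T \<longrightarrow> (\<exists>y. j \<le> Inf (fdd_supp E y) \<and> R (t @ s) (b @ [y])))" by blast
  qed
qed

lemma far_derived_one:
  fixes E :: "nat \<Rightarrow> 'a::banach set"
  assumes inf: "\<not> (\<exists>B :: 'a set. finite B \<and> span B = UNIV)" and E: "is_fdd UNIV E"
    and p: "1 \<le> p" and K: "1 \<le> K"
  shows "[] \<in> derived (far E) (TpE p UNIV E K) (1 :: 'u ordinal)"
proof (rule derived_oneI)
  fix i
  obtain y where y: "norm y = 1" "finite (fdd_supp E y)" "y \<in> fdd_tail E i"
    using fdd_unit_vector[OF inf E] by blast
  then have "[] @ [y] \<in> TpE p UNIV E K"
    using singleton_in_Tp[OF p K, of y UNIV] by (auto simp: TpE_iff[OF E])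
  then show "\<exists>y. i \<le> Inf (fdd_supp E y) \<and> [] @ [y] \<in> TpE p UNIV E K"
    using le_Inf_supp_iff_tail[OF E, of "[]" y p K i] y(3) by blast
qed (rule Nil_in_TpE[OF E p])

lemma add_TpE_far:
  fixes E :: "nat \<Rightarrow> 'a::banach set" and l \<xi> :: "'u ordinal"
  assumes E: "is_fdd UNIV E" and p: "1 \<le> p" and K: "1 \<le> K"
    and l: "[] \<in> derived (far E) (TpE p UNIV E K) l" and \<xi>: "[] \<in> derived (far E) (TpE p UNIV E K) \<xi>"
  shows "\<exists>K'\<ge>1. [] \<in> derived (far E) (TpE p UNIV E K') (l + \<xi>)"
proof -
  obtain C where C: "1 \<le> C" "\<And>N x. norm (partial_sum E N x) \<le> C * norm x"
    using fdd_constant[OF E] by blast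
  have "1 * 1 \<le> (4 * (1 + C)) * K" using K C by (intro mult_mono) auto
  moreover have scale: "i \<le> Inf (fdd_supp E y) \<Longrightarrow> i \<le> Inf (fdd_supp E ((1/2) *\<^sub>R y))" for i y
    by (simp add: fdd_supp_scale[OF E])
  have "[] \<in> derived (far E) (TpE p UNIV E (4 * (1 + C) * K)) (l + \<xi>)"
    using derived_TpE_concat[OF E p K C, of "far E", OF scale derived_far_tail[OF E l] \<xi>] by simp
  ultimately show ?thesis by (intro exI[of _ "4 * (1 + C) * K"]) simp
qed

lemma double_TpE:
  fixes E :: "nat \<Rightarrow> 'a::banach set" and l :: "'u ordinal"
  assumes E: "is_fdd UNIV E" and p: "1 \<le> p" and K: "1 \<le> K"
    and lim: "is_limit l" and l: "[] \<in> derived any (TpE p UNIV E K) l"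
  shows "\<exists>K'\<ge>1. [] \<in> derived any (TpE p UNIV E K') (l + l)"
proof -
  obtain C where C: "1 \<le> C" "\<And>N x. norm (partial_sum E N x) \<le> C * norm x"
    using fdd_constant[OF E] by blast
  have "1 * 1 \<le> (4 * (1 + C)) * K" using K C by (intro mult_mono) auto
  moreover have "[] \<in> derived any (TpE p UNIV E (4 * (1 + C) * K)) (l + l)"
    using derived_TpE_concat[OF E p K C, of any, OF _ derived_TpE_tail[OF E p K lim l] l] by simp
  ultimately show ?thesis by (intro exI[of _ "4 * (1 + C) * K"]) simp
qed

lemma finite_less_TpE:
  fixes E :: "nat \<Rightarrow> 'a::banach set"
  assumes inf: "\<not> (\<exists>B :: 'a set. finite B \<and> span B = UNIV)" and E: "is_fdd UNIV E" and p: "1 \<le> p"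
  shows "\<exists>K\<ge>1. [] \<in> derived (far E) (TpE p UNIV E K) ((osucc ^^ n) 0 :: 'u ordinal)"
proof (induction n)
  case 0
  then show ?case using Nil_in_TpE[OF E p] by (auto simp: derived_def orec_zero intro: exI[of _ 1])
next
  case (Suc n)
  then obtain K where K: "1 \<le> K"
    "[] \<in> derived (far E) (TpE p UNIV E K) ((osucc ^^ n) 0 :: 'u ordinal)" by blast
  show ?case
    using add_TpE_far[OF E p K(1) far_derived_one[OF inf E p K(1)] K(2)] unfolding one_add_finite .
qed

section \<open>The indices\<close>

lemma less_IpK_iff:
  assumes "1 \<le> p" "1 \<le> K"
  shows "Fin \<xi> < IpK p X K \<longleftrightarrow> [] \<in> derived any (Tp p X K) \<xi>"
  unfolding IpK_def by (rule less_tree_order_iff[OF hereditary_Tp[OF assms]])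

lemma less_IpEK_iff:
  assumes "is_fdd UNIV E" "1 \<le> p" "1 \<le> K"
  shows "Fin \<xi> < IpEK p UNIV E K \<longleftrightarrow> [] \<in> derived any (TpE p UNIV E K) \<xi>"
  unfolding IpEK_def by (rule less_tree_order_iff[OF hereditary_TpE[OF assms]])

lemma less_IapEK_iff:
  assumes "is_fdd UNIV E" "1 \<le> p" "1 \<le> K"
  shows "Fin \<xi> < IapEK p UNIV E K \<longleftrightarrow> [] \<in> derived (far E) (TpE p UNIV E K) \<xi>"
  unfolding IapEK_def by (rule less_fdd_order_iff[OF hereditary_TpE[OF assms]])

lemma index_neq_Minf: "IpK p X K \<noteq> Minf" "IpEK p X E K \<noteq> Minf" "IapEK p X E K \<noteq> Minf"
  by (simp_all add: IpK_def IpEK_def IapEK_def tree_order_def fdd_order_def iter_order_neq_Minf)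

lemma IpK_kernel_iff:
  fixes F :: "('a::banach \<Rightarrow>\<^sub>L real) set" and lam :: "('a + 'u) ordinal"
  assumes p: "1 \<le> p" and K: "1 \<le> K" and F: "finite F" and lam: "is_limit lam"
  shows "Fin lam < IpK p (UNIV :: 'a set) K \<longleftrightarrow> Fin lam < IpK p (\<Inter>f\<in>F. {x. blinfun_apply f x = 0}) K"
proof -
  let ?F = "blinfun_apply ` F"
  have lin: "linear f" if "f \<in> ?F" for f using that by (auto intro: blinfun.bounded_linear_right bounded_linear.linear)
  have Y: "(\<Inter>f\<in>F. {x. blinfun_apply f x = 0}) = (\<Inter>f\<in>?F. {x. f x = 0})" by simp
  have "[] \<in> derived any (Tp p (UNIV :: 'a set) K) lam \<Longrightarrow>
      [] \<in> derived any (Tp p (\<Inter>f\<in>?F. {x. f x = 0}) K) lam"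
    using F by (intro derived_Tp_kernel[OF p K _ lin lam]) auto
  moreover have "[] \<in> derived any (Tp p (\<Inter>f\<in>?F. {x. f x = 0}) K) lam \<Longrightarrow>
      [] \<in> derived any (Tp p (UNIV :: 'a set) K) lam"
    by (rule derived_mono[OF Tp_mono[OF subset_UNIV]])
  ultimately show ?thesis unfolding less_IpK_iff[OF p K] Y by blast
qed

lemma IpEK_tail_iff:
  assumes E: "is_fdd UNIV E" and p: "1 \<le> p" and K: "1 \<le> K" and lam: "is_limit lam"
  shows "Fin lam < IpEK p UNIV E K \<longleftrightarrow> Fin lam < IpEK p (fdd_tail E m) (\<lambda>n. E (m + n)) K"
proof -
  have "Fin lam < IpEK p (fdd_tail E m) (\<lambda>n. E (m + n)) K \<longleftrightarrow>
      [] \<in> derived any {xs \<in> TpE p UNIV E K. set xs \<subseteq> fdd_tail E m} lam"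
    unfolding IpEK_def TpE_tail_eq[OF E]
    by (rule less_tree_order_iff[OF hereditary_TpE_tail[OF E p K]])
  moreover have "{xs \<in> TpE p UNIV E K. set xs \<subseteq> fdd_tail E m} \<subseteq> TpE p UNIV E K" by blast
  ultimately show ?thesis
    unfolding less_IpEK_iff[OF E p K]
    using derived_TpE_tail[OF E p K lam] derived_mono by blast
qed

lemma IapEK_tail_eq:
  fixes E :: "nat \<Rightarrow> 'a::banach set"
  assumes E: "is_fdd UNIV E" and p: "1 \<le> p" and K: "1 \<le> K"
  shows "(IapEK p UNIV E K :: ('a + 'u) ordinal extended) = IapEK p (fdd_tail E m) (\<lambda>n. E (m + n)) K"
proof (rule extended_eqI[OF index_neq_Minf(3) index_neq_Minf(3)])
  fix \<xi> :: "('a + 'u) ordinal"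
  have "hereditary (TpE p (fdd_tail E m) (\<lambda>n. E (m + n)) K)"
    unfolding TpE_tail_eq[OF E] by (rule hereditary_TpE_tail[OF E p K])
  then have "Fin \<xi> < IapEK p (fdd_tail E m) (\<lambda>n. E (m + n)) K \<longleftrightarrow>
      [] \<in> derived (far (\<lambda>n. E (m + n))) (TpE p (fdd_tail E m) (\<lambda>n. E (m + n)) K) \<xi>"
    unfolding IapEK_def by (rule less_fdd_order_iff)
  then show "Fin \<xi> < IapEK p UNIV E K \<longleftrightarrow> Fin \<xi> < IapEK p (fdd_tail E m) (\<lambda>n. E (m + n)) K"
    unfolding less_IapEK_iff[OF E p K] derived_far_shift[OF E] by simp
qed

lemma Ip_omega_pow:
  fixes p :: ereal
  assumes inf: "\<not> (\<exists>B :: 'a::banach set. finite B \<and> span B = UNIV)" and p: "1 \<le> p"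
    and fin: "(Ip p (UNIV :: 'a set) :: ('a + 'u) ordinal extended) \<noteq> Pinf"
  shows "\<exists>\<xi> :: ('a + 'u) ordinal. Ip p (UNIV :: 'a set) = Fin (omega_pow \<xi>)"
    and "1 \<le> K \<Longrightarrow> (IpK p (UNIV :: 'a set) K :: ('a + 'u) ordinal extended) < Ip p UNIV"
proof -
  let ?f = "\<lambda>K. IpK p (UNIV :: 'a set) K :: ('a + 'u) ordinal extended"
  note iff = less_IpK_iff[OF p]
  have 1: "\<exists>K\<ge>1. Fin ((osucc ^^ n) 0) < ?f K" for n
    using finite_less_Tp[OF inf p, of n] iff by blast
  have 2: "\<exists>K'\<ge>1. Fin (l + l) < ?f K'" if "K \<ge> 1" "is_limit l" "Fin l < ?f K" for K l
    using double_Tp[OF p that(1,2)] that iff[of K] iff[of "12 * K"] by (intro exI[of _ "12 * K"]) auto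
  have 3: "Fin l < ?f K" if "K \<ge> 1" "is_limit l" "\<And>\<zeta>. \<zeta> < l \<Longrightarrow> Fin \<zeta> < ?f K" for K l
    using that derived_limit[OF that(2)] iff[OF that(1)] by blast
  note thms = index_omega_pow[of ?f, OF index_neq_Minf(1) 1 2 3, folded Ip_def, OF _ _ _ _ _ _ fin]
  show "\<exists>\<xi> :: ('a + 'u) ordinal. Ip p (UNIV :: 'a set) = Fin (omega_pow \<xi>)"
    by (rule thms(1))
  show "1 \<le> K \<Longrightarrow> ?f K < Ip p UNIV" by (rule thms(2))
qed

lemma IpE_omega_pow:
  fixes p :: ereal and E :: "nat \<Rightarrow> 'a::banach set"
  assumes inf: "\<not> (\<exists>B :: 'a set. finite B \<and> span B = UNIV)" and E: "is_fdd UNIV E" and p: "1 \<le> p"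
    and fin: "(IpE p UNIV E :: ('a + 'u) ordinal extended) \<noteq> Pinf"
  shows "\<exists>\<xi> :: ('a + 'u) ordinal. IpE p UNIV E = Fin (omega_pow \<xi>)"
    and "1 \<le> K \<Longrightarrow> (IpEK p UNIV E K :: ('a + 'u) ordinal extended) < IpE p UNIV E"
proof -
  let ?f = "\<lambda>K. IpEK p UNIV E K :: ('a + 'u) ordinal extended"
  note iff = less_IpEK_iff[OF E p]
  have 1: "\<exists>K\<ge>1. Fin ((osucc ^^ n) 0) < ?f K" for n
    using finite_less_TpE[OF inf E p, of n] derived_imp_derived_any iff by blast
  have 2: "\<exists>K'\<ge>1. Fin (l + l) < ?f K'" if "K \<ge> 1" "is_limit l" "Fin l < ?f K" for K l
    using double_TpE[OF E p that(1,2)] that iff by blast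
  have 3: "Fin l < ?f K" if "K \<ge> 1" "is_limit l" "\<And>\<zeta>. \<zeta> < l \<Longrightarrow> Fin \<zeta> < ?f K" for K l
    using that derived_limit[OF that(2)] iff[OF that(1)] by blast
  note thms = index_omega_pow[of ?f, OF index_neq_Minf(2) 1 2 3, folded IpE_def, OF _ _ _ _ _ _ fin]
  show "\<exists>\<xi> :: ('a + 'u) ordinal. IpE p UNIV E = Fin (omega_pow \<xi>)"
    by (rule thms(1))
  show "1 \<le> K \<Longrightarrow> ?f K < IpE p UNIV E" by (rule thms(2))
qed

lemma IapE_omega_pow:
  fixes p :: ereal and E :: "nat \<Rightarrow> 'a::banach set"
  assumes inf: "\<not> (\<exists>B :: 'a set. finite B \<and> span B = UNIV)" and E: "is_fdd UNIV E" and p: "1 \<le> p"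
    and fin: "(IapE p UNIV E :: ('a + 'u) ordinal extended) \<noteq> Pinf"
  shows "\<exists>\<xi> :: ('a + 'u) ordinal. IapE p UNIV E = Fin (omega_pow \<xi>)"
    and "1 \<le> K \<Longrightarrow> (IapEK p UNIV E K :: ('a + 'u) ordinal extended) < IapE p UNIV E"
proof -
  let ?f = "\<lambda>K. IapEK p UNIV E K :: ('a + 'u) ordinal extended"
  note iff = less_IapEK_iff[OF E p]
  have 1: "\<exists>K\<ge>1. Fin ((osucc ^^ n) 0) < ?f K" for n
    using finite_less_TpE[OF inf E p, of n] iff by blast
  have 2: "\<exists>K'\<ge>1. Fin (l + l) < ?f K'" if "K \<ge> 1" "is_limit l" "Fin l < ?f K" for K l
    using add_TpE_far[OF E p that(1), of l l] that iff by blast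
  have 3: "Fin l < ?f K" if "K \<ge> 1" "is_limit l" "\<And>\<zeta>. \<zeta> < l \<Longrightarrow> Fin \<zeta> < ?f K" for K l
    using that derived_limit[OF that(2)] iff[OF that(1)] by blast
  note thms = index_omega_pow[of ?f, OF index_neq_Minf(3) 1 2 3, folded IapE_def, OF _ _ _ _ _ _ fin]
  show "\<exists>\<xi> :: ('a + 'u) ordinal. IapE p UNIV E = Fin (omega_pow \<xi>)"
    by (rule thms(1))
  show "1 \<le> K \<Longrightarrow> ?f K < IapE p UNIV E" by (rule thms(2))
qed

text \<open>
  Beyond \<open>\<omega>\<^sup>1\<^sup>+\<^sup>\<alpha> \<ge> \<omega> * \<omega>\<^sup>\<alpha>\<close> the index of arbitrary sequences would yield a block index beyond \<open>\<omega>\<^sup>\<alpha>\<close>.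
\<close>

lemma index_exponents:
  fixes p :: ereal and E :: "nat \<Rightarrow> 'a::banach set"
  assumes inf: "\<not> (\<exists>B :: 'a set. finite B \<and> span B = UNIV)" and E: "is_fdd UNIV E" and p: "1 \<le> p"
    and fin: "(Ip p (UNIV :: 'a set) :: ('a + 'u) ordinal extended) \<noteq> Pinf"
  shows "\<exists>\<alpha> \<beta> \<gamma> :: ('a + 'u) ordinal. \<alpha> \<le> \<beta> \<and> \<beta> \<le> \<gamma> \<and> \<gamma> \<le> 1 + \<alpha> \<and>
           IapE p UNIV E = Fin (omega_pow \<alpha>) \<and>
           IpE p UNIV E = Fin (omega_pow \<beta>) \<and>
           Ip p (UNIV :: 'a set) = Fin (omega_pow \<gamma>)"
proof -
  have "(IapE p UNIV E :: ('a + 'u) ordinal extended) \<le> IpE p UNIV E"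
    unfolding IapE_def IpE_def
  proof (rule lub_family_mono[OF index_neq_Minf(3) index_neq_Minf(2)])
    fix K :: real assume K: "1 \<le> K"
    show "(IapEK p UNIV E K :: ('a + 'u) ordinal extended) \<le> IpEK p UNIV E K"
      by (rule extended_leI[OF index_neq_Minf(2)])
        (use derived_imp_derived_any less_IapEK_iff[OF E p K] less_IpEK_iff[OF E p K] in blast)
  qed
  moreover have "(IpE p UNIV E :: ('a + 'u) ordinal extended) \<le> Ip p UNIV"
    unfolding IpE_def Ip_def
  proof (rule lub_family_mono[OF index_neq_Minf(2) index_neq_Minf(1)])
    fix K :: real assume K: "1 \<le> K"
    have "TpE p UNIV E K \<subseteq> Tp p UNIV K" by (auto simp: TpE_def)
    then show "(IpEK p UNIV E K :: ('a + 'u) ordinal extended) \<le> IpK p UNIV K"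
      by (intro extended_leI[OF index_neq_Minf(1)])
        (use derived_mono less_IpEK_iff[OF E p K] less_IpK_iff[OF p K] in blast)
  qed
  ultimately have le: "(IapE p UNIV E :: ('a + 'u) ordinal extended) \<le> IpE p UNIV E"
    "(IpE p UNIV E :: ('a + 'u) ordinal extended) \<le> Ip p UNIV" by auto
  then have finE: "(IpE p UNIV E :: ('a + 'u) ordinal extended) \<noteq> Pinf"
    "(IapE p UNIV E :: ('a + 'u) ordinal extended) \<noteq> Pinf"
    using fin by (metis Pinf_le)+
  obtain \<alpha> :: "('a + 'u) ordinal" where \<alpha>: "IapE p UNIV E = Fin (omega_pow \<alpha>)"
    using IapE_omega_pow(1)[OF inf E p finE(2)] by blast
  obtain \<beta> :: "('a + 'u) ordinal" where \<beta>: "IpE p UNIV E = Fin (omega_pow \<beta>)"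
    using IpE_omega_pow(1)[OF inf E p finE(1)] by blast
  obtain \<gamma> :: "('a + 'u) ordinal" where \<gamma>: "Ip p (UNIV :: 'a set) = Fin (omega_pow \<gamma>)"
    using Ip_omega_pow(1)[OF inf p fin] by blast
  have "omega_pow \<alpha> \<le> omega_pow \<beta>" "omega_pow \<beta> \<le> omega_pow \<gamma>"
    using le unfolding \<alpha> \<beta> \<gamma> by simp_all
  moreover have "omega_pow \<gamma> \<le> omega_pow (1 + \<alpha>)"
  proof (rule ccontr)
    assume "\<not> ?thesis"
    then have "Fin (omega_pow (1 + \<alpha>)) < Ip p (UNIV :: 'a set)" unfolding \<gamma> by simp
    then have less: "Fin (omega_pow (1 + \<alpha>)) <
        lub {IpK p (UNIV :: 'a set) K :: ('a + 'u) ordinal extended | K. K \<ge> 1}" unfolding Ip_def .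
    have ne: "{IpK p (UNIV :: 'a set) K :: ('a + 'u) ordinal extended | K. K \<ge> 1} \<noteq> {}"
      using order_refl[of "1::real"] by blast
    have Minf: "Minf \<notin> {IpK p (UNIV :: 'a set) K :: ('a + 'u) ordinal extended | K. K \<ge> 1}"
      using index_neq_Minf(1) by (auto simp: eq_commute[of Minf])
    obtain K where K: "1 \<le> K" "Fin (omega_pow (1 + \<alpha>)) < IpK p (UNIV :: 'a set) K"
      using less less_lub_extended_iff[OF ne Minf] by blast
    then have "[] \<in> derived any (Tp p (UNIV :: 'a set) K) (omega_pow (1 + \<alpha>))"
      using less_IpK_iff[OF p K(1)] by blast
    then have "[] \<in> derived any (Tp p (UNIV :: 'a set) K) (omega * omega_pow \<alpha>)"
      by (rule derived_antimono[OF omega_mult_omega_pow_le])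
    then have "[] \<in> derived (far E) (TpE p UNIV E (4 * K)) (omega_pow \<alpha>)"
      by (rule derived_Tp_imp_TpE[OF E p K(1)])
    moreover have K4: "1 \<le> 4 * K" using K(1) by simp
    ultimately have "Fin (omega_pow \<alpha>) < IapEK p UNIV E (4 * K)"
      using less_IapEK_iff[OF E p K4] by blast
    also have "\<dots> < IapE p UNIV E" by (rule IapE_omega_pow(2)[OF inf E p finE(2) K4])
    finally show False unfolding \<alpha> by simp
  qed
  ultimately show ?thesis using \<alpha> \<beta> \<gamma> omega_pow_le_cancel by blast
qed

theorem proposition4p1:
  fixes p :: ereal and K :: real and lam :: "('a::banach + 'u) ordinal"
  assumes "\<not> (\<exists>B :: 'a set. finite B \<and> span B = UNIV)"
    and "1 \<le> p" and "1 \<le> K" and "is_limit lam"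
  shows
    "(\<forall>(F :: ('a \<Rightarrow>\<^sub>L real) set) Y.
        finite F \<and> Y = (\<Inter>f\<in>F. {x. blinfun_apply f x = 0}) \<longrightarrow>
        (IpK p (UNIV :: 'a set) K > Fin lam \<longleftrightarrow> IpK p Y K > Fin lam)) \<and>
     (\<forall>(E :: nat \<Rightarrow> 'a set) m Y F.
        is_fdd UNIV E \<and> Y = closure (span (\<Union>n\<in>{m..}. E n)) \<and> F = (\<lambda>n. E (m + n)) \<longrightarrow>
        (IpEK p UNIV E K > Fin lam \<longleftrightarrow> IpEK p Y F K > Fin lam)) \<and>
     (\<forall>(E :: nat \<Rightarrow> 'a set) m Y F.
        is_fdd UNIV E \<and> Y = closure (span (\<Union>n\<in>{m..}. E n)) \<and> F = (\<lambda>n. E (m + n)) \<longrightarrow>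
        (IapEK p UNIV E K :: ('a + 'u) ordinal extended) = IapEK p Y F K) \<and>
     ((Ip p (UNIV :: 'a set) :: ('a + 'u) ordinal extended) = Pinf \<or>
      (\<exists>\<xi> :: ('a + 'u) ordinal. Ip p (UNIV :: 'a set) = Fin (omega_pow \<xi>))) \<and>
     (\<forall>E :: nat \<Rightarrow> 'a set. is_fdd UNIV E \<longrightarrow>
        (Ip p (UNIV :: 'a set) :: ('a + 'u) ordinal extended) = Pinf \<or>
        (\<exists>\<alpha> \<beta> \<gamma> :: ('a + 'u) ordinal. \<alpha> \<le> \<beta> \<and> \<beta> \<le> \<gamma> \<and> \<gamma> \<le> 1 + \<alpha> \<and>
           IapE p UNIV E = Fin (omega_pow \<alpha>) \<and>
           IpE p UNIV E = Fin (omega_pow \<beta>) \<and>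
           Ip p (UNIV :: 'a set) = Fin (omega_pow \<gamma>))) \<and>
     ((Ip p (UNIV :: 'a set) :: ('a + 'u) ordinal extended) \<noteq> Pinf \<longrightarrow>
        (IpK p (UNIV :: 'a set) K :: ('a + 'u) ordinal extended) < Ip p UNIV) \<and>
     (\<forall>E :: nat \<Rightarrow> 'a set. is_fdd UNIV E \<longrightarrow>
        ((IpE p UNIV E :: ('a + 'u) ordinal extended) \<noteq> Pinf \<longrightarrow>
           (IpEK p UNIV E K :: ('a + 'u) ordinal extended) < IpE p UNIV E) \<and>
        ((IapE p UNIV E :: ('a + 'u) ordinal extended) \<noteq> Pinf \<longrightarrow>
           (IapEK p UNIV E K :: ('a + 'u) ordinal extended) < IapE p UNIV E))"
proof (intro conjI allI impI, goal_cases)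
  case (1 F Y)
  then show ?case using IpK_kernel_iff[OF assms(2,3) _ assms(4), of F] by simp
next
  case (2 E m Y F)
  then have E: "is_fdd UNIV E" and YF: "Y = fdd_tail E m" "F = (\<lambda>n. E (m + n))"
    using closure_span_tail[of E m] by simp_all
  show ?case unfolding YF by (rule IpEK_tail_iff[OF E assms(2,3,4)])
next
  case (3 E m Y F)
  then have E: "is_fdd UNIV E" and YF: "Y = fdd_tail E m" "F = (\<lambda>n. E (m + n))"
    using closure_span_tail[of E m] by simp_all
  show ?case unfolding YF by (rule IapEK_tail_eq[OF E assms(2,3)])
next
  case 4
  show ?case using Ip_omega_pow(1)[OF assms(1,2)] by blast
next
  case (5 E)
  then show ?case using index_exponents[OF assms(1) _ assms(2)] by blast
next
  case 6
  then show ?case by (rule Ip_omega_pow(2)[OF assms(1,2) _ assms(3)])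
next
  case (7 E)
  then show ?case by (intro IpE_omega_pow(2)[OF assms(1) _ assms(2) _ assms(3)])
next
  case (8 E)
  then show ?case by (intro IapE_omega_pow(2)[OF assms(1) _ assms(2) _ assms(3)])
qed

end
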